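(* Let $M$ be a smooth manifold of real dimension $2n$ with a linear connection $\nabla$, let $\pi:\mathcal Z^0\to M$ be the bundle of all linear complex structures on the tangent spaces of $M$, and let $j,j_1,j_2:M\to\mathcal Z^0$ be three smooth sections (almost complex structures on $M$). Then: (a) $j_1$ is $(j_2,\mathcal J^{j})$-holomorphic if and only if $j_2=j$ and condition $A(j,j_1)$ is satisfied; (b) in particular, $j$ is $(j,\mathcal J^{j})$-holomorphic if and only if $A(j,j)$ is satisfied; (c) $j_1$ is $(j,\mathcal J^\nabla)$-holomorphic if and only if $j_1=j$ and $A(j,j)$ is satisfied.
   Context: $\mathcal Z^0$ is the bundle whose fibre over $x$ is $\{J\in \mathrm{End}(T_xM): J^2=-1\}$. The vertical tangent space $\mathcal V_{J}=\ker d\pi_J$ at $J\in\mathcal Z^0$ is identified with the endomorphisms $A$ of $T_{\pi(J)}M$ with $AJ=-JA$, and has complex structure $A\mapsto JA$. Let $\Phi$ be the canonical section of $\mathrm{End}(\pi^*TM)$, $\Phi_J=J$; the map $\pi^*\nabla_{\cdot}\Phi$ is a projection $T\mathcal Z^0\to\mathcal V$ whose kernel is the horizontal distribution $\mathcal H^\nabla$, so that $T\mathcal Z^0=\mathcal H^\nabla\oplus\mathcal V$ and $d\pi:\mathcal H^\nabla_J\to T_{\pi(J)}M$ is an isomorphism. Two almost complex structures on $\mathcal Z^0$ preserving this splitting are considered. Both equal $A\mapsto JA$ on $\mathcal V_J$. On $\mathcal H^\nabla_J$, via $d\pi$, $\mathcal J^\nabla$ is $J$ itself, whereas $\mathcal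 J^{j}$ (for a fixed section $j$) is $j_{\pi(J)}$. A section $s:M\to\mathcal Z^0$ is $(j',\mathcal J)$-holomorphic, for an almost complex structure $j'$ on $M$ and $\mathcal J$ on $\mathcal Z^0$, if $ds(j'X)=\mathcal J\,ds(X)$ for all $X\in TM$. For an almost complex structure $j$, $\mathfrak X^{+,j}$ denotes the space of vector fields of type $(1,0)$ with respect to $j$, i.e. sections of the $+i$-eigenbundle of $j$ in $TM\otimes\mathbb C$. For almost complex structures $j,j_1$, the connection $\nabla$ satisfies condition $A(j,j_1)$ if $\nabla_{X}Y\in\mathfrak X^{+,j_1}$ for all $X\in\mathfrak X^{+,j}$ and $Y\in\mathfrak X^{+,j_1}$. *)

theory Defs
  imports "HOL-Analysis.Analysis" "HOL-Library.Function_Algebras"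
begin

text \<open>Pointwise scalar multiplication; together with \<^theory>\<open>HOL-Library.Function_Algebras\<close> it makes
  tangent vectors, vector fields and endomorphisms elements of real vector spaces.\<close>

instantiation "fun" :: (type, real_vector) real_vector
begin

definition scaleR_fun :: "real \<Rightarrow> ('a \<Rightarrow> 'b) \<Rightarrow> 'a \<Rightarrow> 'b" where
  "scaleR_fun r f = (\<lambda>x. r *\<^sub>R f x)"

instance
  by standard (auto simp: scaleR_fun_def plus_fun_def scaleR_add_right scaleR_add_left)

end

section \<open>Smooth manifolds\<close>

text \<open>Used only for open \<open>S\<close> in a finite-dimensional space, where continuity of all iterated
  directional derivatives of order at most \<open>k\<close> is the same as being $C^k$.\<close>

primrec Ck_on :: "nat \<Rightarrow> 'a::real_normed_vector set \<Rightarrow> ('a \<Rightarrow> 'b::real_normed_vector) \<Rightarrow> bool" where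
  "Ck_on 0 S f \<longleftrightarrow> continuous_on S f"
| "Ck_on (Suc k) S f \<longleftrightarrow> (\<forall>x\<in>S. f differentiable (at x)) \<and>
     (\<forall>v. Ck_on k S (\<lambda>x. frechet_derivative f (at x) v))"

definition smooth_on :: "'a::real_normed_vector set \<Rightarrow> ('a \<Rightarrow> 'b::real_normed_vector) \<Rightarrow> bool" where
  "smooth_on S f \<longleftrightarrow> (\<forall>k. Ck_on k S f)"

text \<open>A chart is a pair of its domain and its coordinate map (whose values off the domain are
  irrelevant).  A manifold is given by an atlas \<open>A\<close>; its points and its topology are determined
  by \<open>A\<close>.\<close>

type_synonym ('p, 'e) chart = "'p set \<times> ('p \<Rightarrow> 'e)"

definition carrier :: "('p, 'e) chart set \<Rightarrow> 'p set" where
  "carrier A = (\<Union>c\<in>A. fst c)"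

definition chart_inv :: "('p, 'e) chart \<Rightarrow> 'e \<Rightarrow> 'p" where
  "chart_inv c = inv_into (fst c) (snd c)"

definition atlas_open :: "('p, 'e::real_normed_vector) chart set \<Rightarrow> 'p set \<Rightarrow> bool" where
  "atlas_open A W \<longleftrightarrow> W \<subseteq> carrier A \<and> (\<forall>c\<in>A. open (snd c ` (W \<inter> fst c)))"

definition atlas_topology :: "('p, 'e::real_normed_vector) chart set \<Rightarrow> 'p topology" where
  "atlas_topology A = topology (atlas_open A)"

definition smooth_atlas :: "('p, 'e::real_normed_vector) chart set \<Rightarrow> bool" where
  "smooth_atlas A \<longleftrightarrow>
     (\<forall>c\<in>A. inj_on (snd c) (fst c) \<and> open (snd c ` fst c)) \<and>
     (\<forall>c\<in>A. \<forall>d\<in>A. open (snd c ` (fst c \<inter> fst d)) \<and>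
        smooth_on (snd c ` (fst c \<inter> fst d)) (snd d \<circ> chart_inv c))"

lemma openin_atlas_topology:
  assumes "smooth_atlas A"
  shows "openin (atlas_topology A) = atlas_open A"
proof -
  have "istopology (atlas_open A)"
    unfolding istopology_def
  proof (intro conjI allI impI)
    fix S T assume S: "atlas_open A S" and T: "atlas_open A T"
    have "snd c ` (S \<inter> T \<inter> fst c) = snd c ` (S \<inter> fst c) \<inter> snd c ` (T \<inter> fst c)" if "c \<in> A" for c
      using inj_on_image_Int[of "snd c" "fst c" "S \<inter> fst c" "T \<inter> fst c"] that assms
      by (simp add: smooth_atlas_def Int_ac)
    with S T show "atlas_open A (S \<inter> T)"
      by (auto simp: atlas_open_def)
  next
    fix K assume "\<forall>S\<in>K. atlas_open A S"
    moreover have "snd c ` (\<Union>K \<inter> fst c) = (\<Union>S\<in>K. snd c ` (S \<inter> fst c))" for c :: "('a, 'b) chart"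
      by auto
    ultimately show "atlas_open A (\<Union>K)"
      by (auto simp: atlas_open_def)
  qed
  then show ?thesis
    by (simp add: atlas_topology_def)
qed

definition smooth_manifold :: "('p, 'e::real_normed_vector) chart set \<Rightarrow> bool" where
  "smooth_manifold A \<longleftrightarrow> smooth_atlas A \<and>
     Hausdorff_space (atlas_topology A) \<and> second_countable (atlas_topology A)"

text \<open>A normed space regarded as a manifold.\<close>

definition model_chart :: "('e, 'e) chart" where
  "model_chart = (UNIV, \<lambda>x. x)"

definition smooth_map_on ::
  "('p, 'e::real_normed_vector) chart set \<Rightarrow> ('q, 'f::real_normed_vector) chart set \<Rightarrow>
    'p set \<Rightarrow> ('p \<Rightarrow> 'q) \<Rightarrow> bool" where
  "smooth_map_on A B W f \<longleftrightarrow>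
     (\<forall>x\<in>W. \<exists>c\<in>A. \<exists>d\<in>B. \<exists>U. atlas_open A U \<and> x \<in> U \<and> U \<subseteq> W \<inter> fst c \<and> f ` U \<subseteq> fst d \<and>
        smooth_on (snd c ` U) (snd d \<circ> f \<circ> chart_inv c))"

definition smooth_fun_on :: "('p, 'e::real_normed_vector) chart set \<Rightarrow> 'p set \<Rightarrow> ('p \<Rightarrow> real) \<Rightarrow> bool" where
  "smooth_fun_on A W f \<longleftrightarrow> smooth_map_on A {model_chart} W f"

section \<open>Tangent vectors and differentials\<close>

text \<open>A tangent vector at \<open>x\<close> assigns to each chart around \<open>x\<close> its coordinate vector in this chart,
  compatibly with the differentials of the transition maps.  Charts which are irrelevant are
  assigned \<open>0\<close>, so that vectors are determined by their coordinates; in particular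
  \<open>tangent_space A x = {0}\<close> if \<open>x\<close> is not a point of the manifold.\<close>

type_synonym ('p, 'e) tvec = "('p, 'e) chart \<Rightarrow> 'e"

definition tangent_space :: "('p, 'e::real_normed_vector) chart set \<Rightarrow> 'p \<Rightarrow> ('p, 'e) tvec set" where
  "tangent_space A x = {v.
     (\<forall>c\<in>A. \<forall>d\<in>A. x \<in> fst c \<inter> fst d \<longrightarrow>
        v d = frechet_derivative (snd d \<circ> chart_inv c) (at (snd c x)) (v c)) \<and>
     (\<forall>c. \<not> (c \<in> A \<and> x \<in> fst c) \<longrightarrow> v c = 0)}"

definition chart_at :: "('p, 'e) chart set \<Rightarrow> 'p \<Rightarrow> ('p, 'e) chart" where
  "chart_at A x = (SOME c. c \<in> A \<and> x \<in> fst c)"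

text \<open>The differential at \<open>x\<close> of a map \<open>f\<close> between manifolds (the result does not depend on the
  chart chosen around \<open>x\<close>).\<close>

definition differential ::
  "('p, 'e::real_normed_vector) chart set \<Rightarrow> ('q, 'f::real_normed_vector) chart set \<Rightarrow>
    ('p \<Rightarrow> 'q) \<Rightarrow> 'p \<Rightarrow> ('p, 'e) tvec \<Rightarrow> ('q, 'f) tvec" where
  "differential A B f x v = (\<lambda>d. if d \<in> B \<and> f x \<in> fst d
     then frechet_derivative (snd d \<circ> f \<circ> chart_inv (chart_at A x)) (at (snd (chart_at A x) x))
            (v (chart_at A x))
     else 0)"

definition dir_deriv ::
  "('p, 'e::real_normed_vector) chart set \<Rightarrow> ('p \<Rightarrow> real) \<Rightarrow> 'p \<Rightarrow> ('p, 'e) tvec \<Rightarrow> real" where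
  "dir_deriv A f x v = differential A {model_chart} f x v model_chart"

definition velocity ::
  "('p, 'e::real_normed_vector) chart set \<Rightarrow> (real \<Rightarrow> 'p) \<Rightarrow> real \<Rightarrow> ('p, 'e) tvec" where
  "velocity A \<gamma> t = (\<lambda>c. if c \<in> A \<and> \<gamma> t \<in> fst c then vector_derivative (snd c \<circ> \<gamma>) (at t) else 0)"

text \<open>Tangent space of a submanifold \<open>S\<close>: velocities of curves in \<open>S\<close>.\<close>

definition sub_tangent_space ::
  "('p, 'e::real_normed_vector) chart set \<Rightarrow> 'p set \<Rightarrow> 'p \<Rightarrow> ('p, 'e) tvec set" where
  "sub_tangent_space A S p = {velocity A \<gamma> 0 |\<gamma>. \<gamma> 0 = p \<and>
     (\<exists>\<epsilon>>0. \<gamma> ` {-\<epsilon><..<\<epsilon>} \<subseteq> S \<and> smooth_map_on {model_chart} A {-\<epsilon><..<\<epsilon>} \<gamma>)}"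

section \<open>The tangent bundle and its endomorphism bundle\<close>

definition TM_chart ::
  "('p, 'e::real_normed_vector) chart set \<Rightarrow> ('p, 'e) chart \<Rightarrow> ('p \<times> ('p, 'e) tvec, 'e \<times> 'e) chart" where
  "TM_chart A c = ({(x, v). x \<in> fst c \<and> v \<in> tangent_space A x}, \<lambda>(x, v). (snd c x, v c))"

definition TM_atlas ::
  "('p, 'e::real_normed_vector) chart set \<Rightarrow> ('p \<times> ('p, 'e) tvec, 'e \<times> 'e) chart set" where
  "TM_atlas A = TM_chart A ` A"

text \<open>Vector fields are \<open>0\<close> off the manifold, so that two of them are equal as functions iff they
  agree on the manifold.\<close>

definition vector_fields :: "('p, 'e::real_normed_vector) chart set \<Rightarrow> ('p \<Rightarrow> ('p, 'e) tvec) set" where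
  "vector_fields A = {X. (\<forall>x\<in>carrier A. X x \<in> tangent_space A x) \<and> (\<forall>x. x \<notin> carrier A \<longrightarrow> X x = 0) \<and>
     smooth_map_on A (TM_atlas A) (carrier A) (\<lambda>x. (x, X x))}"

type_synonym ('p, 'e) tendo = "('p, 'e) tvec \<Rightarrow> ('p, 'e) tvec"

text \<open>Linear endomorphisms of the tangent space at \<open>x\<close>, extended by \<open>0\<close> off the tangent space.\<close>

definition endos :: "('p, 'e::real_normed_vector) chart set \<Rightarrow> 'p \<Rightarrow> ('p, 'e) tendo set" where
  "endos A x = {J.
     (\<forall>v\<in>tangent_space A x. J v \<in> tangent_space A x) \<and>
     (\<forall>v\<in>tangent_space A x. \<forall>w\<in>tangent_space A x. J (v + w) = J v + J w) \<and>
     (\<forall>r. \<forall>v\<in>tangent_space A x. J (r *\<^sub>R v) = r *\<^sub>R J v) \<and>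
     (\<forall>v. v \<notin> tangent_space A x \<longrightarrow> J v = 0)}"

text \<open>The tangent vector at \<open>x\<close> with coordinate vector \<open>w\<close> in the chart \<open>c\<close>.\<close>

definition coord_vec ::
  "('p, 'e::real_normed_vector) chart set \<Rightarrow> ('p, 'e) chart \<Rightarrow> 'p \<Rightarrow> 'e \<Rightarrow> ('p, 'e) tvec" where
  "coord_vec A c x w = (\<lambda>d. if d \<in> A \<and> x \<in> fst d
     then frechet_derivative (snd d \<circ> chart_inv c) (at (snd c x)) w else 0)"

definition End_chart ::
  "('p, 'e::real_normed_vector) chart set \<Rightarrow> ('p, 'e) chart \<Rightarrow>
    ('p \<times> ('p, 'e) tendo, 'e \<times> ('e \<Rightarrow>\<^sub>L 'e)) chart" where
  "End_chart A c = ({(x, J). x \<in> fst c \<and> J \<in> endos A x},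
     \<lambda>(x, J). (snd c x, Blinfun (\<lambda>w. J (coord_vec A c x w) c)))"

definition End_atlas ::
  "('p, 'e::real_normed_vector) chart set \<Rightarrow> ('p \<times> ('p, 'e) tendo, 'e \<times> ('e \<Rightarrow>\<^sub>L 'e)) chart set" where
  "End_atlas A = End_chart A ` A"

section \<open>The bundle of linear complex structures\<close>

definition cstructs :: "('p, 'e::real_normed_vector) chart set \<Rightarrow> 'p \<Rightarrow> ('p, 'e) tendo set" where
  "cstructs A x = {J \<in> endos A x. \<forall>v\<in>tangent_space A x. J (J v) = - v}"

definition Z0 :: "('p, 'e::real_normed_vector) chart set \<Rightarrow> ('p \<times> ('p, 'e) tendo) set" where
  "Z0 A = {(x, J). x \<in> carrier A \<and> J \<in> cstructs A x}"

text \<open>Smooth sections of \<open>Z0\<close>; their values off the manifold are irrelevant.\<close>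

definition almost_complex_structure ::
  "('p, 'e::real_normed_vector) chart set \<Rightarrow> ('p \<Rightarrow> ('p, 'e) tendo) \<Rightarrow> bool" where
  "almost_complex_structure A j \<longleftrightarrow> (\<forall>x\<in>carrier A. j x \<in> cstructs A x) \<and>
     smooth_map_on A (End_atlas A) (carrier A) (\<lambda>x. (x, j x))"

text \<open>\<open>Z0\<close> is a submanifold of the total space of the endomorphism bundle; its tangent vectors are
  tangent vectors of the latter.\<close>

type_synonym ('p, 'e) Ztvec = "('p \<times> ('p, 'e) tendo, 'e \<times> ('e \<Rightarrow>\<^sub>L 'e)) tvec"

definition TZ0 ::
  "('p, 'e::real_normed_vector) chart set \<Rightarrow> 'p \<times> ('p, 'e) tendo \<Rightarrow> ('p, 'e) Ztvec set" where
  "TZ0 A p = sub_tangent_space (End_atlas A) (Z0 A) p"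

definition dproj ::
  "('p, 'e::real_normed_vector) chart set \<Rightarrow> 'p \<times> ('p, 'e) tendo \<Rightarrow> ('p, 'e) Ztvec \<Rightarrow> ('p, 'e) tvec" where
  "dproj A p = differential (End_atlas A) A fst p"

definition vertical ::
  "('p, 'e::real_normed_vector) chart set \<Rightarrow> 'p \<times> ('p, 'e) tendo \<Rightarrow> ('p, 'e) Ztvec set" where
  "vertical A p = {\<xi> \<in> TZ0 A p. dproj A p \<xi> = 0}"

text \<open>Vertical tangent vectors at \<open>(x, J)\<close> are identified with the endomorphisms which anticommute
  with \<open>J\<close> in the usual way for a submanifold of a vector space: \<open>B\<close> corresponds to the velocity at
  time \<open>0\<close> of \<open>t \<mapsto> J + t B\<close> in the fibre over \<open>x\<close>.\<close>

definition vert_of_endo ::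
  "('p, 'e::real_normed_vector) chart set \<Rightarrow> 'p \<times> ('p, 'e) tendo \<Rightarrow> ('p, 'e) tendo \<Rightarrow> ('p, 'e) Ztvec" where
  "vert_of_endo A p B = velocity (End_atlas A) (\<lambda>t. (fst p, snd p + t *\<^sub>R B)) 0"

definition endo_of_vert ::
  "('p, 'e::real_normed_vector) chart set \<Rightarrow> 'p \<times> ('p, 'e) tendo \<Rightarrow> ('p, 'e) Ztvec \<Rightarrow> ('p, 'e) tendo" where
  "endo_of_vert A p \<xi> = (THE B. B \<in> endos A (fst p) \<and>
     (\<forall>v\<in>tangent_space A (fst p). B (snd p v) = - snd p (B v)) \<and> vert_of_endo A p B = \<xi>)"

section \<open>Linear connections\<close>

type_synonym ('p, 'e) conn =
  "('p \<Rightarrow> ('p, 'e) tvec) \<Rightarrow> ('p \<Rightarrow> ('p, 'e) tvec) \<Rightarrow> 'p \<Rightarrow> ('p, 'e) tvec"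

definition linear_connection ::
  "('p, 'e::real_normed_vector) chart set \<Rightarrow> ('p, 'e) conn \<Rightarrow> bool" where
  "linear_connection A D \<longleftrightarrow>
     (\<forall>X\<in>vector_fields A. \<forall>Y\<in>vector_fields A.
        D X Y \<in> vector_fields A \<and>
        (\<forall>X'\<in>vector_fields A. D (X + X') Y = D X Y + D X' Y) \<and>
        (\<forall>Y'\<in>vector_fields A. D X (Y + Y') = D X Y + D X Y') \<and>
        (\<forall>f. smooth_fun_on A (carrier A) f \<longrightarrow>
           D (\<lambda>x. f x *\<^sub>R X x) Y = (\<lambda>x. f x *\<^sub>R D X Y x) \<and>
           D X (\<lambda>x. f x *\<^sub>R Y x) = (\<lambda>x. dir_deriv A f x (X x) *\<^sub>R Y x + f x *\<^sub>R D X Y x)))"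

text \<open>The derivative at \<open>x\<close> of \<open>Y\<close> in the direction of the single tangent vector \<open>u\<close>.\<close>

definition cov_deriv_at ::
  "('p, 'e::real_normed_vector) chart set \<Rightarrow> ('p, 'e) conn \<Rightarrow> 'p \<Rightarrow> ('p, 'e) tvec \<Rightarrow>
    ('p \<Rightarrow> ('p, 'e) tvec) \<Rightarrow> ('p, 'e) tvec" where
  "cov_deriv_at A D x u Y = (THE z. \<exists>X\<in>vector_fields A. X x = u \<and> z = D X Y x)"

text \<open>The pull-back of the connection to the pull-back of the tangent bundle to \<open>Z0\<close>, applied to a
  section \<open>\<sigma>\<close> at \<open>p\<close> in direction \<open>\<xi>\<close>: if \<open>\<sigma> = (\<Sum>i<k. s i * (Y i \<circ> \<pi>))\<close> near \<open>p\<close> with smooth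
  functions \<open>s i\<close> on \<open>Z0\<close> (locally restrictions of smooth functions on the ambient endomorphism
  bundle) and vector fields \<open>Y i\<close> on the base, then the Leibniz rule and the defining property
  of the pull-back connection on the sections \<open>Y i \<circ> \<pi>\<close> determine its value.\<close>

definition pullback_deriv ::
  "('p, 'e::real_normed_vector) chart set \<Rightarrow> ('p, 'e) conn \<Rightarrow> 'p \<times> ('p, 'e) tendo \<Rightarrow> ('p, 'e) Ztvec \<Rightarrow>
    ('p \<times> ('p, 'e) tendo \<Rightarrow> ('p, 'e) tvec) \<Rightarrow> ('p, 'e) tvec" where
  "pullback_deriv A D p \<xi> \<sigma> = (THE z. \<exists>(k::nat) s Y W.
     atlas_open (End_atlas A) W \<and> p \<in> W \<and>
     (\<forall>i<k. smooth_fun_on (End_atlas A) W (s i) \<and> Y i \<in> vector_fields A) \<and>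
     (\<forall>q\<in>W \<inter> Z0 A. \<sigma> q = (\<Sum>i<k. s i q *\<^sub>R Y i (fst q))) \<and>
     z = (\<Sum>i<k. dir_deriv (End_atlas A) (s i) p \<xi> *\<^sub>R Y i (fst p) +
                s i p *\<^sub>R cov_deriv_at A D (fst p) (dproj A p \<xi>) (Y i)))"

text \<open>The induced connection on the endomorphisms of the pulled back tangent bundle, at the vector
  \<open>y\<close>, with \<open>y\<close> extended to a section pulled back from the base.\<close>

definition pullback_deriv_End ::
  "('p, 'e::real_normed_vector) chart set \<Rightarrow> ('p, 'e) conn \<Rightarrow> 'p \<times> ('p, 'e) tendo \<Rightarrow> ('p, 'e) Ztvec \<Rightarrow>
    ('p \<times> ('p, 'e) tendo \<Rightarrow> ('p, 'e) tendo) \<Rightarrow> ('p, 'e) tendo" where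
  "pullback_deriv_End A D p \<xi> \<Psi> = (\<lambda>y. if y \<in> tangent_space A (fst p)
     then THE z. \<exists>Y\<in>vector_fields A. Y (fst p) = y \<and>
        z = pullback_deriv A D p \<xi> (\<lambda>q. \<Psi> q (Y (fst q))) - \<Psi> p (pullback_deriv A D p \<xi> (\<lambda>q. Y (fst q)))
     else 0)"

definition canonical_section :: "'p \<times> ('p, 'e) tendo \<Rightarrow> ('p, 'e) tendo" where
  "canonical_section p = snd p"

definition horizontal ::
  "('p, 'e::real_normed_vector) chart set \<Rightarrow> ('p, 'e) conn \<Rightarrow> 'p \<times> ('p, 'e) tendo \<Rightarrow> ('p, 'e) Ztvec set" where
  "horizontal A D p = {\<xi> \<in> TZ0 A p. pullback_deriv_End A D p \<xi> canonical_section = 0}"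

section \<open>Almost complex structures on the bundle, and holomorphic sections\<close>

text \<open>The endomorphism of the tangent space of \<open>Z0\<close> at \<open>p = (x, J)\<close> which preserves the splitting,
  is \<open>a\<close> on the horizontal part (via the projection) and \<open>B \<mapsto> J B\<close> on the vertical part.\<close>

definition split_structure ::
  "('p, 'e::real_normed_vector) chart set \<Rightarrow> ('p, 'e) conn \<Rightarrow> ('p, 'e) tendo \<Rightarrow>
    'p \<times> ('p, 'e) tendo \<Rightarrow> ('p, 'e) Ztvec \<Rightarrow> ('p, 'e) Ztvec" where
  "split_structure A D a p \<xi> = (THE \<eta>.
     \<exists>h\<in>horizontal A D p. \<exists>v\<in>vertical A p. \<exists>h'\<in>horizontal A D p. \<exists>v'\<in>vertical A p.
       \<xi> = h + v \<and> \<eta> = h' + v' \<and>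
       dproj A p h' = a (dproj A p h) \<and>
       endo_of_vert A p v' = snd p \<circ> endo_of_vert A p v)"

definition J_nabla ::
  "('p, 'e::real_normed_vector) chart set \<Rightarrow> ('p, 'e) conn \<Rightarrow>
    'p \<times> ('p, 'e) tendo \<Rightarrow> ('p, 'e) Ztvec \<Rightarrow> ('p, 'e) Ztvec" where
  "J_nabla A D p = split_structure A D (snd p) p"

definition J_section ::
  "('p, 'e::real_normed_vector) chart set \<Rightarrow> ('p, 'e) conn \<Rightarrow> ('p \<Rightarrow> ('p, 'e) tendo) \<Rightarrow>
    'p \<times> ('p, 'e) tendo \<Rightarrow> ('p, 'e) Ztvec \<Rightarrow> ('p, 'e) Ztvec" where
  "J_section A D j p = split_structure A D (j (fst p)) p"

definition holomorphic_section ::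
  "('p, 'e::real_normed_vector) chart set \<Rightarrow> ('p \<Rightarrow> ('p, 'e) tendo) \<Rightarrow>
    ('p \<times> ('p, 'e) tendo \<Rightarrow> ('p, 'e) Ztvec \<Rightarrow> ('p, 'e) Ztvec) \<Rightarrow> ('p \<Rightarrow> ('p, 'e) tendo) \<Rightarrow> bool" where
  "holomorphic_section A j' \<J> s \<longleftrightarrow> (\<forall>x\<in>carrier A. \<forall>X\<in>tangent_space A x.
     differential A (End_atlas A) (\<lambda>y. (y, s y)) x (j' x X) =
     \<J> (x, s x) (differential A (End_atlas A) (\<lambda>y. (y, s y)) x X))"

text \<open>Sections of the complexified tangent bundle are pairs \<open>(X, Y)\<close> of vector fields, standing for
  \<open>X + \<i> Y\<close>, so that multiplication by \<open>\<i>\<close> is \<open>(X, Y) \<mapsto> (- Y, X)\<close>.\<close>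

type_synonym ('p, 'e) cfield = "('p \<Rightarrow> ('p, 'e) tvec) \<times> ('p \<Rightarrow> ('p, 'e) tvec)"

definition type10_fields ::
  "('p, 'e::real_normed_vector) chart set \<Rightarrow> ('p \<Rightarrow> ('p, 'e) tendo) \<Rightarrow> ('p, 'e) cfield set" where
  "type10_fields A j = {(X, Y). X \<in> vector_fields A \<and> Y \<in> vector_fields A \<and>
     (\<forall>x\<in>carrier A. (j x (X x), j x (Y x)) = (- Y x, X x))}"

definition complex_conn :: "('p, 'e::real_normed_vector) conn \<Rightarrow> ('p, 'e) cfield \<Rightarrow> ('p, 'e) cfield \<Rightarrow> ('p, 'e) cfield" where
  "complex_conn D X Y =
     (D (fst X) (fst Y) - D (snd X) (snd Y), D (fst X) (snd Y) + D (snd X) (fst Y))"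

definition condition_A ::
  "('p, 'e::real_normed_vector) chart set \<Rightarrow> ('p, 'e) conn \<Rightarrow>
    ('p \<Rightarrow> ('p, 'e) tendo) \<Rightarrow> ('p \<Rightarrow> ('p, 'e) tendo) \<Rightarrow> bool" where
  "condition_A A D j j\<^sub>1 \<longleftrightarrow>
     (\<forall>X\<in>type10_fields A j. \<forall>Y\<in>type10_fields A j\<^sub>1. complex_conn D X Y \<in> type10_fields A j\<^sub>1)"

end

theory Submission
  imports Defs
begin

text \<open>
  Everything is local, so the proof is a computation in a chart \<open>c\<close> around a point \<open>x\<close>. There a linear
  connection has the form \<open>D\<^sub>u Y = dY u + \<Gamma> u Y\<close> (\<open>connection_in_chart\<close>). The endomorphism bundle has
  coordinates \<open>(a, B)\<close>, a point and an operator, and \<open>Z0\<close> is the set \<open>B\<^sup>2 = -1\<close>. Its tangent vectors at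
  \<open>(x, J)\<close> are the pairs \<open>(u, b)\<close> in which \<open>b\<close> anticommutes with \<open>J\<close> (\<open>TZ0_iff\<close>).

  The pulled back connection applied to the canonical section in the direction \<open>(u, b)\<close> is
  \<open>b + [\<Gamma> u, J]\<close> (\<open>pullback_deriv_End_coords\<close>). Hence \<open>(u, b)\<close> is horizontal if \<open>b = - [\<Gamma> u, J]\<close> and
  vertical if \<open>u = 0\<close>, and the almost complex structure which is \<open>a\<close> on the horizontal part sends
  \<open>(u, b)\<close> to \<open>(a u, J (b + [\<Gamma> u, J]) - [\<Gamma> (a u), J])\<close> (\<open>split_structure_coords\<close>).

  A section \<open>s\<close> has the differential \<open>u \<mapsto> (u, ds u)\<close>, and its covariant derivative is
  \<open>\<nabla>\<^sub>u s = ds u + [\<Gamma> u, s]\<close>. Comparing the two components of \<open>ds (j' u)\<close> with the image of \<open>ds u\<close>, one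
  finds that \<open>s\<close> is holomorphic iff \<open>j' = a\<close> and \<open>\<nabla>\<^bsub>a u\<^esub> s = s (\<nabla>\<^sub>u s)\<close> for all \<open>u\<close>
  (\<open>holomorphic_at_iff\<close>). On the other hand, fields of type \<open>(1,0)\<close> are \<open>a Y + \<i> Y\<close> and \<open>s W + \<i> W\<close>
  with real fields \<open>Y\<close> and \<open>W\<close>, and by the product rule the complex covariant derivative of the
  second along the first is of type \<open>(1,0)\<close> for \<open>s\<close> iff \<open>(\<nabla>\<^bsub>a Y\<^esub> s) W = s (\<nabla>\<^sub>Y s) W\<close>
  (\<open>condition_A_at_iff\<close>). So \<open>s\<close> is holomorphic iff \<open>j' = a\<close> and condition A holds for \<open>a\<close> and \<open>s\<close>
  (\<open>holomorphic_section_iff\<close>), and the three claims are the cases \<open>a = j\<close>, \<open>a = s = j\<close> and \<open>a = s\<close>.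

  The remaining work is the passage between fields and vectors. The connection acts on global vector
  fields, so a smooth bump function is needed to extend tangent vectors to fields and to show that
  the connection is local; and the tangent vectors of \<open>Z0\<close> are velocities of curves, so curves with
  prescribed velocity have to be constructed.
\<close>

section \<open>Smooth maps between normed spaces\<close>

lemma Ck_on_subset: "Ck_on k S f \<Longrightarrow> T \<subseteq> S \<Longrightarrow> Ck_on k T f"
  by (induction k arbitrary: f) (auto intro: continuous_on_subset)

lemma Ck_on_cong:
  fixes f g :: "'a::real_normed_vector \<Rightarrow> 'b::real_normed_vector"
  assumes "open S" "\<And>x. x \<in> S \<Longrightarrow> f x = g x" "Ck_on k S f"
  shows "Ck_on k S g"
  using assms(2,3)
proof (induction k arbitrary: f g)
  case 0
  then show ?case by (simp cong: continuous_on_cong)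
next
  case (Suc k)
  have d: "(g has_derivative frechet_derivative f (at x)) (at x)" if "x \<in> S" for x
    by (rule has_derivative_transform_within_open[of f _ _ _ S])
      (use that Suc.prems assms(1) in \<open>auto simp: frechet_derivative_works[symmetric]\<close>)
  then have "frechet_derivative f (at x) = frechet_derivative g (at x)" if "x \<in> S" for x
    using frechet_derivative_at that by blast
  then have "Ck_on k S (\<lambda>x. frechet_derivative g (at x) v)" for v
    using Suc.prems by - (rule Suc.IH[of "\<lambda>x. frechet_derivative f (at x) v"], auto)
  with d show ?case by (auto simp: differentiable_def)
qed

text \<open>Most closure properties below rest on this rule and an induction on the order: the
  derivative is exhibited as a function of the point and the direction, and for a fixed direction it
  is built from maps to which the induction hypothesis applies.\<close>

lemma Ck_on_SucI:
  assumes "\<And>x. x \<in> S \<Longrightarrow> (f has_derivative F x) (at x)"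
    and "\<And>v. Ck_on k S (\<lambda>x. F x v)" and "open S"
  shows "Ck_on (Suc k) S f"
proof -
  have "F x = frechet_derivative f (at x)" if "x \<in> S" for x
    using assms(1)[OF that] by (rule frechet_derivative_at)
  then have "Ck_on k S (\<lambda>x. frechet_derivative f (at x) v)" for v
    by (intro Ck_on_cong[OF assms(3) _ assms(2)[of v]]) simp
  then show ?thesis
    using assms(1) by (auto simp: differentiable_def)
qed

lemma Ck_on_Suc_has_derivative:
  "Ck_on (Suc k) S f \<Longrightarrow> x \<in> S \<Longrightarrow> (f has_derivative frechet_derivative f (at x)) (at x)"
  by (simp add: frechet_derivative_works[symmetric])

lemma Ck_on_continuous_on: "Ck_on k S f \<Longrightarrow> continuous_on S f"
  by (cases k) (auto intro!: continuous_at_imp_continuous_on differentiable_imp_continuous_within)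

lemma Ck_on_Suc_lower: "Ck_on (Suc k) S f \<Longrightarrow> Ck_on k S f"
proof (induction k arbitrary: f)
  case 0
  then show ?case using Ck_on_continuous_on by fastforce
next
  case (Suc k)
  have "Ck_on k S (\<lambda>x. frechet_derivative f (at x) v)" for v
    by (rule Suc.IH) (metis Suc.prems Ck_on.simps(2))
  moreover have "\<forall>x\<in>S. f differentiable (at x)"
    using Suc.prems by (metis Ck_on.simps(2))
  ultimately show ?case by simp
qed

lemma Ck_on_const: "open S \<Longrightarrow> Ck_on k S (\<lambda>x. c)"
  by (induction k arbitrary: c) (auto intro: continuous_on_const)

lemma Ck_on_linear_compose:
  assumes "open S" "bounded_linear L" "Ck_on k S f"
  shows "Ck_on k S (\<lambda>x. L (f x))"
  using assms(3)
proof (induction k arbitrary: f)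
  case 0
  then show ?case using assms(2) by (simp add: bounded_linear.continuous_on)
next
  case (Suc k)
  show ?case
  proof (rule Ck_on_SucI)
    show "((\<lambda>x. L (f x)) has_derivative (\<lambda>v. L (frechet_derivative f (at x) v))) (at x)" if "x \<in> S" for x
      using Ck_on_Suc_has_derivative[OF Suc.prems that] by (rule bounded_linear.has_derivative[OF assms(2)])
    show "Ck_on k S (\<lambda>x. L (frechet_derivative f (at x) v))" for v
      using Suc.prems by - (rule Suc.IH, simp)
  qed (rule assms(1))
qed

lemma Ck_on_linear:
  assumes "open S" "bounded_linear L"
  shows "Ck_on k S L"
proof (cases k)
  case 0
  then show ?thesis using assms(2) by (simp add: linear_continuous_on)
next
  case (Suc m)
  have "Ck_on (Suc m) S L"
    by (rule Ck_on_SucI[where F = "\<lambda>x v. L v"])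
      (use assms in \<open>auto intro!: bounded_linear_imp_has_derivative Ck_on_const\<close>)
  with Suc show ?thesis by simp
qed

lemma Ck_on_add:
  assumes "open S" "Ck_on k S f" "Ck_on k S g"
  shows "Ck_on k S (\<lambda>x. f x + g x)"
  using assms(2,3)
proof (induction k arbitrary: f g)
  case 0
  then show ?case by (simp add: continuous_on_add)
next
  case (Suc k)
  show ?case
    by (rule Ck_on_SucI[where F = "\<lambda>x v. frechet_derivative f (at x) v + frechet_derivative g (at x) v"])
      (use Suc assms in \<open>auto intro!: has_derivative_add simp: frechet_derivative_works[symmetric]\<close>)
qed

lemma Ck_on_bilinear:
  assumes "open S" "bounded_bilinear B" "Ck_on k S f" "Ck_on k S g"
  shows "Ck_on k S (\<lambda>x. B (f x) (g x))"
  using assms(3,4)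
proof (induction k arbitrary: f g)
  case 0
  then show ?case using assms(2) by (simp add: bounded_bilinear.continuous_on)
next
  case (Suc k)
  show ?case
    by (rule Ck_on_SucI[where F = "\<lambda>x v. B (f x) (frechet_derivative g (at x) v) + B (frechet_derivative f (at x) v) (g x)"])
      (use Suc Suc.prems[THEN Ck_on_Suc_lower] assms(1,2) in \<open>auto intro!: bounded_bilinear.FDERIV Ck_on_add
        simp: frechet_derivative_works[symmetric]\<close>)
qed

lemma Ck_on_sum:
  assumes "open S" "\<And>i. i \<in> I \<Longrightarrow> Ck_on k S (f i)"
  shows "Ck_on k S (\<lambda>x. \<Sum>i\<in>I. f i x)"
proof (cases "finite I")
  case True
  then show ?thesis using assms(2)
    by (induction I) (simp_all add: Ck_on_const Ck_on_add assms(1))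
qed (simp add: Ck_on_const assms(1))

text \<open>The intermediate space is finite-dimensional because the directional derivative of a
  composition is expanded in a basis: this turns the varying direction \<open>f' x v\<close> into scalar
  coefficients in front of derivatives of \<open>g\<close> in fixed directions.\<close>

lemma Ck_on_compose:
  fixes f :: "'a::real_normed_vector \<Rightarrow> 'b::euclidean_space" and g :: "'b \<Rightarrow> 'c::real_normed_vector"
  assumes "open S" "open T" "f ` S \<subseteq> T" "Ck_on k S f" "Ck_on k T g"
  shows "Ck_on k S (\<lambda>x. g (f x))"
  using assms(4,5)
proof (induction k arbitrary: g)
  case 0
  then show ?case using assms(3) by (auto intro: continuous_on_compose2)
next
  case (Suc k)
  let ?f = "\<lambda>x. frechet_derivative f (at x)" and ?g = "\<lambda>y. frechet_derivative g (at y)"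
  have fk: "Ck_on k S f" using Suc.prems(1) by (rule Ck_on_Suc_lower)
  have eq: "?g y w = (\<Sum>i\<in>Basis. (w \<bullet> i) *\<^sub>R ?g y i)" if "y \<in> T" for y w
  proof -
    have "linear (?g y)" using that Suc.prems(2) by (intro linear_frechet_derivative) auto
    then show ?thesis
      by (subst euclidean_representation[symmetric, of w]) (simp add: linear_sum linear_cmul)
  qed
  show ?case
  proof (rule Ck_on_SucI[where F = "\<lambda>x v. \<Sum>i\<in>Basis. (?f x v \<bullet> i) *\<^sub>R ?g (f x) i"])
    fix x assume x: "x \<in> S"
    then have "f x \<in> T" using assms(3) by auto
    then have "((\<lambda>x. g (f x)) has_derivative (\<lambda>v. ?g (f x) (?f x v))) (at x)"
      using x Suc.prems assms(3)
      by (auto intro!: has_derivative_compose[where f = f and g = g] simp: frechet_derivative_works[symmetric])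
    then show "((\<lambda>x. g (f x)) has_derivative (\<lambda>v. \<Sum>i\<in>Basis. (?f x v \<bullet> i) *\<^sub>R ?g (f x) i)) (at x)"
      by (simp only: eq[OF \<open>f x \<in> T\<close>, symmetric])
  next
    fix v
    have "Ck_on k S (\<lambda>x. ?g (f x) i)" for i
      using Suc.prems fk by - (rule Suc.IH, auto)
    moreover have "Ck_on k S (\<lambda>x. ?f x v \<bullet> i)" for i
      using Suc.prems by (intro Ck_on_linear_compose[OF assms(1) bounded_linear_inner_left]) auto
    ultimately show "Ck_on k S (\<lambda>x. \<Sum>i\<in>Basis. (?f x v \<bullet> i) *\<^sub>R ?g (f x) i)"
      by (intro Ck_on_sum assms(1) Ck_on_bilinear[OF assms(1) bounded_bilinear_scaleR])
  qed (use assms(1) in auto)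
qed

lemma Ck_on_local:
  assumes "\<And>x. x \<in> S \<Longrightarrow> \<exists>T. open T \<and> x \<in> T \<and> Ck_on k T f"
  shows "Ck_on k S f"
  using assms
proof (induction k arbitrary: f)
  case 0
  have "isCont f x" if x: "x \<in> S" for x
  proof -
    obtain T where T: "open T" "x \<in> T" "Ck_on 0 T f" using 0 x by blast
    then show ?thesis using continuous_on_eq_continuous_at by auto
  qed
  then show ?case by (simp add: continuous_at_imp_continuous_on)
next
  case (Suc k)
  have "f differentiable (at x)" if x: "x \<in> S" for x
  proof -
    obtain T where T: "open T" "x \<in> T" "Ck_on (Suc k) T f" using Suc.prems x by blast
    then show ?thesis by simp
  qed
  moreover have "Ck_on k S (\<lambda>x. frechet_derivative f (at x) v)" for v
  proof (rule Suc.IH)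
    fix x assume x: "x \<in> S"
    obtain T where T: "open T" "x \<in> T" "Ck_on (Suc k) T f" using Suc.prems x by blast
    then show "\<exists>T. open T \<and> x \<in> T \<and> Ck_on k T (\<lambda>x. frechet_derivative f (at x) v)" by auto
  qed
  ultimately show ?case by simp
qed

lemma Ck_on_inverse:
  fixes f :: "'a::real_normed_vector \<Rightarrow> real"
  assumes "open S" "Ck_on k S f" "\<And>x. x \<in> S \<Longrightarrow> f x \<noteq> 0"
  shows "Ck_on k S (\<lambda>x. inverse (f x))"
  using assms(2)
proof (induction k)
  case 0
  then show ?case using assms(3) by (auto intro: continuous_on_inverse)
next
  case (Suc k)
  have inv: "Ck_on k S (\<lambda>x. inverse (f x))" using Suc Ck_on_Suc_lower by blast
  show ?case
  proof (rule Ck_on_SucI[where F = "\<lambda>x v. - (inverse (f x) * frechet_derivative f (at x) v * inverse (f x))"])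
    fix x assume "x \<in> S"
    then show "((\<lambda>x. inverse (f x)) has_derivative
        (\<lambda>v. - (inverse (f x) * frechet_derivative f (at x) v * inverse (f x)))) (at x)"
      using Suc.prems assms(3) by (intro Deriv.has_derivative_inverse) (auto simp: frechet_derivative_works[symmetric])
  next
    fix v
    show "Ck_on k S (\<lambda>x. - (inverse (f x) * frechet_derivative f (at x) v * inverse (f x)))"
      using Suc.prems inv assms(1)
      by (intro Ck_on_linear_compose[where L = uminus] Ck_on_bilinear[where B = "(*)"] bounded_bilinear_mult
          bounded_linear_minus bounded_linear_ident) auto
  qed (use assms(1) in auto)
qed

lemma smooth_on_subset: "smooth_on S f \<Longrightarrow> T \<subseteq> S \<Longrightarrow> smooth_on T f"
  unfolding smooth_on_def by (metis Ck_on_subset)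

lemma smooth_on_cong: "open S \<Longrightarrow> (\<And>x. x \<in> S \<Longrightarrow> f x = g x) \<Longrightarrow> smooth_on S f \<Longrightarrow> smooth_on S g"
  unfolding smooth_on_def using Ck_on_cong[of S f g] by simp

lemma smooth_on_has_derivative:
  "smooth_on S f \<Longrightarrow> x \<in> S \<Longrightarrow> (f has_derivative frechet_derivative f (at x)) (at x)"
  unfolding smooth_on_def by (erule allE, erule Ck_on_Suc_has_derivative)

lemma smooth_on_continuous_on: "smooth_on S f \<Longrightarrow> continuous_on S f"
  unfolding smooth_on_def by (erule allE, erule Ck_on_continuous_on)

lemma smooth_on_directional_derivative: "smooth_on S f \<Longrightarrow> smooth_on S (\<lambda>x. frechet_derivative f (at x) v)"
  unfolding smooth_on_def
proof
  show "Ck_on k S (\<lambda>x. frechet_derivative f (at x) v)" if "\<forall>k. Ck_on k S f" for k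
    using that[rule_format, of "Suc k"] by simp
qed

lemma smooth_on_const: "open S \<Longrightarrow> smooth_on S (\<lambda>x. c)"
  by (simp add: smooth_on_def Ck_on_const)

lemma smooth_on_linear: "open S \<Longrightarrow> bounded_linear L \<Longrightarrow> smooth_on S L"
  by (simp add: smooth_on_def Ck_on_linear)

lemma smooth_on_linear_compose: "open S \<Longrightarrow> bounded_linear L \<Longrightarrow> smooth_on S f \<Longrightarrow> smooth_on S (\<lambda>x. L (f x))"
  by (simp add: smooth_on_def Ck_on_linear_compose)

lemma smooth_on_add: "open S \<Longrightarrow> smooth_on S f \<Longrightarrow> smooth_on S g \<Longrightarrow> smooth_on S (\<lambda>x. f x + g x)"
  by (simp add: smooth_on_def Ck_on_add)

lemma smooth_on_bilinear:
  "open S \<Longrightarrow> bounded_bilinear B \<Longrightarrow> smooth_on S f \<Longrightarrow> smooth_on S g \<Longrightarrow> smooth_on S (\<lambda>x. B (f x) (g x))"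
  by (simp add: smooth_on_def Ck_on_bilinear)

lemmas smooth_on_scaleR = smooth_on_bilinear[OF _ bounded_bilinear_scaleR]
lemmas smooth_on_blinfun_apply = smooth_on_bilinear[OF _ bounded_bilinear_blinfun_apply]
lemmas smooth_on_blinfun_compose = smooth_on_bilinear[OF _ bounded_bilinear_blinfun_compose]
lemmas smooth_on_inner = smooth_on_bilinear[OF _ bounded_bilinear_inner]
lemmas smooth_on_mult = smooth_on_bilinear[OF _ bounded_bilinear_mult]

lemma smooth_on_minus: "open S \<Longrightarrow> smooth_on S f \<Longrightarrow> smooth_on S (\<lambda>x. - f x)"
  by (rule smooth_on_linear_compose[OF _ bounded_linear_minus[OF bounded_linear_ident]])

lemma smooth_on_sum: "open S \<Longrightarrow> (\<And>i. i \<in> I \<Longrightarrow> smooth_on S (f i)) \<Longrightarrow> smooth_on S (\<lambda>x. \<Sum>i\<in>I. f i x)"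
  by (simp add: smooth_on_def Ck_on_sum)

lemma smooth_on_compose:
  fixes f :: "'a::real_normed_vector \<Rightarrow> 'b::euclidean_space"
  shows "open S \<Longrightarrow> open T \<Longrightarrow> f ` S \<subseteq> T \<Longrightarrow> smooth_on S f \<Longrightarrow> smooth_on T g \<Longrightarrow> smooth_on S (\<lambda>x. g (f x))"
  by (simp add: smooth_on_def Ck_on_compose)

lemma smooth_on_local:
  assumes "\<And>x. x \<in> S \<Longrightarrow> \<exists>T. open T \<and> x \<in> T \<and> smooth_on T f"
  shows "smooth_on S f"
  unfolding smooth_on_def
proof
  show "Ck_on k S f" for k
    using assms by (intro Ck_on_local) (auto simp: smooth_on_def)
qed

lemma smooth_on_inverse:
  fixes f :: "'a::real_normed_vector \<Rightarrow> real"
  shows "open S \<Longrightarrow> smooth_on S f \<Longrightarrow> (\<And>x. x \<in> S \<Longrightarrow> f x \<noteq> 0) \<Longrightarrow> smooth_on S (\<lambda>x. inverse (f x))"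
  by (simp add: smooth_on_def Ck_on_inverse)

lemma smooth_on_Pair:
  assumes "open S" "smooth_on S f" "smooth_on S g"
  shows "smooth_on S (\<lambda>x. (f x, g x))"
proof -
  have "smooth_on S (\<lambda>x. (f x, 0) + (0, g x))"
    by (intro smooth_on_add[OF assms(1)]
        smooth_on_linear_compose[OF assms(1) _ assms(2), where L = "\<lambda>y. (y, 0)"]
        smooth_on_linear_compose[OF assms(1) _ assms(3), where L = "\<lambda>y. (0, y)"]
        bounded_linear_Pair bounded_linear_ident bounded_linear_zero)
  then show ?thesis by simp
qed

lemma smooth_on_fst: "open S \<Longrightarrow> smooth_on S f \<Longrightarrow> smooth_on S (\<lambda>x. fst (f x))"
  by (rule smooth_on_linear_compose[OF _ bounded_linear_fst])

lemma smooth_on_snd: "open S \<Longrightarrow> smooth_on S f \<Longrightarrow> smooth_on S (\<lambda>x. snd (f x))"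
  by (rule smooth_on_linear_compose[OF _ bounded_linear_snd])

lemma smooth_on_ident: "open S \<Longrightarrow> smooth_on S (\<lambda>x. x)"
  by (simp add: smooth_on_linear bounded_linear_ident)

text \<open>An operator-valued map is a linear combination, with constant operators as coefficients, of
  its values on a basis.\<close>

lemma smooth_on_blinfun:
  fixes f :: "'a::real_normed_vector \<Rightarrow> ('b::euclidean_space \<Rightarrow>\<^sub>L 'c::real_normed_vector)"
  assumes "open S" "\<And>w. smooth_on S (\<lambda>x. blinfun_apply (f x) w)"
  shows "smooth_on S f"
proof -
  have "smooth_on S (\<lambda>x. \<Sum>i\<in>Basis. blinfun_scaleR_left (f x i) o\<^sub>L blinfun_inner_right i)"
    using assms by (intro smooth_on_sum smooth_on_blinfun_compose smooth_on_const
        smooth_on_linear_compose[OF _ bounded_linear_blinfun_scaleR_left])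
  moreover have "(\<Sum>i\<in>Basis. blinfun_scaleR_left (f x i) o\<^sub>L blinfun_inner_right i) = f x" for x
  proof (rule blinfun_eqI)
    fix w
    have "f x w = f x (\<Sum>i\<in>Basis. (w \<bullet> i) *\<^sub>R i)" by (simp add: euclidean_representation)
    then show "blinfun_apply (\<Sum>i\<in>Basis. blinfun_scaleR_left (f x i) o\<^sub>L blinfun_inner_right i) w = f x w"
      by (simp add: blinfun.sum_right blinfun.scaleR_right blinfun.sum_left inner_commute)
  qed
  ultimately show ?thesis by simp
qed

lemma blinfun_compose_id [simp]: "id_blinfun o\<^sub>L A = A" "A o\<^sub>L id_blinfun = A"
  by (auto intro!: blinfun_eqI)

section \<open>A smooth bump function\<close>

text \<open>The functions \<open>p (1 / t) e\<^bsup>-1/t\<^esup>\<close>, continued by \<open>0\<close> to \<open>t \<le> 0\<close>: a class closed under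
  differentiation, so its members are smooth.\<close>

definition flat_fun :: "real poly \<Rightarrow> real \<Rightarrow> real" where
  "flat_fun p t = (if 0 < t then poly p (inverse t) * exp (- inverse t) else 0)"

lemma poly_times_exp_minus_tendsto_0: "((\<lambda>y. poly p y * exp (- y)) \<longlongrightarrow> (0::real)) at_top"
proof -
  have "((\<lambda>y. \<Sum>i\<le>degree p. coeff p i * (y ^ i / exp y)) \<longlongrightarrow> (\<Sum>i\<le>degree p. coeff p i * 0)) at_top"
    by (intro tendsto_sum tendsto_mult tendsto_const tendsto_power_div_exp_0)
  moreover have "poly p y * exp (- y) = (\<Sum>i\<le>degree p. coeff p i * (y ^ i / exp y))" for y
    by (simp add: poly_altdef exp_minus sum_distrib_right field_simps sum_divide_distrib)
  ultimately show ?thesis by simp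
qed

lemma flat_fun_tendsto_0: "(flat_fun p \<longlongrightarrow> 0) (at 0)"
proof -
  have "((\<lambda>t. poly p (inverse t) * exp (- inverse t)) \<longlongrightarrow> 0) (at_right (0::real))"
    by (rule filterlim_compose[OF poly_times_exp_minus_tendsto_0 filterlim_inverse_at_top_right])
  then have "(flat_fun p \<longlongrightarrow> 0) (at_right 0)"
    by (rule Lim_transform_eventually) (auto simp: flat_fun_def eventually_at_right_less eventually_at_filter)
  moreover have "(flat_fun p \<longlongrightarrow> 0) (at_left 0)"
    by (rule Lim_transform_eventually[OF tendsto_const]) (auto simp: flat_fun_def eventually_at_filter)
  ultimately show ?thesis using filterlim_split_at by blast
qed

lemma flat_fun_has_derivative:
  "(flat_fun p has_real_derivative flat_fun ([:0, 0, 1:] * (p - pderiv p)) t) (at t)"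
proof -
  consider "t < 0" | "t = 0" | "0 < t" by linarith
  then show ?thesis
  proof cases
    case 1
    have "(flat_fun p has_real_derivative 0) (at t)"
      by (rule has_field_derivative_transform_within_open[of "\<lambda>_. 0" _ _ "{..<0}"])
        (use 1 in \<open>auto simp: flat_fun_def\<close>)
    then show ?thesis using 1 by (simp add: flat_fun_def)
  next
    case 2
    have "((\<lambda>h. flat_fun ([:0, 1:] * p) h) \<longlongrightarrow> 0) (at 0)" by (rule flat_fun_tendsto_0)
    moreover have "flat_fun ([:0, 1:] * p) h = (flat_fun p (0 + h) - flat_fun p 0) / h" for h
      by (simp add: flat_fun_def field_simps)
    ultimately show ?thesis using 2 by (simp add: DERIV_def flat_fun_def)
  next
    case 3
    let ?D = "(poly p (inverse t) - poly (pderiv p) (inverse t)) * (inverse t)\<^sup>2 * exp (- inverse t)"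
    have "((\<lambda>t. poly p (inverse t) * exp (- inverse t)) has_real_derivative ?D) (at t)"
      using 3 by (auto intro!: derivative_eq_intros DERIV_chain2[OF poly_DERIV] simp: algebra_simps power2_eq_square)
    then have "(flat_fun p has_real_derivative ?D) (at t)"
      by (rule has_field_derivative_transform_within_open[of _ _ _ "{0<..}"])
        (use 3 in \<open>auto simp: flat_fun_def\<close>)
    then show ?thesis using 3 by (simp add: flat_fun_def power2_eq_square algebra_simps)
  qed
qed

lemma smooth_on_flat_fun: "smooth_on UNIV (flat_fun p)"
proof -
  have "Ck_on k UNIV (flat_fun p)" for k
  proof (induction k arbitrary: p)
    case 0
    show ?case using flat_fun_has_derivative
      by (auto intro!: continuous_at_imp_continuous_on DERIV_isCont)
  next
    case (Suc k)
    show ?case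
      by (rule Ck_on_SucI[where F = "\<lambda>x v. flat_fun ([:0, 0, 1:] * (p - pderiv p)) x * v"])
        (use flat_fun_has_derivative in \<open>auto simp: has_field_derivative_def
          intro!: Suc Ck_on_linear_compose[where L = "\<lambda>y. y * _"] bounded_linear_mult_left\<close>)
  qed
  then show ?thesis by (simp add: smooth_on_def)
qed

text \<open>The square of the distance from \<open>a\<close> has derivative \<open>0\<close> at \<open>a\<close>, and so has every function of it;
  this replaces the usual plateau.\<close>

lemma bump_function_exists:
  fixes a :: "'a::euclidean_space"
  assumes "0 < r"
  obtains \<phi> :: "'a \<Rightarrow> real" where "smooth_on UNIV \<phi>" "\<phi> a = 1" "(\<phi> has_derivative (\<lambda>_. 0)) (at a)"
    "\<And>x. x \<in> ball a r \<Longrightarrow> \<phi> x \<noteq> 0" "\<And>x. x \<notin> ball a r \<Longrightarrow> \<phi> x = 0"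
proof -
  define f where "f = flat_fun 1"
  define q where "q x = r\<^sup>2 - (x - a) \<bullet> (x - a)" for x
  define \<phi> where "\<phi> x = inverse (f (r\<^sup>2)) * f (q x)" for x
  have f0: "f (r\<^sup>2) \<noteq> 0" using assms by (simp add: f_def flat_fun_def)
  have "smooth_on UNIV (\<lambda>x. x - a)"
    using smooth_on_add[OF open_UNIV smooth_on_ident smooth_on_const, of "- a"] by simp
  then have "smooth_on UNIV (\<lambda>x. r\<^sup>2 + - ((x - a) \<bullet> (x - a)))"
    by (intro smooth_on_add smooth_on_minus smooth_on_const smooth_on_inner open_UNIV)
  then have q: "smooth_on UNIV q" by (simp add: q_def[abs_def])
  have "smooth_on UNIV (\<lambda>x. f (q x))"
    by (rule smooth_on_compose[OF open_UNIV open_UNIV _ q]) (simp_all add: f_def smooth_on_flat_fun)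
  then have "smooth_on UNIV \<phi>"
    unfolding \<phi>_def[abs_def] by (intro smooth_on_mult smooth_on_const open_UNIV)
  moreover have "\<phi> a = 1" using f0 by (simp add: \<phi>_def q_def)
  moreover have "(\<phi> has_derivative (\<lambda>_. 0)) (at a)"
  proof -
    have qd: "(q has_derivative (\<lambda>h. 0)) (at a)"
      unfolding q_def by (auto intro!: derivative_eq_intros)
    have fd: "(f has_derivative (*) (flat_fun ([:0, 0, 1:] * (1 - pderiv 1)) (q a))) (at (q a))"
      using flat_fun_has_derivative[of 1] by (simp add: f_def has_field_derivative_def)
    show ?thesis
      unfolding \<phi>_def using has_derivative_compose[OF qd fd] by (auto intro!: derivative_eq_intros)
  qed
  moreover have "\<phi> x \<noteq> 0" if "x \<in> ball a r" for x
  proof -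
    have "(norm (x - a))\<^sup>2 < r\<^sup>2"
      using that assms by (intro power_strict_mono) (auto simp: dist_norm norm_minus_commute)
    then show ?thesis using f0 by (simp add: \<phi>_def f_def flat_fun_def q_def power2_norm_eq_inner)
  qed
  moreover have "\<phi> x = 0" if "x \<notin> ball a r" for x
  proof -
    have "r\<^sup>2 \<le> (norm (x - a))\<^sup>2"
      using that assms by (intro power_mono) (auto simp: dist_norm norm_minus_commute)
    then show ?thesis by (simp add: \<phi>_def f_def flat_fun_def q_def power2_norm_eq_inner)
  qed
  ultimately show ?thesis using that by blast
qed

section \<open>Inverting a curve of operators through the identity\<close>

text \<open>The resolvent identity \<open>G t - G s = (s - t) G t C G s\<close> for \<open>G t = (1 + t C)\<^sup>-\<^sup>1\<close> shows first that
  \<open>G' = - G C G\<close>, and this equation then gives one more derivative at each step.\<close>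

lemma smooth_inverse_curve:
  fixes C :: "'a::euclidean_space \<Rightarrow>\<^sub>L 'a"
  obtains \<epsilon> G where "0 < \<epsilon>" "smooth_on {-\<epsilon><..<\<epsilon>} G" "G 0 = id_blinfun"
    "\<And>t. t \<in> {-\<epsilon><..<\<epsilon>} \<Longrightarrow> (id_blinfun + t *\<^sub>R C) o\<^sub>L G t = id_blinfun"
    "\<And>t. t \<in> {-\<epsilon><..<\<epsilon>} \<Longrightarrow> G t o\<^sub>L (id_blinfun + t *\<^sub>R C) = id_blinfun"
    "(G has_vector_derivative - C) (at 0)"
proof -
  define \<epsilon> where "\<epsilon> = inverse (2 * (norm C + 1))"
  define I where "I = {-\<epsilon><..<\<epsilon>}"
  define P where "P t = id_blinfun + t *\<^sub>R C" for t
  have \<epsilon>: "0 < \<epsilon>" by (simp add: \<epsilon>_def add_nonneg_pos)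
  \<comment> \<open>by the choice of \<open>\<epsilon>\<close> the operator \<open>t C\<close> has norm at most \<open>1/2\<close>\<close>
  have lower: "norm w \<le> 2 * norm (P t w)" if t: "t \<in> I" for t w
  proof -
    have "norm (t *\<^sub>R C w) \<le> \<bar>t\<bar> * (norm C * norm w)" by (simp add: mult_left_mono norm_blinfun)
    also have "\<dots> \<le> \<epsilon> * ((norm C + 1) * norm w)"
      using t \<epsilon> by (intro mult_mono) (auto simp: I_def mult_right_mono)
    also have "\<dots> = norm w / 2"
    proof -
      have "norm C + 1 \<noteq> 0" using norm_ge_zero[of C] by linarith
      then show ?thesis by (simp add: \<epsilon>_def field_simps)
    qed
    finally have "norm (t *\<^sub>R C w) \<le> norm w / 2" .
    moreover have "w = P t w - t *\<^sub>R C w" by (simp add: P_def blinfun.add_left blinfun.scaleR_left)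
    then have "norm w \<le> norm (P t w) + norm (t *\<^sub>R C w)" by (metis norm_triangle_ineq4)
    ultimately show ?thesis by linarith
  qed
  have "\<exists>K. P t o\<^sub>L K = id_blinfun \<and> K o\<^sub>L P t = id_blinfun" if t: "t \<in> I" for t
  proof -
    have lin: "linear (blinfun_apply (P t))" by (simp add: blinfun.bounded_linear_right bounded_linear.linear)
    have "inj (blinfun_apply (P t))"
      unfolding linear_injective_0[OF lin]
    proof (intro allI impI)
      fix w assume "P t w = 0"
      then show "w = 0" using lower[OF t, of w] by simp
    qed
    then obtain g where g: "linear g" "\<forall>x. g (P t x) = x" "\<forall>x. P t (g x) = x"
      using linear_injective_isomorphism[OF lin] by blast
    then have "blinfun_apply (Blinfun g) = g" by (simp add: bounded_linear_Blinfun_apply linear_conv_bounded_linear)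
    then show ?thesis using g by (intro exI[of _ "Blinfun g"]) (auto intro!: blinfun_eqI)
  qed
  then obtain G where PG: "\<And>t. t \<in> I \<Longrightarrow> P t o\<^sub>L G t = id_blinfun" and GP: "\<And>t. t \<in> I \<Longrightarrow> G t o\<^sub>L P t = id_blinfun"
    by metis
  have bound: "norm (G t) \<le> 2" if "t \<in> I" for t
  proof (rule norm_blinfun_bound)
    fix w
    have "P t (G t w) = w" using PG[OF that] by (metis blinfun_apply_blinfun_compose blinfun_apply_id_blinfun)
    then show "norm (G t w) \<le> 2 * norm w" using lower[OF that, of "G t w"] by simp
  qed simp
  have resolvent: "G t - G s = (t - s) *\<^sub>R - (G t o\<^sub>L C o\<^sub>L G s)" if "t \<in> I" "s \<in> I" for t s
  proof -
    have PGw: "P s (G s w) = w" and GPw: "G t (P t w) = w" for w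
      using PG[OF that(2)] GP[OF that(1)] by (metis blinfun_apply_blinfun_compose blinfun_apply_id_blinfun)+
    then have "G t o\<^sub>L (P s - P t) o\<^sub>L G s = G t - G s"
      by (intro blinfun_eqI) (simp add: blinfun.diff_left blinfun.diff_right)
    moreover have "P s - P t = (s - t) *\<^sub>R C" by (simp add: P_def algebra_simps)
    then have "G t o\<^sub>L (P s - P t) o\<^sub>L G s = (s - t) *\<^sub>R (G t o\<^sub>L C o\<^sub>L G s)"
      by (intro blinfun_eqI) (simp add: blinfun.scaleR_left blinfun.scaleR_right)
    ultimately show ?thesis by (simp add: scaleR_diff_left)
  qed
  have der: "(G has_vector_derivative - (G s o\<^sub>L C o\<^sub>L G s)) (at s)" if s: "s \<in> I" for s
    unfolding has_vector_derivative_def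
  proof (rule has_derivativeI_sandwich[where e = "\<epsilon> - \<bar>s\<bar>" and H = "\<lambda>t. norm (t - s) * (8 * norm C * norm C)"])
    show "0 < \<epsilon> - \<bar>s\<bar>" using s by (auto simp: I_def)
    show "bounded_linear (\<lambda>h. h *\<^sub>R - (G s o\<^sub>L C o\<^sub>L G s))"
      by (rule bounded_linear_scaleR_left)
    have "((\<lambda>t. norm (t - s) * (8 * norm C * norm C)) \<longlongrightarrow> norm (s - s) * (8 * norm C * norm C)) (at s)"
      by (intro tendsto_intros)
    then show "((\<lambda>t. norm (t - s) * (8 * norm C * norm C)) \<longlongrightarrow> 0) (at s)" by simp
    fix t assume ts: "t \<noteq> s" "dist t s < \<epsilon> - \<bar>s\<bar>"
    then have t: "t \<in> I" by (auto simp: I_def dist_real_def)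
    let ?c = "\<lambda>A B. A o\<^sub>L C o\<^sub>L B"
    have nc: "norm (A o\<^sub>L C o\<^sub>L B) \<le> norm A * norm C * norm B" for A B :: "'a \<Rightarrow>\<^sub>L 'a"
      by (meson norm_blinfun_compose norm_ge_zero mult_right_mono order_trans)
    have "G t - G s - (t - s) *\<^sub>R - ?c (G s) (G s) = (s - t) *\<^sub>R ?c (G t - G s) (G s)"
      using resolvent[OF t s] by (simp add: bounded_bilinear.diff_left[OF bounded_bilinear_blinfun_compose] algebra_simps)
    also have "\<dots> = (s - t) *\<^sub>R ?c ((s - t) *\<^sub>R ?c (G t) (G s)) (G s)"
      using resolvent[OF t s] by (simp only: scaleR_minus_right scaleR_minus_left[symmetric] minus_diff_eq)
    finally have "norm (G t - G s - (t - s) *\<^sub>R - ?c (G s) (G s))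
        = \<bar>t - s\<bar> * norm (?c ((s - t) *\<^sub>R ?c (G t) (G s)) (G s))" by (simp add: abs_minus_commute)
    also have "norm (?c ((s - t) *\<^sub>R ?c (G t) (G s)) (G s))
        \<le> norm ((s - t) *\<^sub>R ?c (G t) (G s)) * norm C * norm (G s)" by (rule nc)
    also have "\<dots> \<le> (\<bar>t - s\<bar> * (2 * norm C * 2)) * norm C * 2"
    proof -
      have "norm (?c (G t) (G s)) \<le> norm (G t) * norm C * norm (G s)" by (rule nc)
      also have "\<dots> \<le> 2 * norm C * 2"
        using bound[OF t] bound[OF s] by (intro mult_mono) auto
      finally have "norm ((s - t) *\<^sub>R ?c (G t) (G s)) \<le> \<bar>t - s\<bar> * (2 * norm C * 2)"
        by (simp add: abs_minus_commute mult_left_mono)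
      then show ?thesis using bound[OF s] by (intro mult_mono) auto
    qed
    finally have "norm (G t - G s - (t - s) *\<^sub>R - ?c (G s) (G s)) \<le> \<bar>t - s\<bar> * (\<bar>t - s\<bar> * (8 * norm C * norm C))"
      by (simp add: mult_left_mono)
    then show "norm (G t - G s - (t - s) *\<^sub>R - ?c (G s) (G s)) / norm (t - s) \<le> norm (t - s) * (8 * norm C * norm C)"
      using ts by (simp add: field_simps)
  qed
  have "Ck_on k I G" for k
  proof (induction k)
    case 0
    show ?case using der by (auto intro!: continuous_at_imp_continuous_on has_vector_derivative_continuous)
  next
    case (Suc k)
    show ?case
    proof (rule Ck_on_SucI[where F = "\<lambda>s h. h *\<^sub>R - (G s o\<^sub>L C o\<^sub>L G s)"])
      show "(G has_derivative (\<lambda>h. h *\<^sub>R - (G s o\<^sub>L C o\<^sub>L G s))) (at s)" if "s \<in> I" for s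
        using der[OF that] by (simp add: has_vector_derivative_def)
      show "Ck_on k I (\<lambda>s. h *\<^sub>R - (G s o\<^sub>L C o\<^sub>L G s))" for h
      proof -
        have "Ck_on k I (\<lambda>s. (- h) *\<^sub>R (G s o\<^sub>L C o\<^sub>L G s))"
          using Suc by (intro Ck_on_linear_compose[OF _ bounded_linear_scaleR_right]
              Ck_on_bilinear[OF _ bounded_bilinear_blinfun_compose] Ck_on_const) (auto simp: I_def)
        then show ?thesis by simp
      qed
    qed (auto simp: I_def)
  qed
  then have "smooth_on I G" by (simp add: smooth_on_def)
  moreover have "0 \<in> I" using \<epsilon> by (simp add: I_def)
  moreover from this have "G 0 = id_blinfun" using PG[of 0] by (simp add: P_def)
  ultimately show ?thesis
    using that[of \<epsilon> G] \<epsilon> PG GP der[of 0] by (simp add: I_def P_def)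
qed

section \<open>Charts and tangent vectors\<close>

lemma scaleR_fun_apply [simp]: "(r *\<^sub>R f) x = r *\<^sub>R f x"
  by (simp add: scaleR_fun_def)

lemma sum_fun_apply: "(\<Sum>i\<in>I. f i) x = (\<Sum>i\<in>I. f i x)"
  by (induction I rule: infinite_finite_induct) auto

text \<open>The differential at \<open>x\<close> of the change of coordinates from \<open>c\<close> to \<open>d\<close>.\<close>

definition jac :: "('p, 'e::real_normed_vector) chart \<Rightarrow> ('p, 'e) chart \<Rightarrow> 'p \<Rightarrow> 'e \<Rightarrow> 'e" where
  "jac c d x = frechet_derivative (snd d \<circ> chart_inv c) (at (snd c x))"

lemma smooth_atlas_injD: "smooth_atlas A \<Longrightarrow> c \<in> A \<Longrightarrow> inj_on (snd c) (fst c)"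
  by (simp add: smooth_atlas_def)

lemma chart_inv_chart [simp]:
  "smooth_atlas A \<Longrightarrow> c \<in> A \<Longrightarrow> x \<in> fst c \<Longrightarrow> chart_inv c (snd c x) = x"
  by (simp add: chart_inv_def smooth_atlas_injD)

lemma chart_inv_mem: "a \<in> snd c ` fst c \<Longrightarrow> chart_inv c a \<in> fst c"
  by (simp add: chart_inv_def inv_into_into)

lemma chart_chart_inv [simp]: "a \<in> snd c ` fst c \<Longrightarrow> snd c (chart_inv c a) = a"
  by (simp add: chart_inv_def f_inv_into_f)

lemma open_chart_image: "smooth_atlas A \<Longrightarrow> c \<in> A \<Longrightarrow> open (snd c ` fst c)"
  by (simp add: smooth_atlas_def)

lemma open_overlap_image: "smooth_atlas A \<Longrightarrow> c \<in> A \<Longrightarrow> d \<in> A \<Longrightarrow> open (snd c ` (fst c \<inter> fst d))"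
  by (simp add: smooth_atlas_def)

lemma smooth_on_transition:
  "smooth_atlas A \<Longrightarrow> c \<in> A \<Longrightarrow> d \<in> A \<Longrightarrow> smooth_on (snd c ` (fst c \<inter> fst d)) (snd d \<circ> chart_inv c)"
  by (simp add: smooth_atlas_def)

lemma carrierI: "c \<in> A \<Longrightarrow> x \<in> fst c \<Longrightarrow> x \<in> carrier A"
  by (auto simp: carrier_def)

lemma carrierE:
  assumes "x \<in> carrier A"
  obtains c where "c \<in> A" "x \<in> fst c"
  using assms by (auto simp: carrier_def)

lemma chart_at:
  assumes "x \<in> carrier A"
  shows "chart_at A x \<in> A" "x \<in> fst (chart_at A x)"
proof -
  have "\<exists>c. c \<in> A \<and> x \<in> fst c" using assms by (auto simp: carrier_def)
  from someI_ex[OF this] show "chart_at A x \<in> A" "x \<in> fst (chart_at A x)"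
    by (simp_all add: chart_at_def)
qed

lemma tangent_spaceI:
  assumes "\<And>c d. c \<in> A \<Longrightarrow> d \<in> A \<Longrightarrow> x \<in> fst c \<Longrightarrow> x \<in> fst d \<Longrightarrow> v d = jac c d x (v c)"
    and "\<And>c. \<not> (c \<in> A \<and> x \<in> fst c) \<Longrightarrow> v c = 0"
  shows "v \<in> tangent_space A x"
  using assms unfolding tangent_space_def jac_def by blast

lemma tangent_space_outside: "v \<in> tangent_space A x \<Longrightarrow> \<not> (c \<in> A \<and> x \<in> fst c) \<Longrightarrow> v c = 0"
  unfolding tangent_space_def by blast

context
  fixes A :: "('p, 'e::real_normed_vector) chart set"
  assumes A: "smooth_atlas A"
begin

lemma transition_has_derivative:
  assumes "c \<in> A" "d \<in> A" "x \<in> fst c" "x \<in> fst d"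
  shows "((snd d \<circ> chart_inv c) has_derivative jac c d x) (at (snd c x))"
  unfolding jac_def
  by (rule smooth_on_has_derivative[OF smooth_on_transition[OF A assms(1,2)]]) (use assms in auto)

lemma bounded_linear_jac:
  "c \<in> A \<Longrightarrow> d \<in> A \<Longrightarrow> x \<in> fst c \<Longrightarrow> x \<in> fst d \<Longrightarrow> bounded_linear (jac c d x)"
  by (rule has_derivative_bounded_linear[OF transition_has_derivative])

lemma jac_self:
  assumes "c \<in> A" "x \<in> fst c"
  shows "jac c c x w = w"
proof -
  have "((snd c \<circ> chart_inv c) has_derivative (\<lambda>w. w)) (at (snd c x))"
    by (rule has_derivative_transform_within_open[OF has_derivative_ident open_chart_image[OF A assms(1)]])
      (use assms in auto)
  then show ?thesis
    using has_derivative_unique transition_has_derivative[OF assms(1,1,2,2)] by metis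
qed

lemma jac_cocycle:
  assumes "c \<in> A" "d \<in> A" "e \<in> A" "x \<in> fst c" "x \<in> fst d" "x \<in> fst e"
  shows "jac d e x (jac c d x w) = jac c e x w"
proof -
  have "((snd e \<circ> chart_inv d) has_derivative jac d e x) (at ((snd d \<circ> chart_inv c) (snd c x)))"
    using transition_has_derivative[of d e x] assms A by simp
  from has_derivative_compose[OF transition_has_derivative[OF assms(1,2,4,5)] this]
  have "((\<lambda>a. (snd e \<circ> chart_inv d) ((snd d \<circ> chart_inv c) a)) has_derivative (\<lambda>w. jac d e x (jac c d x w)))
      (at (snd c x))" .
  then have "((snd e \<circ> chart_inv c) has_derivative (\<lambda>w. jac d e x (jac c d x w))) (at (snd c x))"
    by (rule has_derivative_transform_within_open[OF _ open_overlap_image[OF A assms(1,2)]])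
      (use assms A in auto)
  then show ?thesis
    using has_derivative_unique transition_has_derivative[OF assms(1,3,4,6)] by metis
qed

lemma tangent_space_coords:
  "v \<in> tangent_space A x \<Longrightarrow> c \<in> A \<Longrightarrow> d \<in> A \<Longrightarrow> x \<in> fst c \<Longrightarrow> x \<in> fst d \<Longrightarrow> v d = jac c d x (v c)"
  unfolding tangent_space_def jac_def by blast

text \<open>Hence a tangent vector is determined by its coordinates in a single chart, and these may be
  prescribed.\<close>

lemma tangent_vector_eqI:
  assumes "v \<in> tangent_space A x" "w \<in> tangent_space A x" "c \<in> A" "x \<in> fst c" "v c = w c"
  shows "v = w"
proof
  fix d
  show "v d = w d"
  proof (cases "d \<in> A \<and> x \<in> fst d")
    case True
    then show ?thesis
      using tangent_space_coords[of v x c d] tangent_space_coords[of w x c d] assms by simp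
  next
    case False
    then show ?thesis using tangent_space_outside[OF assms(1) False] tangent_space_outside[OF assms(2) False] by simp
  qed
qed

lemma coord_vec_in_tangent_space:
  assumes "c \<in> A" "x \<in> fst c"
  shows "coord_vec A c x w \<in> tangent_space A x"
proof (rule tangent_spaceI)
  show "coord_vec A c x w e = jac d e x (coord_vec A c x w d)"
    if "d \<in> A" "e \<in> A" "x \<in> fst d" "x \<in> fst e" for d e
    using assms that jac_cocycle[of c d e x w] by (simp add: coord_vec_def jac_def)
qed (auto simp: coord_vec_def)

lemma coord_vec_same [simp]: "c \<in> A \<Longrightarrow> x \<in> fst c \<Longrightarrow> coord_vec A c x w c = w"
  using jac_self[of c x w] by (simp add: coord_vec_def jac_def)

lemma coord_vec_coords [simp]:
  "c \<in> A \<Longrightarrow> x \<in> fst c \<Longrightarrow> v \<in> tangent_space A x \<Longrightarrow> coord_vec A c x (v c) = v"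
  by (rule tangent_vector_eqI) (auto simp: coord_vec_in_tangent_space)

lemma coord_vec_other:
  "c \<in> A \<Longrightarrow> d \<in> A \<Longrightarrow> x \<in> fst c \<Longrightarrow> x \<in> fst d \<Longrightarrow> coord_vec A c x w d = jac c d x w"
  by (simp add: coord_vec_def jac_def)

lemma zero_in_tangent_space [simp]: "0 \<in> tangent_space A x"
  by (rule tangent_spaceI) (simp_all add: linear_simps bounded_linear_jac)

lemma add_in_tangent_space:
  assumes v: "v \<in> tangent_space A x" and w: "w \<in> tangent_space A x"
  shows "v + w \<in> tangent_space A x"
proof (rule tangent_spaceI)
  show "(v + w) d = jac c d x ((v + w) c)" if "c \<in> A" "d \<in> A" "x \<in> fst c" "x \<in> fst d" for c d
    using tangent_space_coords[OF v that] tangent_space_coords[OF w that] bounded_linear_jac[OF that]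
    by (simp add: linear_simps)
qed (use v w in \<open>simp add: tangent_space_outside\<close>)

lemma scaleR_in_tangent_space:
  assumes v: "v \<in> tangent_space A x"
  shows "r *\<^sub>R v \<in> tangent_space A x"
proof (rule tangent_spaceI)
  show "(r *\<^sub>R v) d = jac c d x ((r *\<^sub>R v) c)" if "c \<in> A" "d \<in> A" "x \<in> fst c" "x \<in> fst d" for c d
    using tangent_space_coords[OF v that] bounded_linear_jac[OF that]
    by (simp add: linear_simps)
qed (use v in \<open>simp add: tangent_space_outside\<close>)

lemma minus_in_tangent_space: "v \<in> tangent_space A x \<Longrightarrow> - v \<in> tangent_space A x"
  using scaleR_in_tangent_space[of v x "-1"] by simp

lemma diff_in_tangent_space:
  "v \<in> tangent_space A x \<Longrightarrow> w \<in> tangent_space A x \<Longrightarrow> v - w \<in> tangent_space A x"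
  using add_in_tangent_space[of v x "- w"] minus_in_tangent_space[of w x] by simp

lemma sum_in_tangent_space:
  "(\<And>i. i \<in> I \<Longrightarrow> f i \<in> tangent_space A x) \<Longrightarrow> (\<Sum>i\<in>I. f i) \<in> tangent_space A x"
  by (induction I rule: infinite_finite_induct) (simp_all add: add_in_tangent_space)

lemma atlas_open_chart_image: "atlas_open A U \<Longrightarrow> c \<in> A \<Longrightarrow> open (snd c ` (U \<inter> fst c))"
  by (simp add: atlas_open_def)

lemma atlas_open_chart_domain: "c \<in> A \<Longrightarrow> atlas_open A (fst c)"
  unfolding atlas_open_def
  by (intro conjI ballI subsetI) (simp_all add: carrierI open_overlap_image[OF A] Int_commute)

text \<open>An open subset of the image of a chart corresponds to an open subset of the manifold.\<close>

lemma atlas_open_chart_inv_image: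
  assumes c: "c \<in> A" and V: "open V" "V \<subseteq> snd c ` fst c"
  shows "atlas_open A (chart_inv c ` V)"
  unfolding atlas_open_def
proof (intro conjI ballI)
  have sub: "chart_inv c ` V \<subseteq> fst c" using V(2) chart_inv_mem[of _ c] by auto
  then show "chart_inv c ` V \<subseteq> carrier A" using carrierI[OF c] by auto
  fix d assume d: "d \<in> A"
  have "snd d ` (chart_inv c ` V \<inter> fst d)
      = {b \<in> snd d ` (fst d \<inter> fst c). (snd c \<circ> chart_inv d) b \<in> V}" (is "_ = ?R")
  proof
    show "snd d ` (chart_inv c ` V \<inter> fst d) \<subseteq> ?R"
    proof
      fix b assume "b \<in> snd d ` (chart_inv c ` V \<inter> fst d)"
      then obtain a where a: "a \<in> V" "chart_inv c a \<in> fst d" "b = snd d (chart_inv c a)" by blast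
      then have "chart_inv c a \<in> fst c" "snd c (chart_inv c a) = a" using sub V(2) by auto
      then show "b \<in> ?R" using a A d by simp
    qed
    show "?R \<subseteq> snd d ` (chart_inv c ` V \<inter> fst d)"
    proof
      fix b assume "b \<in> ?R"
      then obtain y where y: "y \<in> fst d" "y \<in> fst c" "b = snd d y" "snd c y \<in> V"
        using A d by auto
      then have "y = chart_inv c (snd c y)" using A c by simp
      then show "b \<in> snd d ` (chart_inv c ` V \<inter> fst d)" using y by auto
    qed
  qed
  moreover have "continuous_on (snd d ` (fst d \<inter> fst c)) (snd c \<circ> chart_inv d)"
    by (rule smooth_on_continuous_on[OF smooth_on_transition[OF A d c]])
  from continuous_open_preimage[OF this open_overlap_image[OF A d c] V(1)]
  have "open ?R" by (simp add: Int_def vimage_def)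
  ultimately show "open (snd d ` (chart_inv c ` V \<inter> fst d))" by simp
qed

end

lemma smooth_atlas_model_chart: "smooth_atlas {model_chart :: ('e::real_normed_vector, 'e) chart}"
proof -
  have "chart_inv model_chart = (\<lambda>x :: 'e. x)"
    by (auto simp: chart_inv_def model_chart_def inv_into_def)
  then show ?thesis
    by (auto simp: smooth_atlas_def model_chart_def smooth_on_ident o_def image_def)
qed

lemma model_chart_simps [simp]:
  "fst model_chart = UNIV" "snd model_chart x = x" "chart_inv model_chart x = x" "carrier {model_chart} = UNIV"
  by (auto simp: chart_inv_def model_chart_def inv_into_def carrier_def)

lemma snd_model_chart [simp]: "snd model_chart = (\<lambda>x. x)"
  by (simp add: model_chart_def)

lemma chart_inv_model_chart [simp]: "chart_inv model_chart = (\<lambda>x. x)"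
  by (rule ext) simp

lemma atlas_open_model_chart [simp]: "atlas_open {model_chart} U \<longleftrightarrow> open U"
  by (simp add: atlas_open_def)

section \<open>Smooth maps in charts\<close>

text \<open>The definition of smoothness provides some pair of charts; every pair will do, because locally
  the two coordinate expressions differ by transition maps.\<close>

lemma smooth_map_on_chart_change:
  fixes A :: "('p, 'e::real_normed_vector) chart set" and B :: "('q, 'f::real_normed_vector) chart set"
  assumes A: "smooth_atlas A" and B: "smooth_atlas B" and f: "smooth_map_on A B W f" and x: "x \<in> W"
    and c: "c \<in> A" "x \<in> fst c" and d: "d \<in> B" "f x \<in> fst d"
  obtains c' d' V V' where "c' \<in> A" "x \<in> fst c'" "d' \<in> B" "f x \<in> fst d'"
    "open V" "snd c x \<in> V" "V \<subseteq> snd c ` (W \<inter> fst c \<inter> fst c')"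
    "open V'" "snd c' x \<in> V'" "smooth_on V' (snd d' \<circ> f \<circ> chart_inv c')"
    "(snd c' \<circ> chart_inv c) ` V \<subseteq> V'"
    "(snd d' \<circ> f \<circ> chart_inv c') ` V' \<subseteq> snd d' ` (fst d' \<inter> fst d)"
    "\<And>a. a \<in> V \<Longrightarrow> f (chart_inv c a) \<in> fst d"
    "\<And>a. a \<in> V \<Longrightarrow> (snd d \<circ> f \<circ> chart_inv c) a
        = (snd d \<circ> chart_inv d') ((snd d' \<circ> f \<circ> chart_inv c') ((snd c' \<circ> chart_inv c) a))"
proof -
  obtain c' d' U where U: "c' \<in> A" "d' \<in> B" "atlas_open A U" "x \<in> U" "U \<subseteq> W \<inter> fst c'" "f ` U \<subseteq> fst d'"
    "smooth_on (snd c' ` U) (snd d' \<circ> f \<circ> chart_inv c')"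
    using f x unfolding smooth_map_on_def by blast
  let ?F = "snd d' \<circ> f \<circ> chart_inv c'"
  define V' where "V' = {b \<in> snd c' ` U. ?F b \<in> snd d' ` (fst d' \<inter> fst d)}"
  define V where "V = {a \<in> snd c ` (fst c \<inter> fst c'). (snd c' \<circ> chart_inv c) a \<in> V'}"
  have Ufst: "U \<inter> fst c' = U" using U by auto
  have oU: "open (snd c' ` U)" using atlas_open_chart_image[OF A U(3,1)] Ufst by simp
  have "open (snd c' ` U \<inter> ?F -` (snd d' ` (fst d' \<inter> fst d)))"
    by (rule continuous_open_preimage[OF smooth_on_continuous_on[OF U(7)] oU open_overlap_image[OF B U(2) d(1)]])
  then have oV': "open V'" by (simp add: V'_def Int_def vimage_def)
  have "open (snd c ` (fst c \<inter> fst c') \<inter> (snd c' \<circ> chart_inv c) -` V')"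
    by (rule continuous_open_preimage[OF smooth_on_continuous_on[OF smooth_on_transition[OF A c(1) U(1)]]
          open_overlap_image[OF A c(1) U(1)] oV'])
  then have oV: "open V" by (simp add: V_def Int_def vimage_def)
  have xc': "x \<in> fst c'" using U by auto
  have xV': "snd c' x \<in> V'"
    using U d A xc' by (auto simp: V'_def)
  have xV: "snd c x \<in> V"
    using xV' xc' c A by (auto simp: V_def)
  have V'D: "\<exists>y\<in>U. b = snd c' y \<and> f y \<in> fst d \<and> f y \<in> fst d'" if b: "b \<in> V'" for b
  proof -
    obtain y where y: "y \<in> U" "b = snd c' y" using b by (auto simp: V'_def)
    with U have yc: "y \<in> fst c'" "f y \<in> fst d'" by auto
    then have "snd d' (f y) \<in> snd d' ` (fst d' \<inter> fst d)" using b y A U(1) by (simp add: V'_def)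
    then have "f y \<in> fst d"
      using yc(2) smooth_atlas_injD[OF B U(2)] by (auto dest: inj_onD)
    with y yc show ?thesis by blast
  qed
  have VD: "\<exists>y\<in>U. y \<in> fst c \<and> y \<in> fst c' \<and> a = snd c y \<and> f y \<in> fst d \<and> f y \<in> fst d'" if a: "a \<in> V" for a
  proof -
    obtain y where y: "y \<in> fst c" "y \<in> fst c'" "a = snd c y" "snd c' y \<in> V'"
      using a A c by (auto simp: V_def)
    obtain z where z: "z \<in> U" "snd c' y = snd c' z" "f z \<in> fst d" "f z \<in> fst d'" using V'D[OF y(4)] by blast
    then have "y = z" using y(2) U(5) smooth_atlas_injD[OF A U(1)] by (auto dest: inj_onD)
    with y z show ?thesis by blast
  qed
  show thesis
  proof
    show "V \<subseteq> snd c ` (W \<inter> fst c \<inter> fst c')" using VD U(5) by blast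
    show "smooth_on V' ?F" by (rule smooth_on_subset[OF U(7)]) (auto simp: V'_def)
    show "(snd c' \<circ> chart_inv c) ` V \<subseteq> V'" by (auto simp: V_def)
    show "?F ` V' \<subseteq> snd d' ` (fst d' \<inter> fst d)" by (auto simp: V'_def)
    show "f (chart_inv c a) \<in> fst d" if "a \<in> V" for a
      using VD[OF that] A c(1) by auto
    show "(snd d \<circ> f \<circ> chart_inv c) a
        = (snd d \<circ> chart_inv d') ((snd d' \<circ> f \<circ> chart_inv c') ((snd c' \<circ> chart_inv c) a))" if "a \<in> V" for a
      using VD[OF that] A B U(1,2) c(1) by auto
    show "f x \<in> fst d'" using U by auto
  qed (use U xc' oV xV oV' xV' in auto)
qed

lemma smooth_map_on_differentiable:
  fixes A :: "('p, 'e::real_normed_vector) chart set" and B :: "('q, 'f::real_normed_vector) chart set"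
  assumes A: "smooth_atlas A" and B: "smooth_atlas B" and f: "smooth_map_on A B W f" and x: "x \<in> W"
    and c: "c \<in> A" "x \<in> fst c" and d: "d \<in> B" "f x \<in> fst d"
  shows "(snd d \<circ> f \<circ> chart_inv c) differentiable (at (snd c x))"
    and "\<exists>V. open V \<and> snd c x \<in> V \<and> V \<subseteq> snd c ` (W \<inter> fst c) \<and> (\<forall>a\<in>V. f (chart_inv c a) \<in> fst d)"
proof -
  obtain c' d' V V' where *: "c' \<in> A" "x \<in> fst c'" "d' \<in> B" "f x \<in> fst d'"
    "open V" "snd c x \<in> V" "V \<subseteq> snd c ` (W \<inter> fst c \<inter> fst c')"
    "open V'" "snd c' x \<in> V'" "smooth_on V' (snd d' \<circ> f \<circ> chart_inv c')"
    "\<And>a. a \<in> V \<Longrightarrow> f (chart_inv c a) \<in> fst d"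
    "\<And>a. a \<in> V \<Longrightarrow> (snd d \<circ> f \<circ> chart_inv c) a
        = (snd d \<circ> chart_inv d') ((snd d' \<circ> f \<circ> chart_inv c') ((snd c' \<circ> chart_inv c) a))"
    using smooth_map_on_chart_change[OF assms] by metis
  obtain F where F: "((snd d' \<circ> f \<circ> chart_inv c') has_derivative F) (at ((snd c' \<circ> chart_inv c) (snd c x)))"
    using smooth_on_has_derivative[OF *(10,9)] A c by auto
  have "((snd d \<circ> chart_inv d') has_derivative jac d' d (f x))
      (at ((snd d' \<circ> f \<circ> chart_inv c') ((snd c' \<circ> chart_inv c) (snd c x))))"
    using transition_has_derivative[OF B *(3) d(1) *(4) d(2)] A c *(1,2) by simp
  from has_derivative_compose[OF has_derivative_compose[OF
      transition_has_derivative[OF A c(1) *(1) c(2) *(2)] F] this]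
  have "((snd d \<circ> f \<circ> chart_inv c) has_derivative (\<lambda>w. jac d' d (f x) (F (jac c c' x w)))) (at (snd c x))"
    by (rule has_derivative_transform_within_open[OF _ *(5,6)]) (rule *(12)[symmetric])
  then show "(snd d \<circ> f \<circ> chart_inv c) differentiable (at (snd c x))" by (rule differentiableI)
  show "\<exists>V. open V \<and> snd c x \<in> V \<and> V \<subseteq> snd c ` (W \<inter> fst c) \<and> (\<forall>a\<in>V. f (chart_inv c a) \<in> fst d)"
    using *(5,6,7,11) by blast
qed

text \<open>The last assumption stands for a chain rule in the model space of the target. For Euclidean
  models it is \<open>smooth_on_transition_compose\<close>; for bundles with operators in the fibre it can be
  read off from the form of the transition maps.\<close>

lemma smooth_map_on_in_charts:
  fixes A :: "('p, 'e::euclidean_space) chart set" and B :: "('q, 'f::real_normed_vector) chart set"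
  assumes A: "smooth_atlas A" and B: "smooth_atlas B" and f: "smooth_map_on A B W f" and x: "x \<in> W"
    and c: "c \<in> A" "x \<in> fst c" and d: "d \<in> B" "f x \<in> fst d"
    and transition: "\<And>d' d V (F :: 'e \<Rightarrow> 'f). d' \<in> B \<Longrightarrow> d \<in> B \<Longrightarrow> open V \<Longrightarrow> smooth_on V F \<Longrightarrow>
      F ` V \<subseteq> snd d' ` (fst d' \<inter> fst d) \<Longrightarrow> smooth_on V (\<lambda>a. (snd d \<circ> chart_inv d') (F a))"
  obtains V where "open V" "snd c x \<in> V" "V \<subseteq> snd c ` (W \<inter> fst c)"
    "smooth_on V (snd d \<circ> f \<circ> chart_inv c)"
proof -
  obtain c' d' V V' where *: "c' \<in> A" "x \<in> fst c'" "d' \<in> B" "f x \<in> fst d'"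
    "open V" "snd c x \<in> V" "V \<subseteq> snd c ` (W \<inter> fst c \<inter> fst c')"
    "open V'" "snd c' x \<in> V'" "smooth_on V' (snd d' \<circ> f \<circ> chart_inv c')"
    "(snd c' \<circ> chart_inv c) ` V \<subseteq> V'"
    "(snd d' \<circ> f \<circ> chart_inv c') ` V' \<subseteq> snd d' ` (fst d' \<inter> fst d)"
    "\<And>a. a \<in> V \<Longrightarrow> (snd d \<circ> f \<circ> chart_inv c) a
        = (snd d \<circ> chart_inv d') ((snd d' \<circ> f \<circ> chart_inv c') ((snd c' \<circ> chart_inv c) a))"
    using smooth_map_on_chart_change[OF A B f x c d] by metis
  have s: "smooth_on V (snd c' \<circ> chart_inv c)"
    by (rule smooth_on_subset[OF smooth_on_transition[OF A c(1) *(1)]]) (use *(7) in auto)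
  have "smooth_on V (\<lambda>a. (snd d' \<circ> f \<circ> chart_inv c') ((snd c' \<circ> chart_inv c) a))"
    by (rule smooth_on_compose[OF *(5,8,11) s *(10)])
  then have "smooth_on V (\<lambda>a. (snd d \<circ> chart_inv d') ((snd d' \<circ> f \<circ> chart_inv c') ((snd c' \<circ> chart_inv c) a)))"
    by (rule transition[OF *(3) d(1) *(5)]) (use *(11,12) in fastforce)
  then have "smooth_on V (snd d \<circ> f \<circ> chart_inv c)"
    by (rule smooth_on_cong[OF *(5), rotated]) (rule *(13)[symmetric])
  then show thesis using that *(5,6,7) by blast
qed

lemma smooth_on_transition_compose:
  fixes B :: "('q, 'f::euclidean_space) chart set"
  assumes "smooth_atlas B" "d' \<in> B" "d \<in> B" "open V" "smooth_on V F" "F ` V \<subseteq> snd d' ` (fst d' \<inter> fst d)"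
  shows "smooth_on V (\<lambda>a. (snd d \<circ> chart_inv d') (F a))"
  by (rule smooth_on_compose[OF assms(4) open_overlap_image[OF assms(1-3)] assms(6,5) smooth_on_transition[OF assms(1-3)]])

lemma smooth_map_on_chartI:
  assumes "c \<in> A" "d \<in> B" "atlas_open A W" "W \<subseteq> fst c" "\<And>x. x \<in> W \<Longrightarrow> f x \<in> fst d"
    and "smooth_on (snd c ` W) (snd d \<circ> f \<circ> chart_inv c)"
  shows "smooth_map_on A B W f"
  unfolding smooth_map_on_def
  by (intro ballI bexI[OF _ assms(1)] bexI[OF _ assms(2)] exI[of _ W]) (use assms in auto)

lemma smooth_map_on_carrierI:
  assumes A: "smooth_atlas A" and f: "\<And>c. c \<in> A \<Longrightarrow>
    \<exists>d\<in>B. (\<forall>x\<in>fst c. f x \<in> fst d) \<and> smooth_on (snd c ` fst c) (snd d \<circ> f \<circ> chart_inv c)"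
  shows "smooth_map_on A B (carrier A) f"
  unfolding smooth_map_on_def
proof
  fix x assume "x \<in> carrier A"
  then obtain c where c: "c \<in> A" "x \<in> fst c" by (rule carrierE)
  obtain d where d: "d \<in> B" "\<forall>x\<in>fst c. f x \<in> fst d" "smooth_on (snd c ` fst c) (snd d \<circ> f \<circ> chart_inv c)"
    using f[OF c(1)] by blast
  show "\<exists>c\<in>A. \<exists>d\<in>B. \<exists>U. atlas_open A U \<and> x \<in> U \<and> U \<subseteq> carrier A \<inter> fst c \<and> f ` U \<subseteq> fst d \<and>
      smooth_on (snd c ` U) (snd d \<circ> f \<circ> chart_inv c)"
    using c d atlas_open_chart_domain[OF A c(1)] carrierI[OF c(1)]
    by (intro bexI[OF _ c(1)] bexI[OF _ d(1)] exI[of _ "fst c"]) auto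
qed

section \<open>Differentials and velocities\<close>

context
  fixes A :: "('p, 'e::real_normed_vector) chart set" and B :: "('q, 'f::real_normed_vector) chart set"
    and f :: "'p \<Rightarrow> 'q" and W :: "'p set" and x :: 'p
  assumes A: "smooth_atlas A" and B: "smooth_atlas B" and f: "smooth_map_on A B W f" and x: "x \<in> W"
    and xA: "x \<in> carrier A"
begin

lemma coordinate_map_has_derivative:
  assumes c: "c \<in> A" "x \<in> fst c" and d: "d \<in> B" "f x \<in> fst d"
  shows "((snd d \<circ> f \<circ> chart_inv c) has_derivative
    frechet_derivative (snd d \<circ> f \<circ> chart_inv c) (at (snd c x))) (at (snd c x))"
  using smooth_map_on_differentiable(1)[OF A B f x c d] by (simp add: frechet_derivative_works)

lemma differential_in_chart:
  assumes c: "c \<in> A" "x \<in> fst c" and d: "d \<in> B" "f x \<in> fst d" and v: "v \<in> tangent_space A x"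
  shows "differential A B f x v d = frechet_derivative (snd d \<circ> f \<circ> chart_inv c) (at (snd c x)) (v c)"
proof -
  let ?c = "chart_at A x"
  note c0 = chart_at[OF xA]
  have "((snd d \<circ> f \<circ> chart_inv c) has_derivative
      frechet_derivative (snd d \<circ> f \<circ> chart_inv c) (at (snd c x))) (at ((snd c \<circ> chart_inv ?c) (snd ?c x)))"
    using coordinate_map_has_derivative[OF c d] c0 A by simp
  from has_derivative_compose[OF transition_has_derivative[OF A c0(1) c(1) c0(2) c(2)] this]
  have "((snd d \<circ> f \<circ> chart_inv ?c) has_derivative
      (\<lambda>w. frechet_derivative (snd d \<circ> f \<circ> chart_inv c) (at (snd c x)) (jac ?c c x w))) (at (snd ?c x))"
    by (rule has_derivative_transform_within_open[OF _ open_overlap_image[OF A c0(1) c(1)]])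
      (use c0 c A in auto)
  from frechet_derivative_at[OF this]
  show ?thesis
    using d tangent_space_coords[OF A v c0(1) c(1) c0(2) c(2)] by (simp add: differential_def fun_eq_iff)
qed

lemma differential_in_tangent_space:
  assumes v: "v \<in> tangent_space A x"
  shows "differential A B f x v \<in> tangent_space B (f x)"
proof (rule tangent_spaceI)
  let ?c = "chart_at A x"
  note c0 = chart_at[OF xA]
  show "differential A B f x v e = jac d e (f x) (differential A B f x v d)"
    if d1: "d \<in> B" and e1: "e \<in> B" and d2: "f x \<in> fst d" and e2: "f x \<in> fst e" for d e
  proof -
    note d = d1 d2 and e = e1 e2
    have "((snd e \<circ> chart_inv d) has_derivative jac d e (f x)) (at ((snd d \<circ> f \<circ> chart_inv ?c) (snd ?c x)))"
      using transition_has_derivative[OF B d(1) e(1) d(2) e(2)] A c0 by simp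
    from has_derivative_compose[OF coordinate_map_has_derivative[OF c0 d] this]
    have der: "((\<lambda>a. (snd e \<circ> chart_inv d) ((snd d \<circ> f \<circ> chart_inv ?c) a)) has_derivative
        (\<lambda>w. jac d e (f x) (frechet_derivative (snd d \<circ> f \<circ> chart_inv ?c) (at (snd ?c x)) w))) (at (snd ?c x))" .
    obtain V where V: "open V" "snd ?c x \<in> V" "\<forall>a\<in>V. f (chart_inv ?c a) \<in> fst d"
      using smooth_map_on_differentiable(2)[OF A B f x c0 d] by blast
    have "((snd e \<circ> f \<circ> chart_inv ?c) has_derivative
        (\<lambda>w. jac d e (f x) (frechet_derivative (snd d \<circ> f \<circ> chart_inv ?c) (at (snd ?c x)) w))) (at (snd ?c x))"
      by (rule has_derivative_transform_within_open[OF der V(1,2)]) (use V(3) B d in auto)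
    from frechet_derivative_at[OF this] show ?thesis
      using d e by (simp add: differential_def fun_eq_iff)
  qed
qed (auto simp: differential_def)

end

lemma dir_deriv_in_chart:
  assumes "smooth_atlas A" "smooth_fun_on A W f" "x \<in> W" "c \<in> A" "x \<in> fst c" "v \<in> tangent_space A x"
  shows "dir_deriv A f x v = frechet_derivative (f \<circ> chart_inv c) (at (snd c x)) (v c)"
  using differential_in_chart[OF assms(1) smooth_atlas_model_chart assms(2)[unfolded smooth_fun_on_def]
      assms(3) carrierI[OF assms(4,5)] assms(4,5) _ _ assms(6), of model_chart]
  by (simp add: dir_deriv_def comp_def)

lemma velocity_in_chart:
  fixes \<gamma> :: "real \<Rightarrow> 'p" and A :: "('p, 'e::real_normed_vector) chart set"
  assumes A: "smooth_atlas A" and \<gamma>: "smooth_map_on {model_chart} A I \<gamma>" and t: "t \<in> I"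
    and c: "c \<in> A" "\<gamma> t \<in> fst c"
  shows "((snd c \<circ> \<gamma>) has_vector_derivative velocity A \<gamma> t c) (at t)"
proof -
  have "(snd c \<circ> \<gamma>) differentiable (at t)"
    using smooth_map_on_differentiable(1)[OF smooth_atlas_model_chart A \<gamma> t, of model_chart c] c
    by (simp add: comp_def)
  then show ?thesis
    using c by (simp add: velocity_def vector_derivative_works)
qed

lemma smooth_curve_stays_in_chart:
  fixes \<gamma> :: "real \<Rightarrow> 'p" and A :: "('p, 'e::real_normed_vector) chart set"
  assumes A: "smooth_atlas A" and \<gamma>: "smooth_map_on {model_chart} A I \<gamma>" and t: "t \<in> I"
    and c: "c \<in> A" "\<gamma> t \<in> fst c"
  obtains V where "open V" "t \<in> V" "V \<subseteq> I" "\<And>s. s \<in> V \<Longrightarrow> \<gamma> s \<in> fst c"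
  using smooth_map_on_differentiable(2)[OF smooth_atlas_model_chart A \<gamma> t, of model_chart c] c by auto

lemma velocity_in_tangent_space:
  fixes \<gamma> :: "real \<Rightarrow> 'p" and A :: "('p, 'e::real_normed_vector) chart set"
  assumes A: "smooth_atlas A" and \<gamma>: "smooth_map_on {model_chart} A I \<gamma>" and t: "t \<in> I"
  shows "velocity A \<gamma> t \<in> tangent_space A (\<gamma> t)"
proof (rule tangent_spaceI)
  show "velocity A \<gamma> t d = jac c d (\<gamma> t) (velocity A \<gamma> t c)"
    if c1: "c \<in> A" and d1: "d \<in> A" and c2: "\<gamma> t \<in> fst c" and d2: "\<gamma> t \<in> fst d" for c d
  proof -
    note c = c1 c2 and d = d1 d2
    obtain V where V: "open V" "t \<in> V" "\<And>s. s \<in> V \<Longrightarrow> \<gamma> s \<in> fst c"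
      using smooth_curve_stays_in_chart[OF A \<gamma> t c] by metis
    have J: "((snd d \<circ> chart_inv c) has_derivative jac c d (\<gamma> t)) (at ((snd c \<circ> \<gamma>) t))"
      using transition_has_derivative[OF A c(1) d(1) c(2) d(2)] by simp
    have "((\<lambda>s. (snd d \<circ> chart_inv c) ((snd c \<circ> \<gamma>) s)) has_vector_derivative
        jac c d (\<gamma> t) (velocity A \<gamma> t c)) (at t)"
      using has_derivative_compose[OF velocity_in_chart[OF A \<gamma> t c, unfolded has_vector_derivative_def] J]
        bounded_linear_jac[OF A c(1) d(1) c(2) d(2)]
      by (simp add: has_vector_derivative_def linear_simps)
    then have "((snd d \<circ> \<gamma>) has_vector_derivative jac c d (\<gamma> t) (velocity A \<gamma> t c)) (at t)"
      unfolding has_vector_derivative_def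
      by (rule has_derivative_transform_within_open[OF _ V(1,2)]) (use V(3) A c in auto)
    then show ?thesis using d by (simp add: velocity_def vector_derivative_at)
  qed
qed (auto simp: velocity_def)

lemma smooth_fun_along_curve:
  fixes \<gamma> :: "real \<Rightarrow> 'p" and A :: "('p, 'e::real_normed_vector) chart set"
  assumes A: "smooth_atlas A" and \<gamma>: "smooth_map_on {model_chart} A I \<gamma>" and t: "t \<in> I"
    and f: "smooth_fun_on A W f" and W: "\<gamma> t \<in> W" "\<gamma> t \<in> carrier A"
  shows "((\<lambda>s. f (\<gamma> s)) has_vector_derivative dir_deriv A f (\<gamma> t) (velocity A \<gamma> t)) (at t)"
proof -
  obtain c where c: "c \<in> A" "\<gamma> t \<in> fst c" using W(2) by (rule carrierE)
  have fd: "((f \<circ> chart_inv c) has_derivative frechet_derivative (f \<circ> chart_inv c) (at (snd c (\<gamma> t))))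
      (at ((snd c \<circ> \<gamma>) t))"
    using coordinate_map_has_derivative[OF A smooth_atlas_model_chart f[unfolded smooth_fun_on_def] W(1,2) c, of model_chart]
    by (simp add: comp_def)
  obtain V where V: "open V" "t \<in> V" "\<And>s. s \<in> V \<Longrightarrow> \<gamma> s \<in> fst c"
    using smooth_curve_stays_in_chart[OF A \<gamma> t c] by metis
  have "((\<lambda>s. (f \<circ> chart_inv c) ((snd c \<circ> \<gamma>) s)) has_vector_derivative
      frechet_derivative (f \<circ> chart_inv c) (at (snd c (\<gamma> t))) (velocity A \<gamma> t c)) (at t)"
    using has_derivative_compose[OF velocity_in_chart[OF A \<gamma> t c, unfolded has_vector_derivative_def] fd]
      has_derivative_bounded_linear[OF fd]
    by (simp add: has_vector_derivative_def linear_simps)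
  then have "((\<lambda>s. f (\<gamma> s)) has_vector_derivative
      frechet_derivative (f \<circ> chart_inv c) (at (snd c (\<gamma> t))) (velocity A \<gamma> t c)) (at t)"
    unfolding has_vector_derivative_def
    by (rule has_derivative_transform_within_open[OF _ V(1,2)]) (use V(3) A c in auto)
  then show ?thesis
    using dir_deriv_in_chart[OF A f W(1) c velocity_in_tangent_space[OF A \<gamma> t]] by simp
qed

section \<open>Endomorphisms of tangent spaces in coordinates\<close>

text \<open>The fibre coordinate of \<open>End_chart\<close>, and the endomorphism with a given fibre coordinate.\<close>

definition endo_coord ::
  "('p, 'e::real_normed_vector) chart set \<Rightarrow> ('p, 'e) chart \<Rightarrow> 'p \<Rightarrow> ('p, 'e) tendo \<Rightarrow> 'e \<Rightarrow>\<^sub>L 'e" where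
  "endo_coord A c x J = Blinfun (\<lambda>w. J (coord_vec A c x w) c)"

definition coord_endo ::
  "('p, 'e::real_normed_vector) chart set \<Rightarrow> ('p, 'e) chart \<Rightarrow> 'p \<Rightarrow> ('e \<Rightarrow>\<^sub>L 'e) \<Rightarrow> ('p, 'e) tendo" where
  "coord_endo A c x B = (\<lambda>v. if v \<in> tangent_space A x then coord_vec A c x (B (v c)) else 0)"

definition jac_blinfun :: "('p, 'e::real_normed_vector) chart \<Rightarrow> ('p, 'e) chart \<Rightarrow> 'p \<Rightarrow> 'e \<Rightarrow>\<^sub>L 'e" where
  "jac_blinfun c d x = Blinfun (jac c d x)"

lemma endosI:
  assumes "\<And>v. v \<in> tangent_space A x \<Longrightarrow> J v \<in> tangent_space A x"
    and "\<And>v w. v \<in> tangent_space A x \<Longrightarrow> w \<in> tangent_space A x \<Longrightarrow> J (v + w) = J v + J w"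
    and "\<And>r v. v \<in> tangent_space A x \<Longrightarrow> J (r *\<^sub>R v) = r *\<^sub>R J v"
    and "\<And>v. v \<notin> tangent_space A x \<Longrightarrow> J v = 0"
  shows "J \<in> endos A x"
  using assms unfolding endos_def by blast

lemma endosD:
  assumes "J \<in> endos A x"
  shows "v \<in> tangent_space A x \<Longrightarrow> J v \<in> tangent_space A x"
    and "v \<in> tangent_space A x \<Longrightarrow> w \<in> tangent_space A x \<Longrightarrow> J (v + w) = J v + J w"
    and "v \<in> tangent_space A x \<Longrightarrow> J (r *\<^sub>R v) = r *\<^sub>R J v"
    and "v \<notin> tangent_space A x \<Longrightarrow> J v = 0"
  using assms unfolding endos_def by blast+

lemma smooth_atlas_imageI:
  assumes inj: "\<And>c. c \<in> A \<Longrightarrow> inj_on (snd (F c)) (fst (F c))"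
    and op: "\<And>c d. c \<in> A \<Longrightarrow> d \<in> A \<Longrightarrow> open (snd (F c) ` (fst (F c) \<inter> fst (F d)))"
    and sm: "\<And>c d. c \<in> A \<Longrightarrow> d \<in> A \<Longrightarrow>
      smooth_on (snd (F c) ` (fst (F c) \<inter> fst (F d))) (snd (F d) \<circ> chart_inv (F c))"
  shows "smooth_atlas (F ` A)"
proof -
  have "open (snd (F c) ` fst (F c))" if "c \<in> A" for c
    using op[OF that that] by simp
  then show ?thesis
    using assms unfolding smooth_atlas_def ball_simps by blast
qed

context
  fixes A :: "('p, 'e::euclidean_space) chart set"
  assumes A: "smooth_atlas A"
begin

lemma jac_blinfun_apply:
  "c \<in> A \<Longrightarrow> d \<in> A \<Longrightarrow> x \<in> fst c \<Longrightarrow> x \<in> fst d \<Longrightarrow> blinfun_apply (jac_blinfun c d x) w = jac c d x w"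
  by (simp add: jac_blinfun_def bounded_linear_Blinfun_apply bounded_linear_jac[OF A])

context
  fixes c x
  assumes c: "c \<in> A" "x \<in> fst c"
begin

lemma coord_vec_add: "coord_vec A c x (v + w) = coord_vec A c x v + coord_vec A c x w"
  by (rule tangent_vector_eqI[OF A _ _ c])
    (simp_all add: coord_vec_in_tangent_space[OF A c] add_in_tangent_space[OF A] coord_vec_same[OF A c])

lemma coord_vec_scaleR: "coord_vec A c x (r *\<^sub>R v) = r *\<^sub>R coord_vec A c x v"
  by (rule tangent_vector_eqI[OF A _ _ c])
    (simp_all add: coord_vec_in_tangent_space[OF A c] scaleR_in_tangent_space[OF A] coord_vec_same[OF A c])

lemma endo_coord_apply:
  assumes J: "J \<in> endos A x"
  shows "blinfun_apply (endo_coord A c x J) w = J (coord_vec A c x w) c"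
proof -
  note [simp] = coord_vec_in_tangent_space[OF A c]
  have "linear (\<lambda>w. J (coord_vec A c x w) c)"
    by (rule linearI) (simp_all add: coord_vec_add coord_vec_scaleR endosD(2,3)[OF J])
  then show ?thesis
    by (simp add: endo_coord_def bounded_linear_Blinfun_apply linear_conv_bounded_linear)
qed

lemma endo_apply_coords:
  "J \<in> endos A x \<Longrightarrow> v \<in> tangent_space A x \<Longrightarrow> J v c = endo_coord A c x J (v c)"
  by (simp add: endo_coord_apply coord_vec_coords[OF A c])

lemma endo_eqI:
  assumes "J \<in> endos A x" "K \<in> endos A x" "endo_coord A c x J = endo_coord A c x K"
  shows "J = K"
proof
  fix v
  show "J v = K v"
  proof (cases "v \<in> tangent_space A x")
    case True
    then show ?thesis
      using assms by (intro tangent_vector_eqI[OF A _ _ c]) (simp_all add: endosD(1) endo_apply_coords)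
  next
    case False
    then show ?thesis using assms by (simp add: endosD(4))
  qed
qed

lemma coord_endo_in_endos: "coord_endo A c x B \<in> endos A x"
proof (rule endosI)
  fix v w r assume v: "v \<in> tangent_space A x"
  then show "coord_endo A c x B v \<in> tangent_space A x"
    by (simp add: coord_endo_def coord_vec_in_tangent_space[OF A c])
  show "coord_endo A c x B (r *\<^sub>R v) = r *\<^sub>R coord_endo A c x B v"
    using v by (simp add: coord_endo_def coord_vec_scaleR scaleR_in_tangent_space[OF A] blinfun.scaleR_right)
  assume w: "w \<in> tangent_space A x"
  then show "coord_endo A c x B (v + w) = coord_endo A c x B v + coord_endo A c x B w"
    using v by (simp add: coord_endo_def coord_vec_add add_in_tangent_space[OF A] blinfun.add_right)
qed (simp add: coord_endo_def)

lemma endo_coord_coord_endo [simp]: "endo_coord A c x (coord_endo A c x B) = B"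
  by (rule blinfun_eqI, subst endo_coord_apply[OF coord_endo_in_endos])
    (simp add: coord_endo_def coord_vec_in_tangent_space[OF A c] coord_vec_same[OF A c])

lemma coord_endo_endo_coord [simp]: "J \<in> endos A x \<Longrightarrow> coord_endo A c x (endo_coord A c x J) = J"
  by (rule endo_eqI) (simp_all add: coord_endo_in_endos)

lemma endo_compose:
  assumes J: "J \<in> endos A x" and K: "K \<in> endos A x"
  shows "J \<circ> K \<in> endos A x" "endo_coord A c x (J \<circ> K) = endo_coord A c x J o\<^sub>L endo_coord A c x K"
proof -
  have J0: "J 0 = 0" using endosD(3)[OF J zero_in_tangent_space[OF A], of 0] by simp
  show JK: "J \<circ> K \<in> endos A x"
    by (rule endosI) (simp_all add: endosD[OF J] endosD[OF K] J0)
  show "endo_coord A c x (J \<circ> K) = endo_coord A c x J o\<^sub>L endo_coord A c x K"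
    by (rule blinfun_eqI)
      (simp add: endo_coord_apply[OF JK] endo_coord_apply[OF K] endo_apply_coords[OF J]
        endosD(1)[OF K] coord_vec_in_tangent_space[OF A c])
qed

lemma endo_add_scaleR:
  assumes J: "J \<in> endos A x" and K: "K \<in> endos A x"
  shows "J + r *\<^sub>R K \<in> endos A x" "endo_coord A c x (J + r *\<^sub>R K) = endo_coord A c x J + r *\<^sub>R endo_coord A c x K"
proof -
  show JK: "J + r *\<^sub>R K \<in> endos A x"
    by (rule endosI)
      (simp_all add: endosD[OF J] endosD[OF K] add_in_tangent_space[OF A] scaleR_in_tangent_space[OF A] algebra_simps)
  show "endo_coord A c x (J + r *\<^sub>R K) = endo_coord A c x J + r *\<^sub>R endo_coord A c x K"
    by (rule blinfun_eqI)
      (simp add: endo_coord_apply[OF JK] endo_coord_apply[OF K] endo_coord_apply[OF J]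
        blinfun.add_left blinfun.scaleR_left)
qed

lemma in_cstructs_iff:
  assumes J: "J \<in> endos A x"
  shows "J \<in> cstructs A x \<longleftrightarrow> endo_coord A c x J o\<^sub>L endo_coord A c x J = - id_blinfun"
proof
  assume "J \<in> cstructs A x"
  then have JJ: "J (J v) = - v" if "v \<in> tangent_space A x" for v
    using that by (simp add: cstructs_def)
  show "endo_coord A c x J o\<^sub>L endo_coord A c x J = - id_blinfun"
    by (rule blinfun_eqI)
      (simp add: endo_compose(2)[OF J J, symmetric] endo_coord_apply[OF endo_compose(1)[OF J J]]
        JJ coord_vec_in_tangent_space[OF A c] coord_vec_same[OF A c] blinfun.minus_left)
next
  assume *: "endo_coord A c x J o\<^sub>L endo_coord A c x J = - id_blinfun"
  have "J (J v) = - v" if v: "v \<in> tangent_space A x" for v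
  proof (rule tangent_vector_eqI[OF A _ _ c])
    have "J (J v) c = (endo_coord A c x J o\<^sub>L endo_coord A c x J) (v c)"
      using v by (simp add: endo_apply_coords[OF J] endosD(1)[OF J])
    then show "J (J v) c = (- v) c" by (simp add: * blinfun.minus_left)
  qed (use v in \<open>simp_all add: endosD(1)[OF J] minus_in_tangent_space[OF A]\<close>)
  then show "J \<in> cstructs A x" using J by (simp add: cstructs_def)
qed

end

lemma endo_coord_change:
  assumes "c \<in> A" "d \<in> A" "x \<in> fst c" "x \<in> fst d" and J: "J \<in> endos A x"
  shows "endo_coord A d x J = jac_blinfun c d x o\<^sub>L endo_coord A c x J o\<^sub>L jac_blinfun d c x"
proof (rule blinfun_eqI)
  fix w
  have v: "coord_vec A d x w \<in> tangent_space A x" using assms by (simp add: coord_vec_in_tangent_space[OF A])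
  have "J (coord_vec A d x w) d = jac c d x (J (coord_vec A d x w) c)"
    using assms v by (intro tangent_space_coords[OF A endosD(1)[OF J]])
  also have "J (coord_vec A d x w) c = endo_coord A c x J (jac d c x w)"
    using assms endo_apply_coords[OF assms(1,3) J v] coord_vec_other[OF A assms(2,1,4,3)] by simp
  finally show "endo_coord A d x J w
      = (jac_blinfun c d x o\<^sub>L endo_coord A c x J o\<^sub>L jac_blinfun d c x) w"
    using assms by (simp add: endo_coord_apply jac_blinfun_apply)
qed

text \<open>The second operator is inverse to the first; it is the differential of the opposite change of
  coordinates, composed with the change of coordinates from \<open>c\<close> to \<open>d\<close>.\<close>

lemma smooth_on_jac_blinfun:
  assumes c: "c \<in> A" and d: "d \<in> A"
  shows "smooth_on (snd c ` (fst c \<inter> fst d)) (\<lambda>a. jac_blinfun c d (chart_inv c a))" (is "smooth_on ?S _")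
    and "smooth_on (snd c ` (fst c \<inter> fst d)) (\<lambda>a. jac_blinfun d c (chart_inv c a))"
proof -
  have *: "smooth_on (snd c ` (fst c \<inter> fst d)) (\<lambda>a. jac_blinfun c d (chart_inv c a))" if c: "c \<in> A" and d: "d \<in> A" for c d
  proof (rule smooth_on_blinfun[OF open_overlap_image[OF A c d]])
    fix w
    have "smooth_on (snd c ` (fst c \<inter> fst d)) (\<lambda>a. frechet_derivative (snd d \<circ> chart_inv c) (at a) w)"
      by (rule smooth_on_directional_derivative[OF smooth_on_transition[OF A c d]])
    then show "smooth_on (snd c ` (fst c \<inter> fst d)) (\<lambda>a. blinfun_apply (jac_blinfun c d (chart_inv c a)) w)"
      by (rule smooth_on_cong[OF open_overlap_image[OF A c d], rotated])
        (use A c d in \<open>auto simp: jac_blinfun_apply jac_def\<close>)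
  qed
  show "smooth_on ?S (\<lambda>a. jac_blinfun c d (chart_inv c a))" by (rule *[OF c d])
  have "smooth_on ?S (\<lambda>a. jac_blinfun d c (chart_inv d ((snd d \<circ> chart_inv c) a)))"
    by (rule smooth_on_compose[OF open_overlap_image[OF A c d] open_overlap_image[OF A d c] _
          smooth_on_transition[OF A c d] *[OF d c]]) (use A c in auto)
  then show "smooth_on ?S (\<lambda>a. jac_blinfun d c (chart_inv c a))"
    by (rule smooth_on_cong[OF open_overlap_image[OF A c d], rotated]) (use A c d in auto)
qed

end

section \<open>The bundle of endomorphisms as a manifold\<close>

lemma End_chart_simps [simp]:
  "fst (End_chart A c) = {(x, J). x \<in> fst c \<and> J \<in> endos A x}"
  "snd (End_chart A c) (x, J) = (snd c x, endo_coord A c x J)"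
  by (simp_all add: End_chart_def endo_coord_def)

context
  fixes A :: "('p, 'e::euclidean_space) chart set"
  assumes A: "smooth_atlas A"
begin

lemma End_chart_image:
  assumes c: "c \<in> A" and U: "U \<subseteq> fst c"
  shows "snd (End_chart A c) ` {(x, J). x \<in> U \<and> J \<in> endos A x} = (snd c ` U) \<times> UNIV"
proof
  show "(snd c ` U) \<times> UNIV \<subseteq> snd (End_chart A c) ` {(x, J). x \<in> U \<and> J \<in> endos A x}"
  proof
    fix p assume "p \<in> (snd c ` U) \<times> (UNIV :: ('e \<Rightarrow>\<^sub>L 'e) set)"
    then obtain x B where x: "p = (snd c x, B)" "x \<in> U" by auto
    with U have "x \<in> fst c" by auto
    then have "p = snd (End_chart A c) (x, coord_endo A c x B)" "coord_endo A c x B \<in> endos A x"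
      using x c by (simp_all add: coord_endo_in_endos[OF A] endo_coord_coord_endo[OF A])
    then show "p \<in> snd (End_chart A c) ` {(x, J). x \<in> U \<and> J \<in> endos A x}" using x by blast
  qed
qed auto

lemma inj_on_End_chart:
  assumes c: "c \<in> A"
  shows "inj_on (snd (End_chart A c)) (fst (End_chart A c))"
proof (rule inj_onI, clarsimp)
  fix x y J K
  assume x: "x \<in> fst c" "J \<in> endos A x" and y: "y \<in> fst c" "K \<in> endos A y"
    and eq: "snd c x = snd c y" "endo_coord A c x J = endo_coord A c y K"
  have "x = y" using inj_onD[OF smooth_atlas_injD[OF A c] eq(1)] x y by blast
  moreover from this have "J = K" using endo_eqI[OF A c x(1) x(2), of K] y eq(2) by simp
  ultimately show "x = y \<and> J = K" by simp
qed

lemma chart_inv_End_chart: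
  assumes c: "c \<in> A" and a: "a \<in> snd c ` fst c"
  shows "chart_inv (End_chart A c) (a, B) = (chart_inv c a, coord_endo A c (chart_inv c a) B)"
  unfolding chart_inv_def[of "End_chart A c"]
proof (rule inv_into_f_eq[OF inj_on_End_chart[OF c]])
  have "chart_inv c a \<in> fst c" using chart_inv_mem[OF a] .
  then show "(chart_inv c a, coord_endo A c (chart_inv c a) B) \<in> fst (End_chart A c)"
    "snd (End_chart A c) (chart_inv c a, coord_endo A c (chart_inv c a) B) = (a, B)"
    using c a by (simp_all add: coord_endo_in_endos[OF A] endo_coord_coord_endo[OF A])
qed

lemma End_overlap: "fst (End_chart A c) \<inter> fst (End_chart A d) = {(x, J). x \<in> fst c \<inter> fst d \<and> J \<in> endos A x}"
  by auto

lemma End_overlap_image: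
  "c \<in> A \<Longrightarrow> snd (End_chart A c) ` (fst (End_chart A c) \<inter> fst (End_chart A d)) = (snd c ` (fst c \<inter> fst d)) \<times> UNIV"
  unfolding End_overlap using End_chart_image[of c "fst c \<inter> fst d"] by simp

text \<open>In coordinates a change of charts is \<open>(a, B) \<mapsto> (\<tau> a, \<tau>' a B (\<tau>' a)\<^sup>-\<^sup>1)\<close>.\<close>

lemma End_transition:
  assumes c: "c \<in> A" and d: "d \<in> A" and a: "a \<in> snd c ` (fst c \<inter> fst d)"
  shows "(snd (End_chart A d) \<circ> chart_inv (End_chart A c)) (a, B)
    = ((snd d \<circ> chart_inv c) a, jac_blinfun c d (chart_inv c a) o\<^sub>L B o\<^sub>L jac_blinfun d c (chart_inv c a))"
proof -
  have x: "chart_inv c a \<in> fst c" "chart_inv c a \<in> fst d" using a A c by auto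
  have "a \<in> snd c ` fst c" using a by auto
  then show ?thesis
    using c d x endo_coord_change[OF A c d x coord_endo_in_endos[OF A c x(1)], of B]
    by (simp add: chart_inv_End_chart endo_coord_coord_endo[OF A])
qed

lemma smooth_on_End_transition_compose:
  assumes c: "c \<in> A" and d: "d \<in> A" and V: "open V" and F: "smooth_on V F"
    and sub: "F ` V \<subseteq> snd (End_chart A c) ` (fst (End_chart A c) \<inter> fst (End_chart A d))"
  shows "smooth_on V (\<lambda>z. (snd (End_chart A d) \<circ> chart_inv (End_chart A c)) (F z))"
proof -
  let ?S = "snd c ` (fst c \<inter> fst d)"
  have FS: "fst (F z) \<in> ?S" if "z \<in> V" for z
    using that sub unfolding End_overlap_image[OF c] by (metis image_subset_iff mem_Times_iff)
  then have FS': "(\<lambda>z. fst (F z)) ` V \<subseteq> ?S" by auto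
  note comp = smooth_on_compose[OF V open_overlap_image[OF A c d] FS' smooth_on_fst[OF V F]]
  have "smooth_on V (\<lambda>z. ((snd d \<circ> chart_inv c) (fst (F z)),
      jac_blinfun c d (chart_inv c (fst (F z))) o\<^sub>L snd (F z) o\<^sub>L jac_blinfun d c (chart_inv c (fst (F z)))))"
    by (intro smooth_on_Pair smooth_on_blinfun_compose V comp smooth_on_snd F
        smooth_on_transition[OF A c d] smooth_on_jac_blinfun[OF A c d])
  then show ?thesis
  proof (rule smooth_on_cong[OF V, rotated])
    fix z assume "z \<in> V"
    from End_transition[OF c d FS[OF this], of "snd (F z)"]
    show "((snd d \<circ> chart_inv c) (fst (F z)),
        jac_blinfun c d (chart_inv c (fst (F z))) o\<^sub>L snd (F z) o\<^sub>L jac_blinfun d c (chart_inv c (fst (F z))))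
      = (snd (End_chart A d) \<circ> chart_inv (End_chart A c)) (F z)" by simp
  qed
qed

lemma smooth_atlas_End: "smooth_atlas (End_atlas A)"
  unfolding End_atlas_def
proof (rule smooth_atlas_imageI[OF inj_on_End_chart])
  fix c d assume c: "c \<in> A" and d: "d \<in> A"
  show o: "open (snd (End_chart A c) ` (fst (End_chart A c) \<inter> fst (End_chart A d)))"
    unfolding End_overlap_image[OF c] by (intro open_Times open_overlap_image[OF A c d] open_UNIV)
  have "smooth_on (snd (End_chart A c) ` (fst (End_chart A c) \<inter> fst (End_chart A d)))
      (\<lambda>z. (snd (End_chart A d) \<circ> chart_inv (End_chart A c)) z)"
    by (rule smooth_on_End_transition_compose[OF c d o smooth_on_ident[OF o]]) simp
  then show "smooth_on (snd (End_chart A c) ` (fst (End_chart A c) \<inter> fst (End_chart A d)))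
      (snd (End_chart A d) \<circ> chart_inv (End_chart A c))" .
qed

lemma End_chart_in_End_atlas [simp]: "c \<in> A \<Longrightarrow> End_chart A c \<in> End_atlas A"
  by (simp add: End_atlas_def)

section \<open>Smooth fields in charts\<close>

lemma smooth_atlas_TM: "smooth_atlas (TM_atlas A)"
proof -
  have image: "snd (TM_chart A c) ` (fst (TM_chart A c) \<inter> fst (TM_chart A d)) = (snd c ` (fst c \<inter> fst d)) \<times> UNIV"
    if c: "c \<in> A" for c d
  proof
    show "(snd c ` (fst c \<inter> fst d)) \<times> UNIV \<subseteq> snd (TM_chart A c) ` (fst (TM_chart A c) \<inter> fst (TM_chart A d))"
    proof
      fix p assume "p \<in> (snd c ` (fst c \<inter> fst d)) \<times> (UNIV :: 'e set)"
      then obtain x w where x: "p = (snd c x, w)" "x \<in> fst c" "x \<in> fst d" by auto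
      then have "p = snd (TM_chart A c) (x, coord_vec A c x w)" "coord_vec A c x w \<in> tangent_space A x"
        using c by (simp_all add: TM_chart_def coord_vec_in_tangent_space[OF A] coord_vec_same[OF A])
      then show "p \<in> snd (TM_chart A c) ` (fst (TM_chart A c) \<inter> fst (TM_chart A d))"
        using x by (auto simp: TM_chart_def intro!: image_eqI[of _ _ "(x, coord_vec A c x w)"])
    qed
  qed (auto simp: TM_chart_def)
  have inj: "inj_on (snd (TM_chart A c)) (fst (TM_chart A c))" if c: "c \<in> A" for c
  proof (rule inj_onI, clarsimp simp: TM_chart_def)
    fix x y v w
    assume x: "x \<in> fst c" "v \<in> tangent_space A x" and y: "y \<in> fst c" "w \<in> tangent_space A y"
      and eq: "snd c x = snd c y" "v c = w c"
    have "x = y" using inj_onD[OF smooth_atlas_injD[OF A c] eq(1)] x y by blast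
    moreover from this have "v = w" using tangent_vector_eqI[OF A, of v x w c] x y c eq by simp
    ultimately show "x = y \<and> v = w" by simp
  qed
  show ?thesis
    unfolding TM_atlas_def
  proof (rule smooth_atlas_imageI[OF inj])
    fix c d assume c: "c \<in> A" and d: "d \<in> A"
    let ?S = "snd c ` (fst c \<inter> fst d)"
    have oS: "open (?S \<times> (UNIV :: 'e set))" by (intro open_Times open_overlap_image[OF A c d] open_UNIV)
    then show "open (snd (TM_chart A c) ` (fst (TM_chart A c) \<inter> fst (TM_chart A d)))"
      unfolding image[OF c] .
    have "fst ` (?S \<times> (UNIV :: 'e set)) \<subseteq> ?S" by auto
    note comp = smooth_on_compose[OF oS open_overlap_image[OF A c d] this smooth_on_fst[OF oS smooth_on_ident[OF oS]]]
    have "smooth_on (?S \<times> UNIV) (\<lambda>p. ((snd d \<circ> chart_inv c) (fst p), blinfun_apply (jac_blinfun c d (chart_inv c (fst p))) (snd p)))"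
      by (intro smooth_on_Pair smooth_on_blinfun_apply oS comp smooth_on_snd smooth_on_ident
        smooth_on_transition[OF A c d] smooth_on_jac_blinfun[OF A c d])
    then show "smooth_on (snd (TM_chart A c) ` (fst (TM_chart A c) \<inter> fst (TM_chart A d)))
        (snd (TM_chart A d) \<circ> chart_inv (TM_chart A c))"
      unfolding image[OF c]
    proof (rule smooth_on_cong[OF oS, rotated], clarify)
      fix x w assume x: "x \<in> fst c" "x \<in> fst d"
      let ?v = "coord_vec A c x w"
      have v: "?v \<in> tangent_space A x" "?v c = w"
        using x c by (simp_all add: coord_vec_in_tangent_space[OF A] coord_vec_same[OF A])
      have "chart_inv (TM_chart A c) (snd c x, w) = (x, ?v)"
        unfolding chart_inv_def
        by (rule inv_into_f_eq[OF inj[OF c]]) (use x v in \<open>simp_all add: TM_chart_def\<close>)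
      moreover have "?v d = jac c d x w"
        using coord_vec_other[OF A c d x] by simp
      ultimately show "((snd d \<circ> chart_inv c) (fst (snd c x, w)),
          blinfun_apply (jac_blinfun c d (chart_inv c (fst (snd c x, w)))) (snd (snd c x, w)))
        = (snd (TM_chart A d) \<circ> chart_inv (TM_chart A c)) (snd c x, w)"
        using x c d A by (simp add: TM_chart_def jac_blinfun_apply[OF A])
    qed
  qed
qed

lemma smooth_on_vector_field:
  assumes X: "X \<in> vector_fields A" and c: "c \<in> A"
  shows "smooth_on (snd c ` fst c) (\<lambda>a. X (chart_inv c a) c)"
proof (rule smooth_on_local)
  fix a assume "a \<in> snd c ` fst c"
  then obtain x where x: "x \<in> fst c" "a = snd c x" by auto
  have X': "smooth_map_on A (TM_atlas A) (carrier A) (\<lambda>x. (x, X x))" "X x \<in> tangent_space A x"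
    using X carrierI[OF c x(1)] by (auto simp: vector_fields_def)
  have d: "TM_chart A c \<in> TM_atlas A" "(x, X x) \<in> fst (TM_chart A c)"
    using c x X' by (simp_all add: TM_atlas_def TM_chart_def)
  obtain V where V: "open V" "snd c x \<in> V" "V \<subseteq> snd c ` (carrier A \<inter> fst c)"
      "smooth_on V (snd (TM_chart A c) \<circ> (\<lambda>x. (x, X x)) \<circ> chart_inv c)"
    by (rule smooth_map_on_in_charts[OF A smooth_atlas_TM X'(1) carrierI[OF c x(1)] c x(1) d
        smooth_on_transition_compose[OF smooth_atlas_TM]])
  from smooth_on_snd[OF V(1,4)] show "\<exists>T. open T \<and> a \<in> T \<and> smooth_on T (\<lambda>a. X (chart_inv c a) c)"
    using V(1,2) x(2) by (auto simp: TM_chart_def)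
qed

lemma vector_fieldI:
  assumes "\<And>x. x \<in> carrier A \<Longrightarrow> X x \<in> tangent_space A x" "\<And>x. x \<notin> carrier A \<Longrightarrow> X x = 0"
    and sm: "\<And>c. c \<in> A \<Longrightarrow> smooth_on (snd c ` fst c) (\<lambda>a. X (chart_inv c a) c)"
  shows "X \<in> vector_fields A"
proof -
  have "smooth_map_on A (TM_atlas A) (carrier A) (\<lambda>x. (x, X x))"
  proof (rule smooth_map_on_carrierI[OF A])
    fix c assume c: "c \<in> A"
    have o: "open (snd c ` fst c)" by (rule open_chart_image[OF A c])
    have "smooth_on (snd c ` fst c) (\<lambda>a. (a, X (chart_inv c a) c))"
      by (intro smooth_on_Pair smooth_on_ident o sm c)
    then have "smooth_on (snd c ` fst c) (snd (TM_chart A c) \<circ> (\<lambda>x. (x, X x)) \<circ> chart_inv c)"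
      by (rule smooth_on_cong[OF o, rotated]) (simp add: TM_chart_def)
    moreover have "\<forall>x\<in>fst c. (x, X x) \<in> fst (TM_chart A c)"
      using assms(1) carrierI[OF c] by (auto simp: TM_chart_def)
    ultimately show "\<exists>d\<in>TM_atlas A. (\<forall>x\<in>fst c. (x, X x) \<in> fst d) \<and>
        smooth_on (snd c ` fst c) (snd d \<circ> (\<lambda>x. (x, X x)) \<circ> chart_inv c)"
      using c by (intro bexI[of _ "TM_chart A c"]) (auto simp: TM_atlas_def)
  qed
  then show ?thesis using assms(1,2) by (simp add: vector_fields_def)
qed

lemma vector_field_tangent: "X \<in> vector_fields A \<Longrightarrow> X x \<in> tangent_space A x"
  by (cases "x \<in> carrier A") (simp_all add: vector_fields_def zero_in_tangent_space[OF A])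

lemma vector_field_outside: "X \<in> vector_fields A \<Longrightarrow> x \<notin> carrier A \<Longrightarrow> X x = 0"
  by (simp add: vector_fields_def)

lemma smooth_on_endo_field:
  assumes j: "smooth_map_on A (End_atlas A) (carrier A) (\<lambda>x. (x, j x))"
    and jx: "\<And>x. x \<in> carrier A \<Longrightarrow> j x \<in> endos A x" and c: "c \<in> A"
  shows "smooth_on (snd c ` fst c) (\<lambda>a. endo_coord A c (chart_inv c a) (j (chart_inv c a)))"
proof (rule smooth_on_local)
  fix a assume "a \<in> snd c ` fst c"
  then obtain x where x: "x \<in> fst c" "a = snd c x" by auto
  have d: "End_chart A c \<in> End_atlas A" "(x, j x) \<in> fst (End_chart A c)"
    using c x jx[OF carrierI[OF c x(1)]] by simp_all
  have tr: "smooth_on V (\<lambda>a. (snd d \<circ> chart_inv d') (F a))"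
    if "d' \<in> End_atlas A" "d \<in> End_atlas A" "open V" "smooth_on V F" "F ` V \<subseteq> snd d' ` (fst d' \<inter> fst d)"
    for d' d V and F :: "'e \<Rightarrow> 'e \<times> ('e \<Rightarrow>\<^sub>L 'e)"
    using that smooth_on_End_transition_compose unfolding End_atlas_def by blast
  obtain V where V: "open V" "snd c x \<in> V" "V \<subseteq> snd c ` (carrier A \<inter> fst c)"
      "smooth_on V (snd (End_chart A c) \<circ> (\<lambda>x. (x, j x)) \<circ> chart_inv c)"
    by (rule smooth_map_on_in_charts[OF A smooth_atlas_End j carrierI[OF c x(1)] c x(1) d tr])
  from smooth_on_snd[OF V(1,4)]
  show "\<exists>T. open T \<and> a \<in> T \<and> smooth_on T (\<lambda>a. endo_coord A c (chart_inv c a) (j (chart_inv c a)))"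
    using V(1,2) x(2) by auto
qed

lemma smooth_fun_on_carrierI:
  assumes "\<And>c. c \<in> A \<Longrightarrow> smooth_on (snd c ` fst c) (f \<circ> chart_inv c)"
  shows "smooth_fun_on A (carrier A) f"
  unfolding smooth_fun_on_def
  by (rule smooth_map_on_carrierI[OF A]) (use assms in \<open>simp add: comp_def\<close>)

lemma smooth_fun_in_chart:
  assumes f: "smooth_fun_on A (carrier A) f" and c: "c \<in> A"
  shows "smooth_on (snd c ` fst c) (\<lambda>a. f (chart_inv c a))"
proof (rule smooth_on_local)
  fix a assume "a \<in> snd c ` fst c"
  then obtain x where x: "x \<in> fst c" "a = snd c x" by auto
  have d: "model_chart \<in> {model_chart}" "f x \<in> fst model_chart" by simp_all
  obtain V where V: "open V" "snd c x \<in> V" "V \<subseteq> snd c ` (carrier A \<inter> fst c)"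
      "smooth_on V (snd model_chart \<circ> f \<circ> chart_inv c)"
    by (rule smooth_map_on_in_charts[OF A smooth_atlas_model_chart f[unfolded smooth_fun_on_def]
          carrierI[OF c x(1)] c x(1) d smooth_on_transition_compose[OF smooth_atlas_model_chart]])
  then show "\<exists>T. open T \<and> a \<in> T \<and> smooth_on T (\<lambda>a. f (chart_inv c a))"
    using x(2) by (auto simp: comp_def)
qed

lemma vector_field_add:
  assumes "X \<in> vector_fields A" "Y \<in> vector_fields A"
  shows "X + Y \<in> vector_fields A"
proof (rule vector_fieldI)
  show "(X + Y) x = 0" if "x \<notin> carrier A" for x
    using vector_field_outside[OF assms(1) that] vector_field_outside[OF assms(2) that] by simp
  show "(X + Y) x \<in> tangent_space A x" for x
    using assms by (simp add: add_in_tangent_space[OF A] vector_field_tangent)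
  fix c assume c: "c \<in> A"
  have "smooth_on (snd c ` fst c) (\<lambda>a. X (chart_inv c a) c + Y (chart_inv c a) c)"
    by (rule smooth_on_add[OF open_chart_image[OF A c] smooth_on_vector_field[OF assms(1) c] smooth_on_vector_field[OF assms(2) c]])
  then show "smooth_on (snd c ` fst c) (\<lambda>a. (X + Y) (chart_inv c a) c)"
    by simp
qed

lemma vector_field_fun_scaleR:
  assumes f: "smooth_fun_on A (carrier A) f" and X: "X \<in> vector_fields A"
  shows "(\<lambda>x. f x *\<^sub>R X x) \<in> vector_fields A"
proof (rule vector_fieldI)
  show "f x *\<^sub>R X x = 0" if "x \<notin> carrier A" for x
    unfolding vector_field_outside[OF X that] by (rule scaleR_zero_right)
  show "f x *\<^sub>R X x \<in> tangent_space A x" for x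
    by (intro scaleR_in_tangent_space[OF A] vector_field_tangent X)
  fix c assume c: "c \<in> A"
  have "smooth_on (snd c ` fst c) (\<lambda>a. f (chart_inv c a) *\<^sub>R X (chart_inv c a) c)"
    by (rule smooth_on_scaleR[OF open_chart_image[OF A c] smooth_fun_in_chart[OF f c] smooth_on_vector_field[OF X c]])
  then show "smooth_on (snd c ` fst c) (\<lambda>a. (f (chart_inv c a) *\<^sub>R X (chart_inv c a)) c)"
    by simp
qed

lemma smooth_fun_on_const: "smooth_fun_on A (carrier A) (\<lambda>x. r)"
  by (rule smooth_fun_on_carrierI) (simp add: comp_def smooth_on_const open_chart_image[OF A])

lemma vector_field_minus:
  assumes X: "X \<in> vector_fields A"
  shows "- X \<in> vector_fields A"
proof -
  have "- X = (\<lambda>x. (- 1) *\<^sub>R X x)" by auto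
  then show ?thesis using vector_field_fun_scaleR[OF smooth_fun_on_const[of "-1"] X] by simp
qed

lemma vector_field_diff:
  "X \<in> vector_fields A \<Longrightarrow> Y \<in> vector_fields A \<Longrightarrow> X - Y \<in> vector_fields A"
  using vector_field_add[of X "- Y"] vector_field_minus[of Y] by simp

lemma vector_field_apply_endo:
  assumes j: "smooth_map_on A (End_atlas A) (carrier A) (\<lambda>x. (x, j x))"
    and jx: "\<And>x. x \<in> carrier A \<Longrightarrow> j x \<in> endos A x" and X: "X \<in> vector_fields A"
  shows "(\<lambda>x. if x \<in> carrier A then j x (X x) else 0) \<in> vector_fields A"
proof (rule vector_fieldI)
  fix c assume c: "c \<in> A"
  note o = open_chart_image[OF A c]
  have "smooth_on (snd c ` fst c)
      (\<lambda>a. blinfun_apply (endo_coord A c (chart_inv c a) (j (chart_inv c a))) (X (chart_inv c a) c))"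
    by (intro smooth_on_blinfun_apply o smooth_on_endo_field j jx c smooth_on_vector_field X)
  then show "smooth_on (snd c ` fst c)
      (\<lambda>a. (if chart_inv c a \<in> carrier A then j (chart_inv c a) (X (chart_inv c a)) else 0) c)"
  proof (rule smooth_on_cong[OF o, rotated])
    fix a assume "a \<in> snd c ` fst c"
    then have x: "chart_inv c a \<in> fst c" by (rule chart_inv_mem)
    then show "endo_coord A c (chart_inv c a) (j (chart_inv c a)) (X (chart_inv c a) c)
        = (if chart_inv c a \<in> carrier A then j (chart_inv c a) (X (chart_inv c a)) else 0) c"
      using carrierI[OF c x] endo_apply_coords[OF A c x jx vector_field_tangent[OF X]] by simp
  qed
qed (use assms in \<open>auto simp: endosD(1) vector_field_tangent\<close>)

end

section \<open>Localisation on a manifold\<close>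

lemma topspace_atlas_topology:
  assumes A: "smooth_atlas A"
  shows "topspace (atlas_topology A) = carrier A"
proof
  show "topspace (atlas_topology A) \<subseteq> carrier A"
    unfolding topspace_def openin_atlas_topology[OF A] by (auto simp: atlas_open_def)
  show "carrier A \<subseteq> topspace (atlas_topology A)"
  proof
    fix x assume "x \<in> carrier A"
    then obtain c where c: "c \<in> A" "x \<in> fst c" by (rule carrierE)
    then have "openin (atlas_topology A) (fst c)"
      by (simp add: openin_atlas_topology[OF A] atlas_open_chart_domain[OF A])
    then show "x \<in> topspace (atlas_topology A)" using c(2) openin_subset by blast
  qed
qed

text \<open>Here the Hausdorff property enters: a compact set of coordinates is closed in the manifold.\<close>

lemma open_image_minus_compact:
  fixes M :: "('p, 'e::real_normed_vector) chart set"
  assumes M: "smooth_manifold M" and c: "c \<in> M" and d: "d \<in> M" and K: "compact K" "K \<subseteq> snd c ` fst c"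
  shows "open (snd d ` (fst d - chart_inv c ` K))"
proof -
  have A: "smooth_atlas M" and H: "Hausdorff_space (atlas_topology M)"
    using M by (simp_all add: smooth_manifold_def)
  have cont: "continuous_map (top_of_set (snd c ` fst c)) (atlas_topology M) (chart_inv c)"
    unfolding continuous_map_def
  proof (intro conjI allI impI funcsetI)
    fix a assume "a \<in> topspace (top_of_set (snd c ` fst c))"
    then have "chart_inv c a \<in> fst c" by (intro chart_inv_mem) simp
    then show "chart_inv c a \<in> topspace (atlas_topology M)"
      using topspace_atlas_topology[OF A] carrierI[OF c] by blast
  next
    fix U assume "openin (atlas_topology M) U"
    then have U: "open (snd c ` (U \<inter> fst c))"
      using atlas_open_chart_image[OF A _ c] by (simp add: openin_atlas_topology[OF A])
    have "{a \<in> snd c ` fst c. chart_inv c a \<in> U} = snd c ` (U \<inter> fst c)"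
      using A c by auto
    then show "openin (top_of_set (snd c ` fst c)) {a \<in> topspace (top_of_set (snd c ` fst c)). chart_inv c a \<in> U}"
      using U by (auto simp: openin_open_eq[OF open_chart_image[OF A c]])
  qed
  have "compactin (top_of_set (snd c ` fst c)) K" using K by (simp add: compactin_subtopology)
  from compactin_imp_closedin[OF H image_compactin[OF this cont]]
  have "atlas_open M (carrier M - chart_inv c ` K)"
    by (simp add: closedin_def topspace_atlas_topology[OF A] openin_atlas_topology[OF A])
  from atlas_open_chart_image[OF A this d]
  have "open (snd d ` ((carrier M - chart_inv c ` K) \<inter> fst d))" .
  moreover have "(carrier M - chart_inv c ` K) \<inter> fst d = fst d - chart_inv c ` K"
    using carrierI[OF d] by blast
  ultimately show ?thesis by simp
qed

lemma smooth_on_extension_by_zero: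
  fixes M :: "('p, 'e::real_normed_vector) chart set"
  assumes M: "smooth_manifold M" and c: "c \<in> M" and d: "d \<in> M" and K: "compact K" "K \<subseteq> snd c ` fst c"
    and h: "smooth_on (snd d ` (fst d \<inter> fst c)) (\<lambda>b. h (chart_inv d b))"
    and h0: "\<And>y. y \<in> fst d \<Longrightarrow> y \<notin> chart_inv c ` K \<Longrightarrow> h y = 0"
  shows "smooth_on (snd d ` fst d) (\<lambda>b. h (chart_inv d b))"
proof (rule smooth_on_local)
  have A: "smooth_atlas M" using M by (simp add: smooth_manifold_def)
  fix b assume "b \<in> snd d ` fst d"
  then obtain y where y: "y \<in> fst d" "b = snd d y" by blast
  show "\<exists>T. open T \<and> b \<in> T \<and> smooth_on T (\<lambda>b. h (chart_inv d b))"
  proof (cases "y \<in> fst c")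
    case True
    then show ?thesis using y h open_overlap_image[OF A d c] by blast
  next
    case False
    let ?T = "snd d ` (fst d - chart_inv c ` K)"
    have o: "open ?T" by (rule open_image_minus_compact[OF M c d K])
    have "chart_inv c ` K \<subseteq> fst c" using K(2) chart_inv_mem[of _ c] by auto
    then have "b \<in> ?T" using y False by blast
    moreover have "smooth_on ?T (\<lambda>b. h (chart_inv d b))"
    proof (rule smooth_on_cong[OF o _ smooth_on_const[OF o]])
      fix b assume "b \<in> ?T"
      then obtain z where "z \<in> fst d" "z \<notin> chart_inv c ` K" "b = snd d z" by blast
      then show "0 = h (chart_inv d b)" using h0 A d by simp
    qed
    ultimately show ?thesis using o by blast
  qed
qed

text \<open>The field with constant coordinates \<open>w\<close> in the chart \<open>c\<close>, cut off by \<open>\<phi>\<close>.\<close>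

definition cutoff_field ::
  "('p, 'e::real_normed_vector) chart set \<Rightarrow> ('p, 'e) chart \<Rightarrow> ('p \<Rightarrow> real) \<Rightarrow> 'e \<Rightarrow> 'p \<Rightarrow> ('p, 'e) tvec" where
  "cutoff_field M c \<phi> w = (\<lambda>y. if y \<in> fst c then \<phi> y *\<^sub>R coord_vec M c y w else 0)"

text \<open>The properties of a cutoff function \<open>\<phi>\<close> for the point \<open>x\<close> of the chart \<open>c\<close> that are used
  below; \<open>V\<close> is a set of coordinates of points where \<open>\<phi>\<close> does not vanish.\<close>

definition cutoff ::
  "('p, 'e::euclidean_space) chart set \<Rightarrow> ('p, 'e) chart \<Rightarrow> 'p \<Rightarrow> ('p \<Rightarrow> real) \<Rightarrow> 'e set \<Rightarrow> bool" where
  "cutoff M c x \<phi> V \<longleftrightarrow> smooth_fun_on M (carrier M) \<phi> \<and> \<phi> x = 1 \<and> (\<forall>y. y \<notin> fst c \<longrightarrow> \<phi> y = 0) \<and>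
     ((\<lambda>a. \<phi> (chart_inv c a)) has_derivative (\<lambda>_. 0)) (at (snd c x)) \<and>
     open V \<and> snd c x \<in> V \<and> V \<subseteq> snd c ` fst c \<and> (\<forall>a\<in>V. \<phi> (chart_inv c a) \<noteq> 0) \<and>
     (\<forall>w. cutoff_field M c \<phi> w \<in> vector_fields M) \<and>
     (\<forall>X\<in>vector_fields M. \<forall>i. smooth_fun_on M (carrier M) (\<lambda>y. \<phi> y * (X y c \<bullet> i)))"

lemma cutoff_exists:
  fixes M :: "('p, 'e::euclidean_space) chart set"
  assumes M: "smooth_manifold M" and c: "c \<in> M" and x: "x \<in> fst c"
  obtains \<phi> V where "cutoff M c x \<phi> V"
proof -
  have A: "smooth_atlas M" using M by (simp add: smooth_manifold_def)
  have "snd c x \<in> snd c ` fst c" using x by blast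
  then obtain r where r: "0 < r" "cball (snd c x) r \<subseteq> snd c ` fst c"
    using open_contains_cball open_chart_image[OF A c] by blast
  obtain \<psi> :: "'e \<Rightarrow> real" where \<psi>: "smooth_on UNIV \<psi>" "\<psi> (snd c x) = 1"
    "(\<psi> has_derivative (\<lambda>_. 0)) (at (snd c x))"
    "\<And>a. a \<in> ball (snd c x) r \<Longrightarrow> \<psi> a \<noteq> 0" "\<And>a. a \<notin> ball (snd c x) r \<Longrightarrow> \<psi> a = 0"
    using bump_function_exists[OF r(1), of "snd c x"] by blast
  let ?K = "cball (snd c x) r"
  define \<phi> where "\<phi> y = (if y \<in> fst c then \<psi> (snd c y) else 0)" for y
  have \<phi>0: "\<phi> y = 0" if "y \<notin> chart_inv c ` ?K" for y
  proof (cases "y \<in> fst c")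
    case True
    have "snd c y \<notin> ?K"
    proof
      assume "snd c y \<in> ?K"
      then have "chart_inv c (snd c y) \<in> chart_inv c ` ?K" by blast
      then show False using that True A c by simp
    qed
    then show ?thesis using \<psi>(5)[of "snd c y"] by (simp add: \<phi>_def)
  qed (simp add: \<phi>_def)
  have \<phi>s: "smooth_on (snd d ` (fst d \<inter> fst c)) (\<lambda>b. \<phi> (chart_inv d b))" if d: "d \<in> M" for d
  proof -
    note o = open_overlap_image[OF A d c]
    have "smooth_on (snd d ` (fst d \<inter> fst c)) (\<lambda>b. \<psi> ((snd c \<circ> chart_inv d) b))"
      by (rule smooth_on_compose[OF o open_UNIV subset_UNIV smooth_on_transition[OF A d c] \<psi>(1)])
    then show ?thesis
      by (rule smooth_on_cong[OF o, rotated]) (use A d in \<open>auto simp: \<phi>_def\<close>)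
  qed
  note extend = smooth_on_extension_by_zero[OF M c _ compact_cball r(2)]
  have "smooth_fun_on M (carrier M) \<phi>"
  proof (rule smooth_fun_on_carrierI[OF A])
    fix d assume d: "d \<in> M"
    show "smooth_on (snd d ` fst d) (\<phi> \<circ> chart_inv d)"
      unfolding comp_def by (rule extend[OF d \<phi>s[OF d] \<phi>0])
  qed
  moreover have "\<phi> x = 1" using x \<psi>(2) by (simp add: \<phi>_def)
  moreover have "\<forall>y. y \<notin> fst c \<longrightarrow> \<phi> y = 0" by (simp add: \<phi>_def)
  moreover have "((\<lambda>a. \<phi> (chart_inv c a)) has_derivative (\<lambda>_. 0)) (at (snd c x))"
    by (rule has_derivative_transform_within_open[OF \<psi>(3) open_chart_image[OF A c]])
      (use x A c in \<open>auto simp: \<phi>_def\<close>)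
  moreover have "\<forall>a\<in>ball (snd c x) r. \<phi> (chart_inv c a) \<noteq> 0"
  proof
    fix a assume a: "a \<in> ball (snd c x) r"
    then have "a \<in> snd c ` fst c" using r(2) ball_subset_cball by blast
    then show "\<phi> (chart_inv c a) \<noteq> 0" using \<psi>(4)[OF a] chart_inv_mem[of a c] by (simp add: \<phi>_def)
  qed
  moreover have "cutoff_field M c \<phi> w \<in> vector_fields M" for w
  proof (rule vector_fieldI[OF A])
    show "cutoff_field M c \<phi> w y \<in> tangent_space M y" for y
      by (simp add: cutoff_field_def zero_in_tangent_space[OF A] scaleR_in_tangent_space[OF A]
          coord_vec_in_tangent_space[OF A c])
    show "cutoff_field M c \<phi> w y = 0" if "y \<notin> carrier M" for y
      using that carrierI[OF c, of y] by (auto simp: cutoff_field_def)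
    fix d assume d: "d \<in> M"
    note o = open_overlap_image[OF A d c]
    show "smooth_on (snd d ` fst d) (\<lambda>b. cutoff_field M c \<phi> w (chart_inv d b) d)"
    proof (rule extend[OF d, of "\<lambda>y. cutoff_field M c \<phi> w y d"])
      have "smooth_on (snd d ` (fst d \<inter> fst c))
          (\<lambda>b. \<phi> (chart_inv d b) *\<^sub>R blinfun_apply (jac_blinfun c d (chart_inv d b)) w)"
        by (intro smooth_on_scaleR smooth_on_blinfun_apply smooth_on_const o \<phi>s d smooth_on_jac_blinfun(2)[OF A d c])
      then show "smooth_on (snd d ` (fst d \<inter> fst c)) (\<lambda>b. cutoff_field M c \<phi> w (chart_inv d b) d)"
      proof (rule smooth_on_cong[OF o, rotated])
        fix b assume "b \<in> snd d ` (fst d \<inter> fst c)"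
        then have "chart_inv d b \<in> fst d" "chart_inv d b \<in> fst c" using A d by auto
        then show "\<phi> (chart_inv d b) *\<^sub>R blinfun_apply (jac_blinfun c d (chart_inv d b)) w
            = cutoff_field M c \<phi> w (chart_inv d b) d"
          using c d by (simp add: cutoff_field_def jac_blinfun_apply[OF A] coord_vec_other[OF A])
      qed
      show "cutoff_field M c \<phi> w y d = 0" if "y \<notin> chart_inv c ` ?K" for y
        using \<phi>0[OF that] by (simp add: cutoff_field_def)
    qed
  qed
  moreover have "smooth_fun_on M (carrier M) (\<lambda>y. \<phi> y * (X y c \<bullet> i))" if X: "X \<in> vector_fields M" for X i
  proof (rule smooth_fun_on_carrierI[OF A])
    fix d assume d: "d \<in> M"
    note o = open_overlap_image[OF A d c]
    have "smooth_on (snd d ` (fst d \<inter> fst c)) (\<lambda>b. X (chart_inv d b) d)"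
      by (rule smooth_on_subset[OF smooth_on_vector_field[OF A X d]]) blast
    then have "smooth_on (snd d ` (fst d \<inter> fst c))
        (\<lambda>b. \<phi> (chart_inv d b) * (blinfun_apply (jac_blinfun d c (chart_inv d b)) (X (chart_inv d b) d) \<bullet> i))"
      by (intro smooth_on_mult smooth_on_inner smooth_on_const smooth_on_blinfun_apply o \<phi>s d
          smooth_on_jac_blinfun(1)[OF A d c])
    then have "smooth_on (snd d ` (fst d \<inter> fst c)) (\<lambda>b. \<phi> (chart_inv d b) * (X (chart_inv d b) c \<bullet> i))"
    proof (rule smooth_on_cong[OF o, rotated])
      fix b assume "b \<in> snd d ` (fst d \<inter> fst c)"
      then have y: "chart_inv d b \<in> fst d" "chart_inv d b \<in> fst c" using A d by auto
      then show "\<phi> (chart_inv d b) * (blinfun_apply (jac_blinfun d c (chart_inv d b)) (X (chart_inv d b) d) \<bullet> i)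
          = \<phi> (chart_inv d b) * (X (chart_inv d b) c \<bullet> i)"
        using tangent_space_coords[OF A vector_field_tangent[OF A X] d c y] c d
        by (simp add: jac_blinfun_apply[OF A])
    qed
    then show "smooth_on (snd d ` fst d) ((\<lambda>y. \<phi> y * (X y c \<bullet> i)) \<circ> chart_inv d)"
      unfolding comp_def by (rule extend[OF d]) (simp add: \<phi>0)
  qed
  ultimately have "cutoff M c x \<phi> (ball (snd c x) r)"
    using r ball_subset_cball[of "snd c x" r] by (auto simp: cutoff_def)
  then show thesis using that by blast
qed

lemma cutoff_field_at:
  "cutoff M c x \<phi> V \<Longrightarrow> x \<in> fst c \<Longrightarrow> cutoff_field M c \<phi> w x = coord_vec M c x w"
  by (simp add: cutoff_field_def cutoff_def)

lemma vector_field_extending: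
  fixes M :: "('p, 'e::euclidean_space) chart set"
  assumes M: "smooth_manifold M" and v: "v \<in> tangent_space M x" and x: "x \<in> carrier M"
  obtains X where "X \<in> vector_fields M" "X x = v"
proof -
  have A: "smooth_atlas M" using M by (simp add: smooth_manifold_def)
  obtain c where c: "c \<in> M" "x \<in> fst c" using x by (rule carrierE)
  obtain \<phi> V where \<phi>: "cutoff M c x \<phi> V" using cutoff_exists[OF M c] by blast
  show thesis
  proof
    show "cutoff_field M c \<phi> (v c) \<in> vector_fields M" using \<phi> unfolding cutoff_def by blast
    show "cutoff_field M c \<phi> (v c) x = v"
      using cutoff_field_at[OF \<phi> c(2)] v c by (simp add: coord_vec_coords[OF A])
  qed
qed

text \<open>The square of the cutoff function is needed because both the coefficient and the frame field
  have to be cut off.\<close>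

lemma cutoff_decomposition:
  fixes M :: "('p, 'e::euclidean_space) chart set"
  assumes A: "smooth_atlas M" and c: "c \<in> M" and \<phi>: "cutoff M c x \<phi> V" and X: "X \<in> vector_fields M"
  shows "(\<lambda>y. (\<phi> y * \<phi> y) *\<^sub>R X y)
    = (\<Sum>i\<in>Basis. (\<lambda>y. (\<phi> y * (X y c \<bullet> i)) *\<^sub>R cutoff_field M c \<phi> i y))"
proof
  fix y
  show "(\<phi> y * \<phi> y) *\<^sub>R X y = (\<Sum>i\<in>Basis. (\<lambda>y. (\<phi> y * (X y c \<bullet> i)) *\<^sub>R cutoff_field M c \<phi> i y)) y"
  proof (cases "y \<in> fst c")
    case True
    note T = zero_in_tangent_space[OF A] scaleR_in_tangent_space[OF A] coord_vec_in_tangent_space[OF A c True]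
      vector_field_tangent[OF A X]
    have "(\<phi> y * \<phi> y) *\<^sub>R X y = (\<Sum>i\<in>Basis. (\<phi> y * (X y c \<bullet> i)) *\<^sub>R \<phi> y *\<^sub>R coord_vec M c y i)"
    proof (rule tangent_vector_eqI[OF A _ _ c True])
      have "(\<Sum>i\<in>Basis. (\<phi> y * (X y c \<bullet> i)) *\<^sub>R \<phi> y *\<^sub>R coord_vec M c y i) c
          = (\<phi> y * \<phi> y) *\<^sub>R (\<Sum>i\<in>Basis. (X y c \<bullet> i) *\<^sub>R i)"
        using c True by (simp add: sum_fun_apply coord_vec_same[OF A] scaleR_sum_right mult_ac)
      then show "((\<phi> y * \<phi> y) *\<^sub>R X y) c = (\<Sum>i\<in>Basis. (\<phi> y * (X y c \<bullet> i)) *\<^sub>R \<phi> y *\<^sub>R coord_vec M c y i) c"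
        by (simp add: euclidean_representation)
    qed (intro sum_in_tangent_space[OF A] T)+
    then show ?thesis using True by (simp add: sum_fun_apply cutoff_field_def)
  next
    case False
    then have "\<phi> y = 0" using \<phi> by (simp add: cutoff_def)
    then show ?thesis using False by (simp add: sum_fun_apply cutoff_field_def)
  qed
qed

section \<open>A linear connection in a chart\<close>

context
  fixes M :: "('p, 'e::euclidean_space) chart set" and D :: "('p, 'e) conn"
  assumes M: "smooth_manifold M" and D: "linear_connection M D"
begin

lemma atlas: "smooth_atlas M"
  using M by (simp add: smooth_manifold_def)

lemma connection_field: "X \<in> vector_fields M \<Longrightarrow> Y \<in> vector_fields M \<Longrightarrow> D X Y \<in> vector_fields M"
  using D by (simp add: linear_connection_def)

lemma connection_fun_left:
  "X \<in> vector_fields M \<Longrightarrow> Y \<in> vector_fields M \<Longrightarrow> smooth_fun_on M (carrier M) f \<Longrightarrow>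
    D (\<lambda>x. f x *\<^sub>R X x) Y = (\<lambda>x. f x *\<^sub>R D X Y x)"
  using D by (simp add: linear_connection_def)

lemma connection_fun_right:
  "X \<in> vector_fields M \<Longrightarrow> Y \<in> vector_fields M \<Longrightarrow> smooth_fun_on M (carrier M) f \<Longrightarrow>
    D X (\<lambda>x. f x *\<^sub>R Y x) = (\<lambda>x. dir_deriv M f x (X x) *\<^sub>R Y x + f x *\<^sub>R D X Y x)"
  using D by (simp add: linear_connection_def)

lemma connection_add_left:
  "X \<in> vector_fields M \<Longrightarrow> X' \<in> vector_fields M \<Longrightarrow> Y \<in> vector_fields M \<Longrightarrow> D (X + X') Y = D X Y + D X' Y"
  using D by (simp add: linear_connection_def)

lemma connection_add_right:
  "X \<in> vector_fields M \<Longrightarrow> Y \<in> vector_fields M \<Longrightarrow> Y' \<in> vector_fields M \<Longrightarrow> D X (Y + Y') = D X Y + D X Y'"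
  using D by (simp add: linear_connection_def)

lemma zero_vector_field: "0 \<in> vector_fields M"
proof -
  have "(\<lambda>x. 0) \<in> vector_fields M"
    by (rule vector_fieldI[OF atlas])
      (simp_all add: zero_in_tangent_space[OF atlas] smooth_on_const open_chart_image[OF atlas])
  then show ?thesis by (simp add: zero_fun_def)
qed

lemma connection_zero_left: 
  assumes Y: "Y \<in> vector_fields M"
  shows "D 0 Y = 0"
  using connection_add_left[OF zero_vector_field zero_vector_field Y] by simp

lemma connection_zero_right:
  assumes X: "X \<in> vector_fields M"
  shows "D X 0 = 0"
  using connection_add_right[OF X zero_vector_field zero_vector_field] by simp

lemma connection_sum:
  assumes "finite I" "\<And>i. i \<in> I \<Longrightarrow> X i \<in> vector_fields M" and Y: "Y \<in> vector_fields M"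
  shows "(\<Sum>i\<in>I. X i) \<in> vector_fields M" "D (\<Sum>i\<in>I. X i) Y = (\<Sum>i\<in>I. D (X i) Y)"
    "D Y (\<Sum>i\<in>I. X i) = (\<Sum>i\<in>I. D Y (X i))"
proof -
  have "(\<Sum>i\<in>I. X i) \<in> vector_fields M \<and> D (\<Sum>i\<in>I. X i) Y = (\<Sum>i\<in>I. D (X i) Y) \<and>
      D Y (\<Sum>i\<in>I. X i) = (\<Sum>i\<in>I. D Y (X i))"
    using assms(1,2)
  proof (induction I)
    case empty
    then show ?case
      using zero_vector_field connection_zero_left[OF Y] connection_zero_right[OF Y] by (simp only: sum.empty)
  next
    case (insert k I)
    then have k: "X k \<in> vector_fields M" and I: "(\<Sum>i\<in>I. X i) \<in> vector_fields M"
      "D (\<Sum>i\<in>I. X i) Y = (\<Sum>i\<in>I. D (X i) Y)" "D Y (\<Sum>i\<in>I. X i) = (\<Sum>i\<in>I. D Y (X i))" by simp_all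
    show ?case
      unfolding sum.insert[OF insert.hyps] connection_add_left[OF k I(1) Y] connection_add_right[OF Y k I(1)] I(2,3)
      by (intro conjI refl vector_field_add[OF atlas k I(1)])
  qed
  then show "(\<Sum>i\<in>I. X i) \<in> vector_fields M" "D (\<Sum>i\<in>I. X i) Y = (\<Sum>i\<in>I. D (X i) Y)"
    "D Y (\<Sum>i\<in>I. X i) = (\<Sum>i\<in>I. D Y (X i))" by simp_all
qed

text \<open>The two product rules, applied to the decomposition of the cut off fields. The derivative of the
  cutoff function at \<open>x\<close> vanishes, so it leaves no trace at \<open>x\<close>.\<close>

lemma connection_left_in_frame:
  assumes c: "c \<in> M" "x \<in> fst c" and \<phi>: "cutoff M c x \<phi> V"
    and X: "X \<in> vector_fields M" and Y: "Y \<in> vector_fields M"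
  shows "D X Y x = (\<Sum>i\<in>Basis. (X x c \<bullet> i) *\<^sub>R D (cutoff_field M c \<phi> i) Y x)"
proof -
  let ?E = "cutoff_field M c \<phi>" and ?f = "\<lambda>i y. \<phi> y * (X y c \<bullet> i)"
  have E: "?E i \<in> vector_fields M" and f: "smooth_fun_on M (carrier M) (?f i)"
    and \<phi>s: "smooth_fun_on M (carrier M) \<phi>" and \<phi>1: "\<phi> x = 1" for i
    using \<phi> X by (simp_all add: cutoff_def)
  note \<phi>X = vector_field_fun_scaleR[OF atlas \<phi>s X]
  have "D X Y x = (\<phi> x * \<phi> x) *\<^sub>R D X Y x" by (simp add: \<phi>1)
  also have "\<dots> = D (\<lambda>y. (\<phi> y * \<phi> y) *\<^sub>R X y) Y x"
    using connection_fun_left[OF \<phi>X Y \<phi>s] connection_fun_left[OF X Y \<phi>s] by simp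
  also have "\<dots> = (\<Sum>i\<in>Basis. D (\<lambda>y. ?f i y *\<^sub>R ?E i y) Y) x"
    unfolding cutoff_decomposition[OF atlas c(1) \<phi> X]
    by (subst connection_sum(2)) (use Y vector_field_fun_scaleR[OF atlas f E] in auto)
  also have "\<dots> = (\<Sum>i\<in>Basis. (X x c \<bullet> i) *\<^sub>R D (?E i) Y x)"
    unfolding sum_fun_apply[where x = x] by (intro sum.cong refl) (simp add: connection_fun_left[OF E Y f] \<phi>1)
  finally show ?thesis .
qed

lemma connection_right_in_frame:
  assumes c: "c \<in> M" "x \<in> fst c" and \<phi>: "cutoff M c x \<phi> V"
    and X: "X \<in> vector_fields M" and Y: "Y \<in> vector_fields M"
  shows "D X Y x c = frechet_derivative (\<lambda>a. Y (chart_inv c a) c) (at (snd c x)) (X x c)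
    + (\<Sum>i\<in>Basis. (Y x c \<bullet> i) *\<^sub>R D X (cutoff_field M c \<phi> i) x c)"
proof -
  let ?E = "cutoff_field M c \<phi>" and ?f = "\<lambda>i y. \<phi> y * (Y y c \<bullet> i)"
  let ?d = "frechet_derivative (\<lambda>a. Y (chart_inv c a) c) (at (snd c x))"
  have E: "?E i \<in> vector_fields M" and f: "smooth_fun_on M (carrier M) (?f i)"
    and \<phi>s: "smooth_fun_on M (carrier M) \<phi>" and \<phi>1: "\<phi> x = 1"
    and d\<phi>: "((\<lambda>a. \<phi> (chart_inv c a)) has_derivative (\<lambda>_. 0)) (at (snd c x))" for i
    using \<phi> Y by (simp_all add: cutoff_def)
  note Xx = vector_field_tangent[OF atlas X, of x]
  have inv: "chart_inv c (snd c x) = x" using c atlas by simp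
  have d0: "dir_deriv M \<phi> x (X x) = 0"
    using dir_deriv_in_chart[OF atlas \<phi>s carrierI[OF c] c Xx] frechet_derivative_at[OF d\<phi>]
    by (simp add: comp_def fun_eq_iff)
  have dY: "((\<lambda>a. Y (chart_inv c a) c) has_derivative ?d) (at (snd c x))"
    by (rule smooth_on_has_derivative[OF smooth_on_vector_field[OF atlas Y c(1)]]) (use c in blast)
  have df: "dir_deriv M (?f i) x (X x) = ?d (X x c) \<bullet> i" for i
  proof -
    have "((\<lambda>a. \<phi> (chart_inv c a) * (Y (chart_inv c a) c \<bullet> i)) has_derivative
        (\<lambda>h. \<phi> (chart_inv c (snd c x)) * (?d h \<bullet> i) + 0 * (Y (chart_inv c (snd c x)) c \<bullet> i))) (at (snd c x))"
      by (rule has_derivative_mult[OF d\<phi> has_derivative_inner_left[OF dY]])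
    from frechet_derivative_at[OF this] show ?thesis
      using dir_deriv_in_chart[OF atlas f carrierI[OF c] c Xx, of i]
      by (simp add: comp_def fun_eq_iff inv \<phi>1)
  qed
  note \<phi>Y = vector_field_fun_scaleR[OF atlas \<phi>s Y]
  have "D X Y x = D X (\<lambda>y. (\<phi> y * \<phi> y) *\<^sub>R Y y) x"
    using connection_fun_right[OF X \<phi>Y \<phi>s] connection_fun_right[OF X Y \<phi>s] by (simp add: d0 \<phi>1)
  also have "\<dots> = (\<Sum>i\<in>Basis. D X (\<lambda>y. ?f i y *\<^sub>R ?E i y)) x"
    unfolding cutoff_decomposition[OF atlas c(1) \<phi> Y]
    by (subst connection_sum(3)) (use X vector_field_fun_scaleR[OF atlas f E] in auto)
  also have "\<dots> = (\<Sum>i\<in>Basis. (?d (X x c) \<bullet> i) *\<^sub>R coord_vec M c x i + (Y x c \<bullet> i) *\<^sub>R D X (?E i) x)"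
    unfolding sum_fun_apply[where x = x]
    by (intro sum.cong refl) (simp add: connection_fun_right[OF X E f] \<phi>1 df cutoff_field_at[OF \<phi> c(2)])
  finally have "D X Y x c = (\<Sum>i\<in>Basis. (?d (X x c) \<bullet> i) *\<^sub>R i + (Y x c \<bullet> i) *\<^sub>R D X (?E i) x c)"
    using c by (simp add: sum_fun_apply coord_vec_same[OF atlas])
  then show ?thesis by (simp add: sum.distrib euclidean_representation)
qed

text \<open>By the two frame formulas the value at \<open>x\<close> depends on the derivatives of the frame fields along
  each other only; these are the Christoffel symbols at \<open>x\<close>.\<close>

lemma connection_in_chart:
  assumes c: "c \<in> M" "x \<in> fst c"
  obtains \<Gamma> :: "'e \<Rightarrow> 'e \<Rightarrow>\<^sub>L 'e" where
    "\<And>X Y. X \<in> vector_fields M \<Longrightarrow> Y \<in> vector_fields M \<Longrightarrow>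
      D X Y x c = frechet_derivative (\<lambda>a. Y (chart_inv c a) c) (at (snd c x)) (X x c) + \<Gamma> (X x c) (Y x c)"
proof -
  obtain \<phi> V where \<phi>: "cutoff M c x \<phi> V" using cutoff_exists[OF M c] by blast
  let ?E = "cutoff_field M c \<phi>"
  have E: "?E i \<in> vector_fields M" for i using \<phi> by (simp add: cutoff_def)
  define \<Gamma> where "\<Gamma> u = (\<Sum>i\<in>Basis. blinfun_scaleR_left (\<Sum>k\<in>Basis. (u \<bullet> k) *\<^sub>R D (?E k) (?E i) x c)
      o\<^sub>L blinfun_inner_right i)" for u :: 'e
  have "(\<Sum>i\<in>Basis. (Y x c \<bullet> i) *\<^sub>R D X (?E i) x c) = \<Gamma> (X x c) (Y x c)"
    if X: "X \<in> vector_fields M" for X Y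
    unfolding \<Gamma>_def connection_left_in_frame[OF c \<phi> X E]
    by (simp add: blinfun.sum_left sum_fun_apply inner_commute)
  then show thesis
    using that connection_right_in_frame[OF c \<phi>] by simp
qed

end

section \<open>Tangent vectors of the bundle of complex structures in coordinates\<close>

text \<open>A point \<open>(x, J)\<close> of the bundle, a chart \<open>c\<close> around \<open>x\<close>, and the connection form \<open>\<Gamma>\<close> at \<open>x\<close> in this
  chart. Everything below is computed in the chart \<open>C\<close> of the endomorphism bundle induced by \<open>c\<close>, in
  which a tangent vector at \<open>(x, J)\<close> is a pair \<open>(u, b)\<close> of a vector and an operator.\<close>

locale complex_structure_point =
  fixes M :: "('p, 'e::euclidean_space) chart set" and D :: "('p, 'e) conn"
    and c :: "('p, 'e) chart" and x :: 'p and \<Gamma> :: "'e \<Rightarrow> 'e \<Rightarrow>\<^sub>L 'e" and J :: "('p, 'e) tendo"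
  assumes M: "smooth_manifold M" and D: "linear_connection M D" and c: "c \<in> M" "x \<in> fst c"
    and connection_coords: "\<And>X Y. X \<in> vector_fields M \<Longrightarrow> Y \<in> vector_fields M \<Longrightarrow>
      D X Y x c = frechet_derivative (\<lambda>a. Y (chart_inv c a) c) (at (snd c x)) (X x c) + \<Gamma> (X x c) (Y x c)"
    and J: "J \<in> cstructs M x"
begin

abbreviation "C \<equiv> End_chart M c"
abbreviation "Jc \<equiv> endo_coord M c x J"
abbreviation "TE \<equiv> tangent_space (End_atlas M) (x, J)"

abbreviation field_deriv :: "('p \<Rightarrow> ('p, 'e) tvec) \<Rightarrow> 'e \<Rightarrow> 'e" where
  "field_deriv Y \<equiv> frechet_derivative (\<lambda>a. Y (chart_inv c a) c) (at (snd c x))"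

text \<open>The commutator \<open>[\<Gamma> u, J]\<close>: the difference between the covariant derivative of an endomorphism
  field with value \<open>J\<close> at \<open>x\<close> and the derivative of its coordinates.\<close>

definition bracket :: "'e \<Rightarrow> 'e \<Rightarrow>\<^sub>L 'e" where
  "bracket u = (\<Gamma> u o\<^sub>L Jc) - (Jc o\<^sub>L \<Gamma> u)"

lemma A: "smooth_atlas M" and E: "smooth_atlas (End_atlas M)"
  using M smooth_atlas_End by (auto simp: smooth_manifold_def)

lemma J_endo: "J \<in> endos M x"
  using J by (simp add: cstructs_def)

lemma xM: "x \<in> carrier M"
  by (rule carrierI[OF c])

lemma C: "C \<in> End_atlas M" "(x, J) \<in> fst C"
  using c J_endo by (simp_all add: End_chart_in_End_atlas[OF A])

lemma p_carrier: "(x, J) \<in> carrier (End_atlas M)"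
  by (rule carrierI[OF C])

lemma C_at [simp]: "snd C (x, J) = (snd c x, Jc)"
  by (simp add: End_chart_simps)

lemma p_Z0: "(x, J) \<in> Z0 M"
  using J xM by (simp add: Z0_def)

lemma Jc_square: "Jc o\<^sub>L Jc = - id_blinfun"
  using in_cstructs_iff[OF A c J_endo] J by simp

lemma Jc_Jc [simp]: "Jc (Jc w) = - w"
  using arg_cong[OF Jc_square, of "\<lambda>B. blinfun_apply B w"] by (simp add: blinfun.minus_left)

lemma C_image: "snd C ` fst C = (snd c ` fst c) \<times> UNIV"
  using End_overlap_image[OF A c(1), of c] by simp

definition tangent_curve :: "(real \<Rightarrow> 'p \<times> ('p, 'e) tendo) \<Rightarrow> real set \<Rightarrow> ('p, 'e) Ztvec \<Rightarrow> bool" where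
  "tangent_curve \<gamma> I \<xi> \<longleftrightarrow> smooth_map_on {model_chart} (End_atlas M) I \<gamma> \<and> 0 \<in> I \<and> \<gamma> 0 = (x, J) \<and>
     \<gamma> ` I \<subseteq> Z0 M \<and> velocity (End_atlas M) \<gamma> 0 = \<xi>"

lemma TZ0_curve:
  assumes "\<xi> \<in> TZ0 M (x, J)"
  obtains \<gamma> I where "tangent_curve \<gamma> I \<xi>"
proof -
  obtain \<gamma> \<epsilon> where g: "\<xi> = velocity (End_atlas M) \<gamma> 0" "\<gamma> 0 = (x, J)" "0 < \<epsilon>" "\<gamma> ` {-\<epsilon><..<\<epsilon>} \<subseteq> Z0 M"
    "smooth_map_on {model_chart} (End_atlas M) {-\<epsilon><..<\<epsilon>} \<gamma>"
    using assms unfolding TZ0_def sub_tangent_space_def by blast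
  show thesis by (rule that[of \<gamma> "{-\<epsilon><..<\<epsilon>}"]) (use g in \<open>simp add: tangent_curve_def\<close>)
qed

lemma tangent_curveD:
  assumes "tangent_curve \<gamma> I \<xi>"
  shows "smooth_map_on {model_chart} (End_atlas M) I \<gamma>" "0 \<in> I" "\<gamma> 0 = (x, J)" "\<gamma> ` I \<subseteq> Z0 M"
    "velocity (End_atlas M) \<gamma> 0 = \<xi>" "\<gamma> 0 \<in> fst C"
  using assms C(2) by (simp_all add: tangent_curve_def)

lemma tangent_curve_velocity:
  assumes \<gamma>: "tangent_curve \<gamma> I \<xi>"
  shows "\<xi> \<in> TE"
    and "((snd C \<circ> \<gamma>) has_vector_derivative \<xi> C) (at 0)"
    and "((\<lambda>t. fst (snd C (\<gamma> t))) has_vector_derivative fst (\<xi> C)) (at 0)"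
    and "((\<lambda>t. snd (snd C (\<gamma> t))) has_vector_derivative snd (\<xi> C)) (at 0)"
proof -
  note g = tangent_curveD[OF \<gamma>]
  show "\<xi> \<in> TE" using velocity_in_tangent_space[OF E g(1,2)] g(3,5) by simp
  show *: "((snd C \<circ> \<gamma>) has_vector_derivative \<xi> C) (at 0)"
    using velocity_in_chart[OF E g(1,2) C(1) g(6)] g(5) by simp
  show "((\<lambda>t. fst (snd C (\<gamma> t))) has_vector_derivative fst (\<xi> C)) (at 0)"
    using bounded_linear.has_vector_derivative[OF bounded_linear_fst *] by (simp add: comp_def)
  show "((\<lambda>t. snd (snd C (\<gamma> t))) has_vector_derivative snd (\<xi> C)) (at 0)"
    using bounded_linear.has_vector_derivative[OF bounded_linear_snd *] by (simp add: comp_def)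
qed

lemma tangent_curve_in_chart:
  assumes \<gamma>: "tangent_curve \<gamma> I \<xi>"
  obtains V where "open V" "0 \<in> V" "V \<subseteq> I" "\<And>t. t \<in> V \<Longrightarrow> \<gamma> t \<in> fst C"
  using smooth_curve_stays_in_chart[OF E tangent_curveD(1,2)[OF \<gamma>] C(1) tangent_curveD(6)[OF \<gamma>]] by metis

lemma tangent_curve_point:
  assumes \<gamma>: "tangent_curve \<gamma> I \<xi>" and t: "t \<in> I" "\<gamma> t \<in> fst C"
  shows "fst (\<gamma> t) \<in> fst c" "snd (\<gamma> t) \<in> cstructs M (fst (\<gamma> t))" "snd (\<gamma> t) \<in> endos M (fst (\<gamma> t))"
    "snd C (\<gamma> t) = (snd c (fst (\<gamma> t)), endo_coord M c (fst (\<gamma> t)) (snd (\<gamma> t)))"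
proof -
  have "\<gamma> t \<in> Z0 M" using t(1) tangent_curveD(4)[OF \<gamma>] by blast
  then show "snd (\<gamma> t) \<in> cstructs M (fst (\<gamma> t))" by (cases "\<gamma> t") (simp add: Z0_def)
  show "fst (\<gamma> t) \<in> fst c" "snd (\<gamma> t) \<in> endos M (fst (\<gamma> t))"
    "snd C (\<gamma> t) = (snd c (fst (\<gamma> t)), endo_coord M c (fst (\<gamma> t)) (snd (\<gamma> t)))"
    using t(2) by (cases "\<gamma> t"; simp)+
qed

lemma TZ0_tangent: "\<xi> \<in> TZ0 M (x, J) \<Longrightarrow> \<xi> \<in> TE"
  by (rule TZ0_curve, assumption, rule tangent_curve_velocity(1))

text \<open>Differentiate \<open>B\<^sup>2 = -1\<close> along a curve.\<close>

lemma TZ0_anticommutes: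
  assumes \<xi>: "\<xi> \<in> TZ0 M (x, J)"
  shows "(Jc o\<^sub>L snd (\<xi> C)) + (snd (\<xi> C) o\<^sub>L Jc) = 0"
proof -
  obtain \<gamma> I where \<gamma>: "tangent_curve \<gamma> I \<xi>" by (rule TZ0_curve[OF \<xi>])
  obtain V where V: "open V" "0 \<in> V" "V \<subseteq> I" "\<And>t. t \<in> V \<Longrightarrow> \<gamma> t \<in> fst C"
    using tangent_curve_in_chart[OF \<gamma>] by metis
  let ?B = "\<lambda>t. snd (snd C (\<gamma> t))"
  note d = tangent_curve_velocity(4)[OF \<gamma>]
  from bounded_bilinear.has_vector_derivative[OF bounded_bilinear_blinfun_compose d d]
  have "((\<lambda>t. ?B t o\<^sub>L ?B t) has_vector_derivative ((Jc o\<^sub>L snd (\<xi> C)) + (snd (\<xi> C) o\<^sub>L Jc))) (at 0)"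
    using tangent_curveD(3)[OF \<gamma>] by simp
  moreover have "((\<lambda>t. ?B t o\<^sub>L ?B t) has_vector_derivative 0) (at 0)"
  proof (rule has_vector_derivative_transform_within_open[OF has_vector_derivative_const V(1,2)])
    fix t assume t: "t \<in> V"
    note pt = tangent_curve_point[OF \<gamma> subsetD[OF V(3) t] V(4)[OF t]]
    show "- id_blinfun = ?B t o\<^sub>L ?B t"
      using in_cstructs_iff[OF A c(1) pt(1,3)] pt(2,4) by simp
  qed
  ultimately show ?thesis by (rule vector_derivative_unique_at)
qed

text \<open>An operator \<open>b\<close> anticommuting with \<open>J\<close> is \<open>[K, J]\<close> with \<open>K = J b / 2\<close>, hence the velocity of
  the conjugates of \<open>J\<close> by \<open>1 + t K\<close>.\<close>

lemma TZ0_vector_exists: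
  assumes b: "(Jc o\<^sub>L b) + (b o\<^sub>L Jc) = 0"
  obtains \<xi> where "\<xi> \<in> TZ0 M (x, J)" "\<xi> C = (u, b)"
proof -
  define K where "K = (1/2) *\<^sub>R (Jc o\<^sub>L b)"
  obtain \<epsilon> G where G: "0 < \<epsilon>" "smooth_on {-\<epsilon><..<\<epsilon>} G" "G 0 = id_blinfun"
    "\<And>t. t \<in> {-\<epsilon><..<\<epsilon>} \<Longrightarrow> (id_blinfun + t *\<^sub>R K) o\<^sub>L G t = id_blinfun"
    "\<And>t. t \<in> {-\<epsilon><..<\<epsilon>} \<Longrightarrow> G t o\<^sub>L (id_blinfun + t *\<^sub>R K) = id_blinfun"
    "(G has_vector_derivative - K) (at 0)"
    using smooth_inverse_curve[of K] by metis
  let ?a = "\<lambda>t::real. snd c x + t *\<^sub>R u" and ?B = "\<lambda>t. ((id_blinfun + t *\<^sub>R K) o\<^sub>L Jc) o\<^sub>L G t"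
  let ?U = "snd c ` fst c"
  have "open (?a -` ?U)"
    by (intro open_vimage open_chart_image[OF A c(1)] continuous_intros)
  moreover have "0 \<in> ?a -` ?U" using c by simp
  ultimately obtain \<delta> where \<delta>: "0 < \<delta>" "ball 0 \<delta> \<subseteq> ?a -` ?U"
    using open_contains_ball by blast
  define r where "r = min \<epsilon> \<delta>"
  define I where "I = {-r<..<r}"
  have I: "open I" "0 \<in> I" "0 < r" and I\<epsilon>: "\<And>t. t \<in> I \<Longrightarrow> t \<in> {-\<epsilon><..<\<epsilon>}" and aU: "\<And>t. t \<in> I \<Longrightarrow> ?a t \<in> ?U"
    using G(1) \<delta>(1) subsetD[OF \<delta>(2)] by (auto simp: I_def r_def dist_real_def)
  define \<gamma> where "\<gamma> t = (chart_inv c (?a t), coord_endo M c (chart_inv c (?a t)) (?B t))" for t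
  have y: "chart_inv c (?a t) \<in> fst c" if "t \<in> I" for t using chart_inv_mem[OF aU[OF that]] .
  have \<gamma>C: "\<gamma> t \<in> fst C" "snd C (\<gamma> t) = (?a t, ?B t)" if t: "t \<in> I" for t
    using y[OF t] chart_chart_inv[OF aU[OF t]] c(1)
    by (simp_all add: \<gamma>_def End_chart_simps coord_endo_in_endos[OF A] endo_coord_coord_endo[OF A])
  have \<gamma>0: "\<gamma> 0 = (x, J)"
    using A c J_endo by (simp add: \<gamma>_def G(3) coord_endo_endo_coord[OF A])
  have sm: "smooth_on I (\<lambda>t. (?a t, ?B t))"
    by (intro smooth_on_Pair smooth_on_add smooth_on_scaleR smooth_on_blinfun_compose smooth_on_const smooth_on_ident I(1)
        smooth_on_subset[OF G(2)]) (use I\<epsilon> in auto)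
  have "smooth_on I (snd C \<circ> \<gamma> \<circ> chart_inv model_chart)"
    by (rule smooth_on_cong[OF I(1) _ sm]) (simp add: \<gamma>C(2))
  then have \<gamma>s: "smooth_map_on {model_chart} (End_atlas M) I \<gamma>"
    using I(1) \<gamma>C(1) by (intro smooth_map_on_chartI[where c = model_chart, OF _ C(1)]) (simp_all del: End_chart_simps)
  have "\<gamma> ` I \<subseteq> Z0 M"
  proof
    fix p assume "p \<in> \<gamma> ` I"
    then obtain t where t: "t \<in> I" "p = \<gamma> t" by blast
    let ?K = "coord_endo M c (chart_inv c (?a t)) (?B t)"
    have Ke: "?K \<in> endos M (chart_inv c (?a t))" by (rule coord_endo_in_endos[OF A c(1) y[OF t(1)]])
    have PG: "(id_blinfun + t *\<^sub>R K) (G t w) = w" and GP: "G t ((id_blinfun + t *\<^sub>R K) w) = w" for w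
      using G(4,5)[OF I\<epsilon>[OF t(1)]] by (metis blinfun_apply_blinfun_compose blinfun_apply_id_blinfun)+
    have "?B t o\<^sub>L ?B t = - id_blinfun"
      by (rule blinfun_eqI) (simp add: GP blinfun.minus_right PG blinfun.minus_left)
    then have "?K \<in> cstructs M (chart_inv c (?a t))"
      using in_cstructs_iff[OF A c(1) y[OF t(1)] Ke] c(1) y[OF t(1)] by (simp add: endo_coord_coord_endo[OF A])
    then show "p \<in> Z0 M"
      using t carrierI[OF c(1) y[OF t(1)]] by (simp add: Z0_def \<gamma>_def)
  qed
  then have T: "velocity (End_atlas M) \<gamma> 0 \<in> TZ0 M (x, J)"
    unfolding TZ0_def sub_tangent_space_def using \<gamma>0 \<gamma>s I(3) by (auto simp: I_def)
  have "((\<lambda>t. (?a t, ?B t)) has_vector_derivative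
      (u, (((id_blinfun + 0 *\<^sub>R K) o\<^sub>L Jc) o\<^sub>L (- K)) + ((K o\<^sub>L Jc) o\<^sub>L G 0))) (at 0)"
  proof (intro has_vector_derivative_Pair)
    show "(?a has_vector_derivative u) (at 0)" by (auto intro!: derivative_eq_intros)
    have "((\<lambda>t. id_blinfun + t *\<^sub>R K) has_vector_derivative K) (at 0)" by (auto intro!: derivative_eq_intros)
    from bounded_linear.has_vector_derivative[OF bounded_bilinear.bounded_linear_left[OF bounded_bilinear_blinfun_compose] this]
    have "((\<lambda>t. (id_blinfun + t *\<^sub>R K) o\<^sub>L Jc) has_vector_derivative (K o\<^sub>L Jc)) (at 0)" .
    from bounded_bilinear.has_vector_derivative[OF bounded_bilinear_blinfun_compose this G(6)]
    show "(?B has_vector_derivative (((id_blinfun + 0 *\<^sub>R K) o\<^sub>L Jc) o\<^sub>L (- K)) + ((K o\<^sub>L Jc) o\<^sub>L G 0)) (at 0)" .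
  qed
  moreover have "(((id_blinfun + 0 *\<^sub>R K) o\<^sub>L Jc) o\<^sub>L (- K)) + ((K o\<^sub>L Jc) o\<^sub>L G 0) = b"
  proof (rule blinfun_eqI)
    fix w
    have bJ: "b (Jc w) = - Jc (b w)"
      using arg_cong[OF b, of "\<lambda>B. blinfun_apply B w"] by (simp add: blinfun.add_left add_eq_0_iff)
    show "((((id_blinfun + 0 *\<^sub>R K) o\<^sub>L Jc) o\<^sub>L (- K)) + ((K o\<^sub>L Jc) o\<^sub>L G 0)) w = b w"
      by (simp add: G(3) K_def blinfun.add_left blinfun.minus_left blinfun.minus_right blinfun.scaleR_left
          blinfun.scaleR_right bJ scaleR_half_double flip: scaleR_add_left)
  qed
  ultimately have "((\<lambda>t. (?a t, ?B t)) has_vector_derivative (u, b)) (at 0)" by simp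
  then have "((snd C \<circ> \<gamma>) has_vector_derivative (u, b)) (at 0)"
    by (rule has_vector_derivative_transform_within_open[OF _ I(1,2)]) (simp add: \<gamma>C(2))
  then have "velocity (End_atlas M) \<gamma> 0 C = (u, b)"
    using C \<gamma>0 by (simp add: velocity_def vector_derivative_at)
  then show thesis using that T by blast
qed

lemma TE_eqI: "\<xi> \<in> TE \<Longrightarrow> \<eta> \<in> TE \<Longrightarrow> \<xi> C = \<eta> C \<Longrightarrow> \<xi> = \<eta>"
  by (rule tangent_vector_eqI[OF E _ _ C])

text \<open>In particular \<open>TZ0\<close> is a linear space, which its definition by velocities of curves does not
  show.\<close>

lemma TZ0_iff: "\<xi> \<in> TZ0 M (x, J) \<longleftrightarrow> \<xi> \<in> TE \<and> (Jc o\<^sub>L snd (\<xi> C)) + (snd (\<xi> C) o\<^sub>L Jc) = 0"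
proof
  assume *: "\<xi> \<in> TE \<and> (Jc o\<^sub>L snd (\<xi> C)) + (snd (\<xi> C) o\<^sub>L Jc) = 0"
  obtain \<eta> where \<eta>: "\<eta> \<in> TZ0 M (x, J)" "\<eta> C = (fst (\<xi> C), snd (\<xi> C))"
    by (rule TZ0_vector_exists[OF *[THEN conjunct2]])
  have "\<xi> = \<eta>" by (rule TE_eqI[OF *[THEN conjunct1] TZ0_tangent[OF \<eta>(1)]]) (simp add: \<eta>(2))
  then show "\<xi> \<in> TZ0 M (x, J)" using \<eta>(1) by simp
qed (simp add: TZ0_tangent TZ0_anticommutes)

lemma smooth_projection: "smooth_map_on (End_atlas M) M (carrier (End_atlas M)) fst"
proof (rule smooth_map_on_carrierI[OF E])
  fix c' assume "c' \<in> End_atlas M"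
  then obtain d where d: "d \<in> M" "c' = End_chart M d" by (auto simp: End_atlas_def)
  let ?V = "snd c' ` fst c'"
  have V: "?V = (snd d ` fst d) \<times> UNIV" using End_overlap_image[OF A d(1), of d] d(2) by simp
  have o: "open ?V" using open_chart_image[OF E End_chart_in_End_atlas[OF A d(1)]] d(2) by blast
  have "smooth_on ?V (snd d \<circ> fst \<circ> chart_inv c')"
  proof (rule smooth_on_cong[OF o _ smooth_on_fst[OF o smooth_on_ident[OF o]]])
    fix q assume "q \<in> ?V"
    then have "fst q \<in> snd d ` fst d" unfolding V by auto
    then show "fst q = (snd d \<circ> fst \<circ> chart_inv c') q"
      using chart_inv_End_chart[OF A d(1), of "fst q" "snd q"] d(2) by simp
  qed
  then show "\<exists>d\<in>M. (\<forall>x\<in>fst c'. fst x \<in> fst d) \<and> smooth_on ?V (snd d \<circ> fst \<circ> chart_inv c')"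
    using d by (intro bexI[OF _ d(1)]) auto
qed

lemma dproj_coords:
  assumes \<xi>: "\<xi> \<in> TE"
  shows "dproj M (x, J) \<xi> \<in> tangent_space M x" "dproj M (x, J) \<xi> c = fst (\<xi> C)"
proof -
  show "dproj M (x, J) \<xi> \<in> tangent_space M x"
    using differential_in_tangent_space[OF E A smooth_projection p_carrier p_carrier \<xi>] by (simp add: dproj_def)
  have "((snd c \<circ> fst \<circ> chart_inv C) has_derivative fst) (at (snd C (x, J)))"
  proof (rule has_derivative_transform_within_open[OF bounded_linear_imp_has_derivative[OF bounded_linear_fst] open_chart_image[OF E C(1)]])
    show "snd C (x, J) \<in> snd C ` fst C" using C(2) by blast
    fix q assume "q \<in> snd C ` fst C"
    then have "fst q \<in> snd c ` fst c" unfolding C_image by auto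
    then show "fst q = (snd c \<circ> fst \<circ> chart_inv C) q"
      using chart_inv_End_chart[OF A c(1), of "fst q" "snd q"] by simp
  qed
  from frechet_derivative_at[OF this, unfolded C_at, symmetric]
  show "dproj M (x, J) \<xi> c = fst (\<xi> C)"
    using differential_in_chart[OF E A smooth_projection p_carrier p_carrier C c(1) _ \<xi>] c(2)
    by (simp add: dproj_def)
qed

section \<open>The pulled back connection\<close>

text \<open>The formula for the connection in the chart contains the field \<open>X\<close> through its value at \<open>x\<close>
  only, so the covariant derivative along a single vector is well defined.\<close>

lemma cov_deriv_at_coords:
  assumes v: "v \<in> tangent_space M x" and Y: "Y \<in> vector_fields M"
  shows "cov_deriv_at M D x v Y \<in> tangent_space M x"
    "cov_deriv_at M D x v Y c = field_deriv Y (v c) + \<Gamma> (v c) (Y x c)"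
proof -
  obtain X where X: "X \<in> vector_fields M" "X x = v" using vector_field_extending[OF M v xM] by blast
  have t: "D X' Y x \<in> tangent_space M x" if "X' \<in> vector_fields M" for X'
    by (rule vector_field_tangent[OF A connection_field[OF M D that Y]])
  have "cov_deriv_at M D x v Y = D X Y x"
    unfolding cov_deriv_at_def
  proof (rule the_equality)
    fix z assume "\<exists>X\<in>vector_fields M. X x = v \<and> z = D X Y x"
    then obtain X' where X': "X' \<in> vector_fields M" "X' x = v" "z = D X' Y x" by blast
    have "D X' Y x c = D X Y x c"
      unfolding connection_coords[OF X'(1) Y] connection_coords[OF X(1) Y] X'(2) X(2) ..
    then have "D X' Y x = D X Y x" by (rule tangent_vector_eqI[OF A t[OF X'(1)] t[OF X(1)] c])
    then show "z = D X Y x" using X'(3) by simp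
  qed (use X in blast)
  then show "cov_deriv_at M D x v Y \<in> tangent_space M x"
    "cov_deriv_at M D x v Y c = field_deriv Y (v c) + \<Gamma> (v c) (Y x c)"
    using t[OF X(1)] connection_coords[OF X(1) Y] X(2) by simp_all
qed

text \<open>The representations of a section which \<open>pullback_deriv\<close> quantifies over.\<close>

definition represents ::
  "nat \<Rightarrow> (nat \<Rightarrow> 'p \<times> ('p, 'e) tendo \<Rightarrow> real) \<Rightarrow> (nat \<Rightarrow> 'p \<Rightarrow> ('p, 'e) tvec) \<Rightarrow>
    ('p \<times> ('p, 'e) tendo) set \<Rightarrow> ('p \<times> ('p, 'e) tendo \<Rightarrow> ('p, 'e) tvec) \<Rightarrow> bool" where
  "represents k s Y W \<sigma> \<longleftrightarrow> atlas_open (End_atlas M) W \<and> (x, J) \<in> W \<and>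
     (\<forall>i<k. smooth_fun_on (End_atlas M) W (s i) \<and> Y i \<in> vector_fields M) \<and>
     (\<forall>q\<in>W \<inter> Z0 M. \<sigma> q = (\<Sum>i<k. s i q *\<^sub>R Y i (fst q)))"

definition representation_deriv ::
  "('p, 'e) Ztvec \<Rightarrow> nat \<Rightarrow> (nat \<Rightarrow> 'p \<times> ('p, 'e) tendo \<Rightarrow> real) \<Rightarrow> (nat \<Rightarrow> 'p \<Rightarrow> ('p, 'e) tvec) \<Rightarrow> ('p, 'e) tvec" where
  "representation_deriv \<xi> k s Y = (\<Sum>i<k. dir_deriv (End_atlas M) (s i) (x, J) \<xi> *\<^sub>R Y i x +
     s i (x, J) *\<^sub>R cov_deriv_at M D x (dproj M (x, J) \<xi>) (Y i))"

lemma pullback_deriv_representation: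
  "pullback_deriv M D (x, J) \<xi> \<sigma> = (THE z. \<exists>k s Y W. represents k s Y W \<sigma> \<and> z = representation_deriv \<xi> k s Y)"
  unfolding pullback_deriv_def represents_def representation_deriv_def by (simp add: conj_assoc)

lemma field_along_curve:
  assumes \<gamma>: "tangent_curve \<gamma> I \<xi>" and Y: "Y \<in> vector_fields M"
  shows "((\<lambda>t. Y (fst (\<gamma> t)) c) has_vector_derivative field_deriv Y (fst (\<xi> C))) (at 0)"
proof -
  obtain V where V: "open V" "0 \<in> V" "V \<subseteq> I" "\<And>t. t \<in> V \<Longrightarrow> \<gamma> t \<in> fst C"
    using tangent_curve_in_chart[OF \<gamma>] by metis
  have "((\<lambda>a. Y (chart_inv c a) c) has_derivative field_deriv Y) (at (snd c x))"
    by (rule smooth_on_has_derivative[OF smooth_on_vector_field[OF A Y c(1)]]) (use c in blast)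
  then have Yd: "((\<lambda>a. Y (chart_inv c a) c) has_derivative field_deriv Y) (at (fst (snd C (\<gamma> 0))))"
    using tangent_curveD(3)[OF \<gamma>] by simp
  have "((\<lambda>t. Y (chart_inv c (fst (snd C (\<gamma> t)))) c) has_vector_derivative field_deriv Y (fst (\<xi> C))) (at 0)"
    using has_derivative_compose[OF tangent_curve_velocity(3)[OF \<gamma>, unfolded has_vector_derivative_def] Yd]
      has_derivative_bounded_linear[OF Yd]
    by (simp add: has_vector_derivative_def linear_simps)
  then show ?thesis
  proof (rule has_vector_derivative_transform_within_open[OF _ V(1,2)])
    fix t assume t: "t \<in> V"
    note pt = tangent_curve_point[OF \<gamma> subsetD[OF V(3) t] V(4)[OF t]]
    show "Y (chart_inv c (fst (snd C (\<gamma> t)))) c = Y (fst (\<gamma> t)) c" using pt(1,4) A c(1) by simp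
  qed
qed

text \<open>Along a curve in \<open>Z0\<close> with velocity \<open>\<xi>\<close>, the value of a representation is the derivative of the
  coordinates of the section plus the connection form. The section alone determines both, so all
  its representations have the same value.\<close>

lemma representation_deriv_coords:
  assumes \<gamma>: "tangent_curve \<gamma> I \<xi>" and r: "represents k s Y W \<sigma>"
  shows "representation_deriv \<xi> k s Y \<in> tangent_space M x"
    "((\<lambda>t. \<sigma> (\<gamma> t) c) has_vector_derivative (representation_deriv \<xi> k s Y c - \<Gamma> (fst (\<xi> C)) (\<sigma> (x, J) c))) (at 0)"
proof -
  have W: "atlas_open (End_atlas M) W" "(x, J) \<in> W"
    and s: "\<And>i. i < k \<Longrightarrow> smooth_fun_on (End_atlas M) W (s i)"
    and Y: "\<And>i. i < k \<Longrightarrow> Y i \<in> vector_fields M"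
    and rep: "\<And>q. q \<in> W \<Longrightarrow> q \<in> Z0 M \<Longrightarrow> \<sigma> q = (\<Sum>i<k. s i q *\<^sub>R Y i (fst q))"
    using r unfolding represents_def by blast+
  note g = tangent_curveD[OF \<gamma>] and vel = tangent_curve_velocity[OF \<gamma>]
  note dp = dproj_coords[OF vel(1)]
  let ?u = "fst (\<xi> C)"
  let ?ds = "\<lambda>i. dir_deriv (End_atlas M) (s i) (x, J) \<xi>"
  show "representation_deriv \<xi> k s Y \<in> tangent_space M x"
    unfolding representation_deriv_def
    by (intro sum_in_tangent_space[OF A] add_in_tangent_space[OF A] scaleR_in_tangent_space[OF A]
        vector_field_tangent[OF A] cov_deriv_at_coords(1) dp(1) Y) auto
  obtain V where V: "open V" "0 \<in> V" "V \<subseteq> I" "\<And>t. t \<in> V \<Longrightarrow> \<gamma> t \<in> fst C"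
    using tangent_curve_in_chart[OF \<gamma>] by metis
  \<comment> \<open>\<open>\<gamma>\<close> is continuous at \<open>0\<close>, so it stays in the open set \<open>W\<close> for a short time\<close>
  obtain V' where V': "open V'" "0 \<in> V'" "V' \<subseteq> V" "\<And>t. t \<in> V' \<Longrightarrow> \<gamma> t \<in> W"
  proof -
    have cont: "isCont (snd C \<circ> \<gamma>) 0" by (rule has_vector_derivative_continuous[OF vel(2)])
    have op: "open (snd C ` (W \<inter> fst C))" by (rule atlas_open_chart_image[OF E W(1) C(1)])
    have mem: "(snd C \<circ> \<gamma>) 0 \<in> snd C ` (W \<inter> fst C)" unfolding comp_apply g(3) using W(2) C(2) by blast
    obtain T where T: "open T" "0 \<in> T" "\<And>t. t \<in> T \<Longrightarrow> (snd C \<circ> \<gamma>) t \<in> snd C ` (W \<inter> fst C)"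
      using cont[unfolded continuous_at_open, rule_format, OF conjI[OF op mem]] by metis
    show thesis
    proof (rule that[of "V \<inter> T"])
      fix t assume "t \<in> V \<inter> T"
      then have t: "t \<in> V" "t \<in> T" by simp_all
      obtain q where q: "q \<in> W" "q \<in> fst C" "snd C (\<gamma> t) = snd C q"
        using T(3)[OF t(2)] unfolding comp_apply by blast
      have "\<gamma> t = q" by (rule inj_onD[OF smooth_atlas_injD[OF E C(1)] q(3) V(4)[OF t(1)] q(2)])
      then show "\<gamma> t \<in> W" using q(1) by simp
    qed (use V T in auto)
  qed
  have summand: "((\<lambda>t. s i (\<gamma> t) *\<^sub>R Y i (fst (\<gamma> t)) c) has_vector_derivative
      (s i (x, J) *\<^sub>R field_deriv (Y i) ?u + ?ds i *\<^sub>R Y i x c)) (at 0)" if i: "i < k" for i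
  proof -
    have sd: "((\<lambda>t. s i (\<gamma> t)) has_vector_derivative ?ds i) (at 0)"
      using smooth_fun_along_curve[OF E g(1,2) s[OF i]] W(2) p_carrier g(3,5) by simp
    from bounded_bilinear.has_vector_derivative[OF bounded_bilinear_scaleR sd field_along_curve[OF \<gamma> Y[OF i]]]
    show ?thesis using g(3) by simp
  qed
  have "((\<lambda>t. \<Sum>i<k. s i (\<gamma> t) *\<^sub>R Y i (fst (\<gamma> t)) c) has_vector_derivative
      (\<Sum>i<k. s i (x, J) *\<^sub>R field_deriv (Y i) ?u + ?ds i *\<^sub>R Y i x c)) (at 0)"
    by (rule has_vector_derivative_sum, rule summand) simp
  moreover have "(\<Sum>i<k. s i (\<gamma> t) *\<^sub>R Y i (fst (\<gamma> t)) c) = \<sigma> (\<gamma> t) c" if t: "t \<in> V'" for t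
  proof -
    have "\<gamma> t \<in> Z0 M" using V(3) V'(3) t g(4) by blast
    then show ?thesis using rep[OF V'(4)[OF t]] by (simp add: sum_fun_apply)
  qed
  ultimately have "((\<lambda>t. \<sigma> (\<gamma> t) c) has_vector_derivative
      (\<Sum>i<k. s i (x, J) *\<^sub>R field_deriv (Y i) ?u + ?ds i *\<^sub>R Y i x c)) (at 0)"
    by (rule has_vector_derivative_transform_within_open[OF _ V'(1,2)])
  moreover have "representation_deriv \<xi> k s Y c - \<Gamma> ?u (\<sigma> (x, J) c)
      = (\<Sum>i<k. s i (x, J) *\<^sub>R field_deriv (Y i) ?u + ?ds i *\<^sub>R Y i x c)"
  proof -
    have "\<Gamma> ?u (\<sigma> (x, J) c) = (\<Sum>i<k. s i (x, J) *\<^sub>R \<Gamma> ?u (Y i x c))"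
      using rep[OF W(2) p_Z0] by (simp add: sum_fun_apply blinfun.sum_right blinfun.scaleR_right)
    moreover have "representation_deriv \<xi> k s Y c
        = (\<Sum>i<k. ?ds i *\<^sub>R Y i x c + s i (x, J) *\<^sub>R (field_deriv (Y i) ?u + \<Gamma> ?u (Y i x c)))"
      unfolding representation_deriv_def sum_fun_apply[where x = c]
      by (intro sum.cong refl) (use cov_deriv_at_coords(2)[OF dp(1) Y] dp(2) in simp)
    ultimately show ?thesis
      by (simp add: sum_subtractf[symmetric] scaleR_add_right algebra_simps)
  qed
  ultimately show "((\<lambda>t. \<sigma> (\<gamma> t) c) has_vector_derivative
      (representation_deriv \<xi> k s Y c - \<Gamma> ?u (\<sigma> (x, J) c))) (at 0)" by simp
qed

lemma pullback_deriv_coords: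
  assumes \<gamma>: "tangent_curve \<gamma> I \<xi>" and r: "represents k s Y W \<sigma>"
    and d: "((\<lambda>t. \<sigma> (\<gamma> t) c) has_vector_derivative d) (at 0)"
  shows "pullback_deriv M D (x, J) \<xi> \<sigma> \<in> tangent_space M x"
    "pullback_deriv M D (x, J) \<xi> \<sigma> c = d + \<Gamma> (fst (\<xi> C)) (\<sigma> (x, J) c)"
proof -
  have val: "representation_deriv \<xi> k s Y c = d + \<Gamma> (fst (\<xi> C)) (\<sigma> (x, J) c)" if "represents k s Y W \<sigma>" for k s Y W
    using vector_derivative_unique_at[OF d representation_deriv_coords(2)[OF \<gamma> that]] by simp
  have "pullback_deriv M D (x, J) \<xi> \<sigma> = representation_deriv \<xi> k s Y"
    unfolding pullback_deriv_representation
  proof (rule the_equality)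
    fix z assume "\<exists>k s Y W. represents k s Y W \<sigma> \<and> z = representation_deriv \<xi> k s Y"
    then obtain k' s' Y' W' where r': "represents k' s' Y' W' \<sigma>" "z = representation_deriv \<xi> k' s' Y'" by blast
    show "z = representation_deriv \<xi> k s Y"
      unfolding r'(2)
      by (rule tangent_vector_eqI[OF A representation_deriv_coords(1)[OF \<gamma> r'(1)] representation_deriv_coords(1)[OF \<gamma> r] c])
        (simp add: val[OF r'(1)] val[OF r])
  qed (use r in blast)
  then show "pullback_deriv M D (x, J) \<xi> \<sigma> \<in> tangent_space M x"
    "pullback_deriv M D (x, J) \<xi> \<sigma> c = d + \<Gamma> (fst (\<xi> C)) (\<sigma> (x, J) c)"
    using representation_deriv_coords(1)[OF \<gamma> r] val[OF r] by simp_all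
qed

lemma represents_pulled_back_field:
  assumes Y: "Y \<in> vector_fields M"
  shows "represents 1 (\<lambda>_ _. 1) (\<lambda>_. Y) (fst C) (\<lambda>q. Y (fst q))"
proof -
  have "smooth_fun_on (End_atlas M) (fst C) (\<lambda>_. 1)"
    using smooth_on_const[OF open_chart_image[OF E C(1)], of 1] atlas_open_chart_domain[OF E C(1)]
    unfolding smooth_fun_on_def
    by (intro smooth_map_on_chartI[where d = model_chart, OF C(1)]) (simp_all add: comp_def del: End_chart_simps)
  then show ?thesis
    using Y C atlas_open_chart_domain[OF E C(1)] by (simp add: represents_def)
qed

text \<open>In the frame of cut off coordinate fields the coefficients of \<open>J Y\<close> are smooth where the cutoff
  function does not vanish.\<close>

lemma represents_endo_applied_to_field:
  assumes Y: "Y \<in> vector_fields M"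
  obtains k s Z W where "represents k s Z W (\<lambda>q. snd q (Y (fst q)))"
proof -
  obtain \<phi> V where \<phi>: "cutoff M c x \<phi> V" using cutoff_exists[OF M c] by blast
  have \<phi>s: "smooth_fun_on M (carrier M) \<phi>" and V: "open V" "snd c x \<in> V" "V \<subseteq> snd c ` fst c"
    and nz: "\<And>a. a \<in> V \<Longrightarrow> \<phi> (chart_inv c a) \<noteq> 0"
    and F: "\<And>w. cutoff_field M c \<phi> w \<in> vector_fields M"
    using \<phi> unfolding cutoff_def by blast+
  obtain h where h: "bij_betw h {..<DIM('e)} (Basis :: 'e set)"
    using ex_bij_betw_nat_finite[OF finite_Basis] unfolding atLeast0LessThan by blast
  let ?VV = "V \<times> (UNIV :: ('e \<Rightarrow>\<^sub>L 'e) set)"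
  define W where "W = chart_inv C ` ?VV"
  define s where "s i q = inverse (\<phi> (fst q)) * (snd q (Y (fst q)) c \<bullet> h i)" for i :: nat and q :: "'p \<times> ('p, 'e) tendo"
  have oVV: "open ?VV" using V(1) by (simp add: open_Times)
  have VVC: "?VV \<subseteq> snd C ` fst C" unfolding C_image using V(3) by blast
  have W_open: "atlas_open (End_atlas M) W"
    unfolding W_def by (rule atlas_open_chart_inv_image[OF E C(1) oVV VVC])
  have WC: "W \<subseteq> fst C" unfolding W_def using VVC chart_inv_mem[of _ C] by blast
  have "snd C (chart_inv C z) = z" if "z \<in> ?VV" for z
    by (rule chart_chart_inv[OF subsetD[OF VVC that]])
  then have "(\<lambda>z. snd C (chart_inv C z)) ` ?VV = (\<lambda>z. z) ` ?VV" by (rule image_cong[OF refl])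
  then have CW: "snd C ` W = ?VV" unfolding W_def image_image image_ident .
  have pW: "(x, J) \<in> W"
    unfolding W_def
  proof (rule image_eqI)
    show "(x, J) = chart_inv C (snd C (x, J))" by (rule chart_inv_chart[OF E C, symmetric])
    show "snd C (x, J) \<in> ?VV" using V(2) by simp
  qed
  have s_smooth: "smooth_fun_on (End_atlas M) W (s i)" for i
    unfolding smooth_fun_on_def
  proof (rule smooth_map_on_chartI[OF C(1) _ W_open WC])
    have fV: "fst ` ?VV \<subseteq> V" by auto
    have sf: "smooth_on ?VV (\<lambda>z. fst z)" and ss: "smooth_on ?VV (\<lambda>z. snd z)"
      using smooth_on_fst[OF oVV smooth_on_ident[OF oVV]] smooth_on_snd[OF oVV smooth_on_ident[OF oVV]] by simp_all
    note comp = smooth_on_compose[OF oVV V(1) fV sf]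
    have "smooth_on ?VV (\<lambda>z. inverse (\<phi> (chart_inv c (fst z))) *
        (blinfun_apply (snd z) (Y (chart_inv c (fst z)) c) \<bullet> h i))"
      by (intro smooth_on_mult smooth_on_inverse smooth_on_inner smooth_on_blinfun_apply smooth_on_const oVV ss
          comp[of "\<lambda>a. \<phi> (chart_inv c a)"] comp[of "\<lambda>a. Y (chart_inv c a) c"]
          smooth_on_subset[OF smooth_fun_in_chart[OF A \<phi>s c(1)] V(3)]
          smooth_on_subset[OF smooth_on_vector_field[OF A Y c(1)] V(3)] nz) auto
    then have "smooth_on ?VV (snd model_chart \<circ> s i \<circ> chart_inv C)"
    proof (rule smooth_on_cong[OF oVV, rotated])
      fix z assume "z \<in> ?VV"
      then have z: "fst z \<in> snd c ` fst c" using V(3) by auto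
      note y = chart_inv_mem[OF z]
      show "inverse (\<phi> (chart_inv c (fst z))) * (blinfun_apply (snd z) (Y (chart_inv c (fst z)) c) \<bullet> h i)
          = (snd model_chart \<circ> s i \<circ> chart_inv C) z"
        using chart_inv_End_chart[OF A c(1) z, of "snd z"] vector_field_tangent[OF A Y]
        by (simp add: s_def coord_endo_def coord_vec_same[OF A c(1) y])
    qed
    then show "smooth_on (snd C ` W) (snd model_chart \<circ> s i \<circ> chart_inv C)" unfolding CW .
  qed simp_all
  have "snd q (Y (fst q)) = (\<Sum>i<DIM('e). s i q *\<^sub>R cutoff_field M c \<phi> (h i) (fst q))"
    if q: "q \<in> W" for q
  proof -
    obtain y K where yK: "q = (y, K)" by fastforce
    have y: "y \<in> fst c" and K: "K \<in> endos M y" using q WC yK by auto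
    have "snd C q \<in> ?VV" using q CW by blast
    then have ny: "\<phi> y \<noteq> 0" using nz[of "snd c y"] yK chart_inv_chart[OF A c(1) y] by simp
    have KY: "K (Y y) \<in> tangent_space M y" by (rule endosD(1)[OF K vector_field_tangent[OF A Y]])
    have "(\<Sum>i<DIM('e). s i q *\<^sub>R cutoff_field M c \<phi> (h i) y) = (\<Sum>i<DIM('e). (K (Y y) c \<bullet> h i) *\<^sub>R coord_vec M c y (h i))"
      using ny y by (intro sum.cong refl) (simp add: s_def yK cutoff_field_def)
    also have "\<dots> = (\<Sum>b\<in>Basis. (K (Y y) c \<bullet> b) *\<^sub>R coord_vec M c y b)"
      by (rule sum.reindex_bij_betw[OF h])
    also have "\<dots> = K (Y y)"
    proof (rule tangent_vector_eqI[OF A _ KY c(1) y])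
      show "(\<Sum>b\<in>Basis. (K (Y y) c \<bullet> b) *\<^sub>R coord_vec M c y b) \<in> tangent_space M y"
        by (intro sum_in_tangent_space[OF A] scaleR_in_tangent_space[OF A] coord_vec_in_tangent_space[OF A c(1) y])
      show "(\<Sum>b\<in>Basis. (K (Y y) c \<bullet> b) *\<^sub>R coord_vec M c y b) c = K (Y y) c"
        by (simp add: sum_fun_apply coord_vec_same[OF A c(1) y] euclidean_representation)
    qed
    finally show ?thesis using yK by simp
  qed
  then have "represents DIM('e) s (\<lambda>i. cutoff_field M c \<phi> (h i)) W (\<lambda>q. snd q (Y (fst q)))"
    using W_open pW s_smooth F by (simp add: represents_def)
  then show thesis by (rule that)
qed

text \<open>The derivatives of the field used to extend a tangent vector cancel, and what remains is the
  derivative of the endomorphism plus the commutator with the connection form.\<close>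

lemma pullback_deriv_End_coords:
  assumes \<xi>: "\<xi> \<in> TZ0 M (x, J)" and y: "y \<in> tangent_space M x"
  shows "pullback_deriv_End M D (x, J) \<xi> canonical_section y \<in> tangent_space M x"
    "pullback_deriv_End M D (x, J) \<xi> canonical_section y c = (snd (\<xi> C) + bracket (fst (\<xi> C))) (y c)"
proof -
  obtain \<gamma> I where \<gamma>: "tangent_curve \<gamma> I \<xi>" by (rule TZ0_curve[OF \<xi>])
  let ?u = "fst (\<xi> C)" and ?b = "snd (\<xi> C)"
  let ?z = "\<lambda>Y. pullback_deriv M D (x, J) \<xi> (\<lambda>q. snd q (Y (fst q))) - J (pullback_deriv M D (x, J) \<xi> (\<lambda>q. Y (fst q)))"
  obtain V where V: "open V" "0 \<in> V" "V \<subseteq> I" "\<And>t. t \<in> V \<Longrightarrow> \<gamma> t \<in> fst C"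
    using tangent_curve_in_chart[OF \<gamma>] by metis
  have z: "?z Y \<in> tangent_space M x" "?z Y c = (?b + bracket ?u) (Y x c)" if Y: "Y \<in> vector_fields M" for Y
  proof -
    let ?dY = "field_deriv Y ?u"
    note Yx = vector_field_tangent[OF A Y]
    note d1 = field_along_curve[OF \<gamma> Y]
    from bounded_bilinear.has_vector_derivative[OF bounded_bilinear_blinfun_apply tangent_curve_velocity(4)[OF \<gamma>] d1]
    have "((\<lambda>t. blinfun_apply (snd (snd C (\<gamma> t))) (Y (fst (\<gamma> t)) c)) has_vector_derivative (Jc ?dY + ?b (Y x c))) (at 0)"
      using tangent_curveD(3)[OF \<gamma>] by simp
    then have d2: "((\<lambda>t. snd (\<gamma> t) (Y (fst (\<gamma> t))) c) has_vector_derivative (Jc ?dY + ?b (Y x c))) (at 0)"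
    proof (rule has_vector_derivative_transform_within_open[OF _ V(1,2)])
      fix t assume t: "t \<in> V"
      note pt = tangent_curve_point[OF \<gamma> subsetD[OF V(3) t] V(4)[OF t]]
      show "blinfun_apply (snd (snd C (\<gamma> t))) (Y (fst (\<gamma> t)) c) = snd (\<gamma> t) (Y (fst (\<gamma> t))) c"
        using endo_apply_coords[OF A c(1) pt(1,3) Yx] pt(4) by simp
    qed
    note p1 = pullback_deriv_coords[OF \<gamma> represents_pulled_back_field[OF Y] d1]
    obtain k s Z W where r: "represents k s Z W (\<lambda>q. snd q (Y (fst q)))"
      by (rule represents_endo_applied_to_field[OF Y])
    note p2 = pullback_deriv_coords[OF \<gamma> r d2]
    show "?z Y \<in> tangent_space M x"
      by (intro diff_in_tangent_space[OF A] p2(1) endosD(1)[OF J_endo] p1(1))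
    show "?z Y c = (?b + bracket ?u) (Y x c)"
      using p1(2) p2(2) endo_apply_coords[OF A c J_endo p1(1)] endo_apply_coords[OF A c J_endo Yx]
      by (simp add: bracket_def blinfun.add_left blinfun.add_right blinfun.diff_left algebra_simps)
  qed
  obtain Y where Y: "Y \<in> vector_fields M" "Y x = y" using vector_field_extending[OF M y xM] by blast
  have "(THE z. \<exists>Y\<in>vector_fields M. Y x = y \<and> z = ?z Y) = ?z Y"
  proof (rule the_equality)
    fix z' assume "\<exists>Y\<in>vector_fields M. Y x = y \<and> z' = ?z Y"
    then obtain Y' where Y': "Y' \<in> vector_fields M" "Y' x = y" "z' = ?z Y'" by blast
    have "?z Y' = ?z Y"
      by (rule tangent_vector_eqI[OF A z(1)[OF Y'(1)] z(1)[OF Y(1)] c]) (simp only: z(2)[OF Y'(1)] z(2)[OF Y(1)] Y(2) Y'(2))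
    then show "z' = ?z Y" using Y'(3) by simp
  qed (use Y in blast)
  then have "pullback_deriv_End M D (x, J) \<xi> canonical_section y = ?z Y"
    using y by (simp add: pullback_deriv_End_def canonical_section_def)
  then show "pullback_deriv_End M D (x, J) \<xi> canonical_section y \<in> tangent_space M x"
    "pullback_deriv_End M D (x, J) \<xi> canonical_section y c = (?b + bracket ?u) (y c)"
    using z[OF Y(1)] Y(2) by simp_all
qed

section \<open>Horizontal and vertical vectors\<close>

text \<open>A tangent vector \<open>(u, b)\<close> is the sum of the horizontal vector \<open>(u, - [\<Gamma> u, J])\<close> and the vertical
  vector \<open>(0, b + [\<Gamma> u, J])\<close>.\<close>

lemma horizontal_iff:
  "\<xi> \<in> horizontal M D (x, J) \<longleftrightarrow> \<xi> \<in> TZ0 M (x, J) \<and> snd (\<xi> C) = - bracket (fst (\<xi> C))"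
proof -
  have "pullback_deriv_End M D (x, J) \<xi> canonical_section = 0 \<longleftrightarrow> snd (\<xi> C) + bracket (fst (\<xi> C)) = 0"
    if \<xi>: "\<xi> \<in> TZ0 M (x, J)"
  proof
    assume 0: "pullback_deriv_End M D (x, J) \<xi> canonical_section = 0"
    show "snd (\<xi> C) + bracket (fst (\<xi> C)) = 0"
    proof (rule blinfun_eqI)
      fix w
      show "(snd (\<xi> C) + bracket (fst (\<xi> C))) w = blinfun_apply 0 w"
        using pullback_deriv_End_coords(2)[OF \<xi> coord_vec_in_tangent_space[OF A c, of w]]
        by (simp add: 0 coord_vec_same[OF A c])
    qed
  next
    assume 0: "snd (\<xi> C) + bracket (fst (\<xi> C)) = 0"
    show "pullback_deriv_End M D (x, J) \<xi> canonical_section = 0"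
    proof
      fix y
      show "pullback_deriv_End M D (x, J) \<xi> canonical_section y = 0 y"
      proof (cases "y \<in> tangent_space M x")
        case True
        have "pullback_deriv_End M D (x, J) \<xi> canonical_section y = 0"
          by (rule tangent_vector_eqI[OF A pullback_deriv_End_coords(1)[OF \<xi> True] zero_in_tangent_space[OF A] c])
            (simp add: pullback_deriv_End_coords(2)[OF \<xi> True] 0)
        then show ?thesis by simp
      next
        case False
        then show ?thesis by (simp add: pullback_deriv_End_def)
      qed
    qed
  qed
  then show ?thesis by (auto simp: horizontal_def add_eq_0_iff2)
qed

lemma vertical_iff: "\<xi> \<in> vertical M (x, J) \<longleftrightarrow> \<xi> \<in> TZ0 M (x, J) \<and> fst (\<xi> C) = 0"
proof -
  have "dproj M (x, J) \<xi> = 0 \<longleftrightarrow> fst (\<xi> C) = 0" if \<xi>: "\<xi> \<in> TZ0 M (x, J)"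
  proof -
    note dp = dproj_coords[OF TZ0_tangent[OF \<xi>]]
    have "dproj M (x, J) \<xi> = 0" if "fst (\<xi> C) = 0"
      by (rule tangent_vector_eqI[OF A dp(1) zero_in_tangent_space[OF A] c]) (simp add: dp(2) that)
    then show ?thesis using dp(2) by auto
  qed
  then show ?thesis by (auto simp: vertical_def)
qed

lemma anticommutes_iff:
  "(Jc o\<^sub>L b) + (b o\<^sub>L Jc) = 0 \<longleftrightarrow> (\<forall>w. b (Jc w) = - Jc (b w))"
proof
  assume 0: "(Jc o\<^sub>L b) + (b o\<^sub>L Jc) = 0"
  show "\<forall>w. b (Jc w) = - Jc (b w)"
    using arg_cong[OF 0, of "\<lambda>B. blinfun_apply B _"] by (simp add: blinfun.add_left add_eq_0_iff)
next
  assume "\<forall>w. b (Jc w) = - Jc (b w)"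
  then show "(Jc o\<^sub>L b) + (b o\<^sub>L Jc) = 0"
    by (intro blinfun_eqI) (simp add: blinfun.add_left)
qed

text \<open>So the two summands of a tangent vector considered above are tangent to \<open>Z0\<close> again.\<close>

lemma bracket_anticommutes: "(Jc o\<^sub>L bracket u) + (bracket u o\<^sub>L Jc) = 0"
  unfolding anticommutes_iff by (simp add: bracket_def blinfun.diff_left blinfun.diff_right blinfun.minus_right)

lemma vert_of_endo_coords:
  assumes B: "B \<in> endos M x"
  shows "vert_of_endo M (x, J) B \<in> TE" "vert_of_endo M (x, J) B C = (0, endo_coord M c x B)"
proof -
  let ?\<gamma> = "\<lambda>t::real. (x, J + t *\<^sub>R B)"
  have \<gamma>C: "?\<gamma> t \<in> fst C" "snd C (?\<gamma> t) = (snd c x, Jc + t *\<^sub>R endo_coord M c x B)" for t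
    using endo_add_scaleR[OF A c J_endo B] c by simp_all
  have sm: "smooth_on UNIV (\<lambda>t. (snd c x, Jc + t *\<^sub>R endo_coord M c x B))"
    by (intro smooth_on_Pair smooth_on_add smooth_on_scaleR smooth_on_const smooth_on_ident open_UNIV)
  have "snd C \<circ> ?\<gamma> \<circ> chart_inv model_chart = (\<lambda>t. (snd c x, Jc + t *\<^sub>R endo_coord M c x B))"
    unfolding chart_inv_model_chart comp_def using \<gamma>C(2) by simp
  then have \<gamma>: "smooth_map_on {model_chart} (End_atlas M) UNIV ?\<gamma>"
    using \<gamma>C(1) sm by (intro smooth_map_on_chartI[where c = model_chart, OF _ C(1)]) (simp_all del: End_chart_simps)
  have v: "vert_of_endo M (x, J) B = velocity (End_atlas M) ?\<gamma> 0" by (simp add: vert_of_endo_def)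
  show "vert_of_endo M (x, J) B \<in> TE"
    using velocity_in_tangent_space[OF E \<gamma>, of 0] by (simp add: v)
  have "((\<lambda>t. (snd c x, Jc + t *\<^sub>R endo_coord M c x B)) has_vector_derivative (0, endo_coord M c x B)) (at 0)"
    by (intro has_vector_derivative_Pair) (auto intro!: derivative_eq_intros)
  then have "((snd C \<circ> ?\<gamma>) has_vector_derivative (0, endo_coord M c x B)) (at 0)"
    unfolding comp_def \<gamma>C(2) .
  then show "vert_of_endo M (x, J) B C = (0, endo_coord M c x B)"
    unfolding v using C(1) \<gamma>C(1)[of 0] by (simp add: velocity_def vector_derivative_at del: End_chart_simps)
qed

lemma endo_anticommutes_iff:
  assumes B: "B \<in> endos M x"
  shows "(\<forall>v\<in>tangent_space M x. B (J v) = - J (B v)) \<longleftrightarrow>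
    (Jc o\<^sub>L endo_coord M c x B) + (endo_coord M c x B o\<^sub>L Jc) = 0"
proof -
  note app = endo_apply_coords[OF A c]
  have BJ: "B (J v) c = endo_coord M c x B (Jc (v c))" "J (B v) c = Jc (endo_coord M c x B (v c))"
    if v: "v \<in> tangent_space M x" for v
    using app[OF B endosD(1)[OF J_endo v]] app[OF J_endo v] app[OF J_endo endosD(1)[OF B v]] app[OF B v] by simp_all
  show ?thesis
    unfolding anticommutes_iff
  proof (intro iffI allI ballI)
    fix w assume *: "\<forall>v\<in>tangent_space M x. B (J v) = - J (B v)"
    let ?v = "coord_vec M c x w"
    have v: "?v \<in> tangent_space M x" "?v c = w" by (simp_all add: coord_vec_in_tangent_space[OF A c] coord_vec_same[OF A c])
    have "B (J ?v) c = - J (B ?v) c" using * v(1) by simp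
    then show "endo_coord M c x B (Jc w) = - Jc (endo_coord M c x B w)" by (simp add: BJ[OF v(1)] v(2))
  next
    fix v assume *: "\<forall>w. endo_coord M c x B (Jc w) = - Jc (endo_coord M c x B w)" and v: "v \<in> tangent_space M x"
    show "B (J v) = - J (B v)"
      by (rule tangent_vector_eqI[OF A _ _ c])
        (use v * in \<open>simp_all add: BJ endosD(1)[OF B] endosD(1)[OF J_endo] minus_in_tangent_space[OF A]\<close>)
  qed
qed

text \<open>In coordinates the identification of vertical vectors with anticommuting endomorphisms is
  \<open>(0, b) \<mapsto> b\<close>.\<close>

lemma endo_of_vert_coords:
  assumes \<xi>: "\<xi> \<in> vertical M (x, J)"
  shows "endo_of_vert M (x, J) \<xi> \<in> endos M x" "endo_coord M c x (endo_of_vert M (x, J) \<xi>) = snd (\<xi> C)"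
proof -
  have \<xi>': "\<xi> \<in> TZ0 M (x, J)" "fst (\<xi> C) = 0" using \<xi> by (simp_all add: vertical_iff)
  let ?B = "coord_endo M c x (snd (\<xi> C))"
  have B: "?B \<in> endos M x" "endo_coord M c x ?B = snd (\<xi> C)"
    by (simp_all add: coord_endo_in_endos[OF A c] endo_coord_coord_endo[OF A c])
  have "endo_of_vert M (x, J) \<xi> = ?B"
    unfolding endo_of_vert_def fst_conv snd_conv
  proof (rule the_equality)
    have "vert_of_endo M (x, J) ?B = \<xi>"
      by (rule TE_eqI[OF vert_of_endo_coords(1)[OF B(1)] TZ0_tangent[OF \<xi>'(1)]])
        (simp add: vert_of_endo_coords(2)[OF B(1)] B(2) prod_eq_iff \<xi>'(2))
    then show "?B \<in> endos M x \<and> (\<forall>v\<in>tangent_space M x. ?B (J v) = - J (?B v)) \<and> vert_of_endo M (x, J) ?B = \<xi>"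
      using B TZ0_anticommutes[OF \<xi>'(1)] endo_anticommutes_iff[OF B(1)] by simp
    fix B' assume *: "B' \<in> endos M x \<and> (\<forall>v\<in>tangent_space M x. B' (J v) = - J (B' v)) \<and> vert_of_endo M (x, J) B' = \<xi>"
    then have "endo_coord M c x B' = snd (\<xi> C)" using vert_of_endo_coords(2)[of B'] by (metis snd_conv)
    then show "B' = ?B" using endo_eqI[OF A c, of B' ?B] * B by simp
  qed
  then show "endo_of_vert M (x, J) \<xi> \<in> endos M x" "endo_coord M c x (endo_of_vert M (x, J) \<xi>) = snd (\<xi> C)"
    using B by simp_all
qed

section \<open>The almost complex structures of the bundle in coordinates\<close>

text \<open>The horizontal part \<open>(u, - [\<Gamma> u, J])\<close> of \<open>(u, b)\<close> is sent to the horizontal vector over \<open>a u\<close>, and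
  the vertical part \<open>(0, b + [\<Gamma> u, J])\<close> is composed with \<open>J\<close>. In coordinates the summands of a
  decomposition can be read off, which makes it unique.\<close>

lemma split_structure_coords:
  assumes \<xi>: "\<xi> \<in> TZ0 M (x, J)" and a: "a \<in> endos M x"
  shows "split_structure M D a (x, J) \<xi> \<in> TE"
    "split_structure M D a (x, J) \<xi> C =
      (endo_coord M c x a (fst (\<xi> C)),
       (Jc o\<^sub>L (snd (\<xi> C) + bracket (fst (\<xi> C)))) - bracket (endo_coord M c x a (fst (\<xi> C))))"
proof -
  let ?ac = "endo_coord M c x a" and ?u = "fst (\<xi> C)" and ?b = "snd (\<xi> C)"
  let ?val = "(?ac ?u, (Jc o\<^sub>L (?b + bracket ?u)) - bracket (?ac ?u))"
  have b: "?b (Jc w) = - Jc (?b w)" and br: "bracket u (Jc w) = - Jc (bracket u w)" for u w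
    using TZ0_anticommutes[OF \<xi>] bracket_anticommutes unfolding anticommutes_iff by blast+
  have anti: "(Jc o\<^sub>L - bracket u) + (- bracket u o\<^sub>L Jc) = 0"
    "(Jc o\<^sub>L (?b + bracket u)) + ((?b + bracket u) o\<^sub>L Jc) = 0"
    "(Jc o\<^sub>L (Jc o\<^sub>L (?b + bracket u))) + ((Jc o\<^sub>L (?b + bracket u)) o\<^sub>L Jc) = 0" for u
    unfolding anticommutes_iff
    by (simp_all add: blinfun.minus_left blinfun.minus_right blinfun.add_left blinfun.add_right
      blinfun.diff_right b br)
  obtain h where h: "h \<in> TZ0 M (x, J)" "h C = (?u, - bracket ?u)" by (rule TZ0_vector_exists[OF anti(1)])
  obtain v where v: "v \<in> TZ0 M (x, J)" "v C = (0, ?b + bracket ?u)" by (rule TZ0_vector_exists[OF anti(2)])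
  obtain h' where h': "h' \<in> TZ0 M (x, J)" "h' C = (?ac ?u, - bracket (?ac ?u))" by (rule TZ0_vector_exists[OF anti(1)])
  obtain v' where v': "v' \<in> TZ0 M (x, J)" "v' C = (0, Jc o\<^sub>L (?b + bracket ?u))" by (rule TZ0_vector_exists[OF anti(3)])
  have hv: "h \<in> horizontal M D (x, J)" "v \<in> vertical M (x, J)" "h' \<in> horizontal M D (x, J)" "v' \<in> vertical M (x, J)"
    using h v h' v' by (simp_all add: horizontal_iff vertical_iff)
  have sumT: "p + q \<in> TE" if "p \<in> TZ0 M (x, J)" "q \<in> TZ0 M (x, J)" for p q
    by (intro add_in_tangent_space[OF E] TZ0_tangent that)
  let ?P = "\<lambda>\<eta> h v h' v'. \<xi> = h + v \<and> \<eta> = h' + v' \<and> dproj M (x, J) h' = a (dproj M (x, J) h) \<and>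
    endo_of_vert M (x, J) v' = J \<circ> endo_of_vert M (x, J) v"
  have "\<xi> = h + v"
    by (rule TE_eqI[OF TZ0_tangent[OF \<xi>] sumT[OF h(1) v(1)]]) (simp add: h(2) v(2) prod_eq_iff)
  moreover have "dproj M (x, J) h' = a (dproj M (x, J) h)"
  proof (rule tangent_vector_eqI[OF A _ _ c])
    note dh = dproj_coords[OF TZ0_tangent[OF h(1)]] and dh' = dproj_coords[OF TZ0_tangent[OF h'(1)]]
    show "dproj M (x, J) h' \<in> tangent_space M x" "a (dproj M (x, J) h) \<in> tangent_space M x"
      "dproj M (x, J) h' c = a (dproj M (x, J) h) c"
      using dh dh' endosD(1)[OF a] endo_apply_coords[OF A c a dh(1)] h(2) h'(2) by simp_all
  qed
  moreover have "endo_of_vert M (x, J) v' = J \<circ> endo_of_vert M (x, J) v"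
  proof (rule endo_eqI[OF A c])
    note ev = endo_of_vert_coords[OF hv(2)] and ev' = endo_of_vert_coords[OF hv(4)]
    show "endo_of_vert M (x, J) v' \<in> endos M x" "J \<circ> endo_of_vert M (x, J) v \<in> endos M x"
      "endo_coord M c x (endo_of_vert M (x, J) v') = endo_coord M c x (J \<circ> endo_of_vert M (x, J) v)"
      using ev ev' endo_compose[OF A c J_endo ev(1)] v(2) v'(2) by simp_all
  qed
  ultimately have P: "?P (h' + v') h v h' v'" by simp
  have uniq: "\<eta> \<in> TE" "\<eta> C = ?val"
    if H: "h1 \<in> horizontal M D (x, J)" "v1 \<in> vertical M (x, J)" "h2 \<in> horizontal M D (x, J)" "v2 \<in> vertical M (x, J)"
      and P: "?P \<eta> h1 v1 h2 v2" for \<eta> h1 v1 h2 v2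
  proof -
    have h1: "h1 \<in> TZ0 M (x, J)" "snd (h1 C) = - bracket (fst (h1 C))"
      and h2: "h2 \<in> TZ0 M (x, J)" "snd (h2 C) = - bracket (fst (h2 C))"
      and v1: "v1 \<in> TZ0 M (x, J)" "fst (v1 C) = 0" and v2: "v2 \<in> TZ0 M (x, J)" "fst (v2 C) = 0"
      using H by (simp_all add: horizontal_iff vertical_iff)
    show "\<eta> \<in> TE" using P sumT[OF h2(1) v2(1)] by simp
    have u1: "fst (h1 C) = ?u" and b1: "snd (v1 C) = ?b + bracket ?u"
      using P h1(2) v1(2) by (auto simp: algebra_simps)
    note dh1 = dproj_coords[OF TZ0_tangent[OF h1(1)]] and dh2 = dproj_coords[OF TZ0_tangent[OF h2(1)]]
    have "fst (h2 C) = a (dproj M (x, J) h1) c" using P dh2(2) by simp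
    then have u2: "fst (h2 C) = ?ac ?u" using endo_apply_coords[OF A c a dh1(1)] dh1(2) u1 by simp
    have "snd (v2 C) = endo_coord M c x (J \<circ> endo_of_vert M (x, J) v1)"
      using P endo_of_vert_coords(2)[OF H(4)] by simp
    then have b2: "snd (v2 C) = Jc o\<^sub>L (?b + bracket ?u)"
      using endo_compose(2)[OF A c J_endo endo_of_vert_coords(1)[OF H(2)]] endo_of_vert_coords(2)[OF H(2)] b1 by simp
    show "\<eta> C = ?val" using P h2(2) v2(2) u2 b2 by (simp add: prod_eq_iff)
  qed
  have "split_structure M D a (x, J) \<xi> = h' + v'"
    unfolding split_structure_def snd_conv
  proof (rule the_equality)
    show "\<exists>h\<in>horizontal M D (x, J). \<exists>v\<in>vertical M (x, J). \<exists>h'a\<in>horizontal M D (x, J). \<exists>v'a\<in>vertical M (x, J).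
        ?P (h' + v') h v h'a v'a"
      by (rule bexI[OF _ hv(1)], rule bexI[OF _ hv(2)], rule bexI[OF _ hv(3)], rule bexI[OF _ hv(4)]) (rule P)
    fix \<eta> assume "\<exists>h\<in>horizontal M D (x, J). \<exists>v\<in>vertical M (x, J). \<exists>h'\<in>horizontal M D (x, J). \<exists>v'\<in>vertical M (x, J).
        ?P \<eta> h v h' v'"
    then obtain h1 v1 h2 v2 where "h1 \<in> horizontal M D (x, J)" "v1 \<in> vertical M (x, J)"
      "h2 \<in> horizontal M D (x, J)" "v2 \<in> vertical M (x, J)" "?P \<eta> h1 v1 h2 v2" by blast
    from uniq[OF this] uniq[OF hv P] show "\<eta> = h' + v'" by (intro TE_eqI) simp_all
  qed
  then show "split_structure M D a (x, J) \<xi> \<in> TE" "split_structure M D a (x, J) \<xi> C = ?val"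
    using uniq[OF hv P] by simp_all
qed

end

text \<open>Now \<open>J\<close> is the value at \<open>x\<close> of an almost complex structure \<open>s\<close>; \<open>nabla_coord u\<close> is the coordinate
  expression of the covariant derivative of \<open>s\<close> in the direction \<open>u\<close>.\<close>

locale acs_point = complex_structure_point M D c x \<Gamma> "s x"
  for M :: "('p, 'e::euclidean_space) chart set" and D c x \<Gamma> and s :: "'p \<Rightarrow> ('p, 'e) tendo" +
  assumes s: "almost_complex_structure M s"
begin

definition s_coord :: "'e \<Rightarrow> 'e \<Rightarrow>\<^sub>L 'e" where
  "s_coord a = endo_coord M c (chart_inv c a) (s (chart_inv c a))"

abbreviation s_deriv :: "'e \<Rightarrow> 'e \<Rightarrow>\<^sub>L 'e" where
  "s_deriv \<equiv> frechet_derivative s_coord (at (snd c x))"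

abbreviation section_diff :: "('p, 'e) tvec \<Rightarrow> ('p, 'e) Ztvec" where
  "section_diff \<equiv> differential M (End_atlas M) (\<lambda>y. (y, s y)) x"

definition nabla_coord :: "'e \<Rightarrow> 'e \<Rightarrow>\<^sub>L 'e" where
  "nabla_coord u = s_deriv u + bracket u"

lemma s_smooth: "smooth_map_on M (End_atlas M) (carrier M) (\<lambda>x. (x, s x))"
  and s_cstructs: "y \<in> carrier M \<Longrightarrow> s y \<in> cstructs M y"
  and s_endo: "y \<in> carrier M \<Longrightarrow> s y \<in> endos M y"
  using s by (simp_all add: almost_complex_structure_def cstructs_def)

lemma s_coord_at [simp]: "s_coord (snd c x) = Jc"
  using A c by (simp add: s_coord_def)

lemma snd_c_x: "snd c x \<in> snd c ` fst c"
  using c by blast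

lemma s_coord_has_derivative:
  "(s_coord has_derivative s_deriv) (at (snd c x))"
proof (rule smooth_on_has_derivative[OF _ snd_c_x])
  show "smooth_on (snd c ` fst c) s_coord"
    unfolding s_coord_def[abs_def] by (rule smooth_on_endo_field[OF A s_smooth s_endo c(1)])
qed

text \<open>Differentiate \<open>s\<^sup>2 = -1\<close>.\<close>

lemma s_coord_derivative_anticommutes:
  "(Jc o\<^sub>L s_deriv u) + (s_deriv u o\<^sub>L Jc) = 0"
proof -
  have "((\<lambda>a. s_coord a o\<^sub>L s_coord a) has_derivative (\<lambda>h. (Jc o\<^sub>L s_deriv h) + (s_deriv h o\<^sub>L Jc))) (at (snd c x))"
    using bounded_bilinear.FDERIV[OF bounded_bilinear_blinfun_compose s_coord_has_derivative s_coord_has_derivative] by simp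
  moreover have "((\<lambda>a. s_coord a o\<^sub>L s_coord a) has_derivative (\<lambda>h. 0)) (at (snd c x))"
  proof (rule has_derivative_transform_within_open[OF has_derivative_const open_chart_image[OF A c(1)] snd_c_x])
    fix a assume "a \<in> snd c ` fst c"
    then have y: "chart_inv c a \<in> fst c" by (rule chart_inv_mem)
    note yM = carrierI[OF c(1) y]
    show "- id_blinfun = s_coord a o\<^sub>L s_coord a"
      unfolding s_coord_def using in_cstructs_iff[OF A c(1) y s_endo[OF yM]] s_cstructs[OF yM] by simp
  qed
  ultimately have "(\<lambda>h. (Jc o\<^sub>L s_deriv h) + (s_deriv h o\<^sub>L Jc)) = (\<lambda>h. 0)" by (rule has_derivative_unique)
  then show ?thesis by meson
qed

lemma differential_section_coords:
  assumes v: "v \<in> tangent_space M x"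
  shows "section_diff v \<in> TZ0 M (x, s x)"
    "section_diff v C = (v c, s_deriv (v c))"
proof -
  have T: "section_diff v \<in> TE"
    by (rule differential_in_tangent_space[OF A E s_smooth xM xM v])
  have "((\<lambda>a. (a, s_coord a)) has_derivative (\<lambda>h. (h, s_deriv h))) (at (snd c x))"
    by (intro has_derivative_Pair has_derivative_ident s_coord_has_derivative)
  then have "((snd C \<circ> (\<lambda>y. (y, s y)) \<circ> chart_inv c) has_derivative (\<lambda>h. (h, s_deriv h))) (at (snd c x))"
    by (rule has_derivative_transform_within_open[OF _ open_chart_image[OF A c(1)] snd_c_x])
      (simp add: s_coord_def)
  from frechet_derivative_at[OF this, symmetric]
  show coords: "section_diff v C = (v c, s_deriv (v c))"
    using differential_in_chart[OF A E s_smooth xM xM c C v] by simp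
  show "section_diff v \<in> TZ0 M (x, s x)"
    unfolding TZ0_iff coords using T s_coord_derivative_anticommutes by simp
qed

text \<open>The two conditions on the right are the equality of the base components and, given this, of the
  fibre components. In the latter the commutator with \<open>\<Gamma> (a u)\<close> moves to the left-hand side, where it
  completes the derivative of \<open>s\<close> along \<open>a u\<close> to the covariant derivative.\<close>

lemma holomorphic_at_iff:
  assumes v: "v \<in> tangent_space M x" and j': "j' \<in> endos M x" and a: "a \<in> endos M x"
  shows "section_diff (j' v)
      = split_structure M D a (x, s x) (section_diff v) \<longleftrightarrow>
    j' v = a v \<and> nabla_coord (endo_coord M c x a (v c)) = Jc o\<^sub>L nabla_coord (v c)" (is "?l = ?r \<longleftrightarrow> _")
proof -
  let ?ac = "endo_coord M c x a"
  note jv = endosD(1)[OF j' v] and av = endosD(1)[OF a v]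
  note dv = differential_section_coords[OF v] and djv = differential_section_coords[OF jv]
  note sp = split_structure_coords[OF dv(1) a]
  have avc: "a v c = ?ac (v c)" by (rule endo_apply_coords[OF A c a v])
  have "?l = ?r \<longleftrightarrow> ?l C = ?r C"
  proof
    show "?l = ?r" if "?l C = ?r C" using that by (rule TE_eqI[OF TZ0_tangent[OF djv(1)] sp(1)])
  qed simp
  also have "\<dots> \<longleftrightarrow> j' v c = a v c \<and> nabla_coord (?ac (v c)) = Jc o\<^sub>L nabla_coord (v c)"
    unfolding sp(2) dv(2) djv(2) nabla_coord_def avc by (auto simp: algebra_simps)
  also have "j' v c = a v c \<longleftrightarrow> j' v = a v" using tangent_vector_eqI[OF A jv av c] by auto
  finally show ?thesis .
qed

section \<open>Condition A at a point\<close>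

text \<open>The product rule for \<open>Z = s W\<close>, which justifies calling \<open>nabla_coord\<close> a covariant derivative.\<close>

lemma connection_Leibniz:
  assumes X: "X \<in> vector_fields M" and W: "W \<in> vector_fields M" and Z: "Z \<in> vector_fields M"
    and ZW: "\<And>y. y \<in> carrier M \<Longrightarrow> Z y = s y (W y)"
  shows "D X Z x c = Jc (D X W x c) + nabla_coord (X x c) (W x c)"
proof -
  let ?W = "\<lambda>a. W (chart_inv c a) c"
  have inv: "chart_inv c (snd c x) = x" using A c by simp
  have dW: "(?W has_derivative frechet_derivative ?W (at (snd c x))) (at (snd c x))"
    by (rule smooth_on_has_derivative[OF smooth_on_vector_field[OF A W c(1)] snd_c_x])
  have "((\<lambda>a. s_coord a (?W a)) has_derivative
      (\<lambda>h. Jc (frechet_derivative ?W (at (snd c x)) h) + s_deriv h (W x c))) (at (snd c x))"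
    using bounded_bilinear.FDERIV[OF bounded_bilinear_blinfun_apply s_coord_has_derivative dW] by (simp add: inv)
  then have "((\<lambda>a. Z (chart_inv c a) c) has_derivative
      (\<lambda>h. Jc (frechet_derivative ?W (at (snd c x)) h) + s_deriv h (W x c))) (at (snd c x))"
  proof (rule has_derivative_transform_within_open[OF _ open_chart_image[OF A c(1)] snd_c_x])
    fix a assume "a \<in> snd c ` fst c"
    then have y: "chart_inv c a \<in> fst c" by (rule chart_inv_mem)
    note yM = carrierI[OF c(1) y]
    show "s_coord a (?W a) = Z (chart_inv c a) c"
      unfolding s_coord_def ZW[OF yM]
      by (rule endo_apply_coords[OF A c(1) y s_endo[OF yM] vector_field_tangent[OF A W], symmetric])
  qed
  from frechet_derivative_at[OF this, symmetric]
  have "D X Z x c = Jc (frechet_derivative ?W (at (snd c x)) (X x c)) + s_deriv (X x c) (W x c) + \<Gamma> (X x c) (Z x c)"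
    using connection_coords[OF X Z] by simp
  moreover have "Z x c = Jc (W x c)"
    unfolding ZW[OF xM] by (rule endo_apply_coords[OF A c J_endo vector_field_tangent[OF A W]])
  ultimately show ?thesis
    using connection_coords[OF X W]
    by (simp add: nabla_coord_def bracket_def blinfun.add_left blinfun.diff_left blinfun.add_right)
qed

end

definition condition_A_at ::
  "('p, 'e::real_normed_vector) chart set \<Rightarrow> ('p, 'e) conn \<Rightarrow>
    ('p \<Rightarrow> ('p, 'e) tendo) \<Rightarrow> ('p \<Rightarrow> ('p, 'e) tendo) \<Rightarrow> 'p \<Rightarrow> bool" where
  "condition_A_at M D j s x \<longleftrightarrow> (\<forall>X\<in>type10_fields M j. \<forall>Z\<in>type10_fields M s.
     s x (fst (complex_conn D X Z) x) = - snd (complex_conn D X Z) x \<and>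
     s x (snd (complex_conn D X Z) x) = fst (complex_conn D X Z) x)"

lemma type10_fields_iff:
  "Z \<in> type10_fields M s \<longleftrightarrow> fst Z \<in> vector_fields M \<and> snd Z \<in> vector_fields M \<and>
    (\<forall>x\<in>carrier M. s x (fst Z x) = - snd Z x \<and> s x (snd Z x) = fst Z x)"
  by (cases Z) (simp add: type10_fields_def)

text \<open>The real and imaginary parts of the complex derivative are vector fields in any case, so only
  the pointwise condition on their values is left.\<close>

lemma condition_A_pointwise:
  fixes M :: "('p, 'e::euclidean_space) chart set"
  assumes M: "smooth_manifold M" and D: "linear_connection M D"
  shows "condition_A M D j s \<longleftrightarrow> (\<forall>x\<in>carrier M. condition_A_at M D j s x)"
proof -
  have A: "smooth_atlas M" using M by (simp add: smooth_manifold_def)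
  have "fst (complex_conn D X Z) \<in> vector_fields M" "snd (complex_conn D X Z) \<in> vector_fields M"
    if "X \<in> type10_fields M j" "Z \<in> type10_fields M s" for X Z
    using that unfolding type10_fields_iff complex_conn_def fst_conv snd_conv
    by (blast intro: connection_field[OF M D] vector_field_add[OF A] vector_field_diff[OF A])+
  then have "complex_conn D X Z \<in> type10_fields M s \<longleftrightarrow>
      (\<forall>x\<in>carrier M. s x (fst (complex_conn D X Z) x) = - snd (complex_conn D X Z) x \<and>
        s x (snd (complex_conn D X Z) x) = fst (complex_conn D X Z) x)"
    if "X \<in> type10_fields M j" "Z \<in> type10_fields M s" for X Z
    using that unfolding type10_fields_iff[of "complex_conn D X Z"] by blast
  then show ?thesis unfolding condition_A_def condition_A_at_def by blast
qed

text \<open>A field of type \<open>(1,0)\<close> is \<open>j Y + \<i> Y\<close> with a real field \<open>Y\<close>, which may take any value at \<open>x\<close>.\<close>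

lemma type10_fieldD:
  assumes "X \<in> type10_fields M j"
  shows "fst X \<in> vector_fields M" "snd X \<in> vector_fields M"
    "\<And>y. y \<in> carrier M \<Longrightarrow> fst X y = j y (snd X y)"
  using assms by (simp_all add: type10_fields_iff)

lemma type10_fieldI:
  fixes M :: "('p, 'e::euclidean_space) chart set"
  assumes A: "smooth_atlas M" and j: "almost_complex_structure M j" and Y: "Y \<in> vector_fields M"
  shows "(\<lambda>y. if y \<in> carrier M then j y (Y y) else 0, Y) \<in> type10_fields M j"
proof -
  have e: "j y \<in> endos M y" and jj: "v \<in> tangent_space M y \<Longrightarrow> j y (j y v) = - v" if "y \<in> carrier M" for y v
    using j that by (simp_all add: almost_complex_structure_def cstructs_def)
  have "(\<lambda>y. if y \<in> carrier M then j y (Y y) else 0) \<in> vector_fields M"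
    by (rule vector_field_apply_endo[OF A _ e Y]) (use j in \<open>simp add: almost_complex_structure_def\<close>)
  then show ?thesis using Y jj vector_field_tangent[OF A Y] by (simp add: type10_fields_def)
qed

context acs_point
begin

text \<open>Let \<open>P + \<i> Q\<close> be the derivative of \<open>s W + \<i> W\<close> along \<open>j Y + \<i> Y\<close>. By the product rule
  \<open>s Q - P = s (\<nabla>\<^sub>Y s) W - (\<nabla>\<^bsub>j Y\<^esub> s) W\<close>, the derivatives of \<open>W\<close> having cancelled, and \<open>s Q = P\<close> implies
  \<open>s P = - Q\<close>. Fields \<open>Y\<close> and \<open>W\<close> with arbitrary values at \<open>x\<close> exist.\<close>

lemma condition_A_at_iff:
  assumes j: "almost_complex_structure M j"
  shows "condition_A_at M D j s x \<longleftrightarrow>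
    (\<forall>v\<in>tangent_space M x. nabla_coord (endo_coord M c x (j x) (v c)) = Jc o\<^sub>L nabla_coord (v c))"
proof -
  have jx: "j x \<in> endos M x" using j xM by (simp add: almost_complex_structure_def cstructs_def)
  let ?jc = "endo_coord M c x (j x)"
  have key: "s x (fst (complex_conn D X Z) x) = - snd (complex_conn D X Z) x \<and>
      s x (snd (complex_conn D X Z) x) = fst (complex_conn D X Z) x \<longleftrightarrow>
      nabla_coord (?jc (snd X x c)) (snd Z x c) = Jc (nabla_coord (snd X x c) (snd Z x c))"
    if X: "X \<in> type10_fields M j" and Z: "Z \<in> type10_fields M s" for X Z
  proof -
    note Y = type10_fieldD[OF X] and W = type10_fieldD[OF Z]
    let ?P = "fst (complex_conn D X Z) x" and ?Q = "snd (complex_conn D X Z) x"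
    have P: "?P = D (fst X) (fst Z) x - D (snd X) (snd Z) x" and Q: "?Q = D (fst X) (snd Z) x + D (snd X) (fst Z) x"
      by (simp_all add: complex_conn_def)
    note DT = vector_field_tangent[OF A connection_field[OF M D]]
    have PT: "?P \<in> tangent_space M x" and QT: "?Q \<in> tangent_space M x"
      unfolding P Q by (intro diff_in_tangent_space[OF A] add_in_tangent_space[OF A] DT Y W)+
    have Xc: "fst X x c = ?jc (snd X x c)"
      unfolding Y(3)[OF xM] by (rule endo_apply_coords[OF A c jx vector_field_tangent[OF A Y(2)]])
    have Qc: "s x ?Q c = Jc (D (fst X) (snd Z) x c) - D (snd X) (snd Z) x c + Jc (nabla_coord (snd X x c) (snd Z x c))"
      unfolding endo_apply_coords[OF A c J_endo QT] unfolding Q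
      by (simp add: connection_Leibniz[OF Y(2) W(2,1,3)] blinfun.add_right)
    have Pc: "?P c = Jc (D (fst X) (snd Z) x c) + nabla_coord (?jc (snd X x c)) (snd Z x c) - D (snd X) (snd Z) x c"
      unfolding P by (simp add: connection_Leibniz[OF Y(1) W(2,1,3)] Xc)
    have "s x ?Q = ?P \<longleftrightarrow> s x ?Q c = ?P c"
    proof
      show "s x ?Q = ?P" if "s x ?Q c = ?P c"
        using that by (rule tangent_vector_eqI[OF A endosD(1)[OF J_endo QT] PT c])
    qed simp
    also have "\<dots> \<longleftrightarrow> nabla_coord (?jc (snd X x c)) (snd Z x c) = Jc (nabla_coord (snd X x c) (snd Z x c))"
      unfolding Qc Pc by (auto simp: algebra_simps)
    finally have iff: "s x ?Q = ?P \<longleftrightarrow> nabla_coord (?jc (snd X x c)) (snd Z x c) = Jc (nabla_coord (snd X x c) (snd Z x c))" .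
    have "s x ?P = - ?Q" if "s x ?Q = ?P"
      using J QT that unfolding cstructs_def by fastforce
    with iff show ?thesis by blast
  qed
  show ?thesis
  proof
    assume *: "condition_A_at M D j s x"
    show "\<forall>v\<in>tangent_space M x. nabla_coord (?jc (v c)) = Jc o\<^sub>L nabla_coord (v c)"
    proof (intro ballI blinfun_eqI)
      fix v w assume v: "v \<in> tangent_space M x"
      obtain Y where Y: "Y \<in> vector_fields M" "Y x = v" using vector_field_extending[OF M v xM] by blast
      obtain W where W: "W \<in> vector_fields M" "W x = coord_vec M c x w"
        using vector_field_extending[OF M coord_vec_in_tangent_space[OF A c] xM] by blast
      note X = type10_fieldI[OF A j Y(1)] and Z = type10_fieldI[OF A s W(1)]
      show "nabla_coord (?jc (v c)) w = (Jc o\<^sub>L nabla_coord (v c)) w"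
        using key[OF X Z] * X Z Y(2) W(2) unfolding condition_A_at_def by (simp add: coord_vec_same[OF A c])
    qed
  next
    assume *: "\<forall>v\<in>tangent_space M x. nabla_coord (?jc (v c)) = Jc o\<^sub>L nabla_coord (v c)"
    show "condition_A_at M D j s x"
      unfolding condition_A_at_def
    proof (intro ballI)
      fix X Z assume X: "X \<in> type10_fields M j" and Z: "Z \<in> type10_fields M s"
      have "snd X x \<in> tangent_space M x"
        using X by (auto simp: type10_fields_def intro: vector_field_tangent[OF A])
      then show "s x (fst (complex_conn D X Z) x) = - snd (complex_conn D X Z) x \<and>
          s x (snd (complex_conn D X Z) x) = fst (complex_conn D X Z) x"
        using key[OF X Z] * by simp
    qed
  qed
qed

end

lemma acs_point_exists:
  fixes M :: "('p, 'e::euclidean_space) chart set"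
  assumes M: "smooth_manifold M" and D: "linear_connection M D" and s: "almost_complex_structure M s"
    and x: "x \<in> carrier M"
  obtains c \<Gamma> where "acs_point M D c x \<Gamma> s"
proof -
  obtain c where c: "c \<in> M" "x \<in> fst c" using x by (rule carrierE)
  obtain \<Gamma> :: "'e \<Rightarrow> 'e \<Rightarrow>\<^sub>L 'e" where \<Gamma>: "\<And>X Y. X \<in> vector_fields M \<Longrightarrow> Y \<in> vector_fields M \<Longrightarrow>
      D X Y x c = frechet_derivative (\<lambda>a. Y (chart_inv c a) c) (at (snd c x)) (X x c) + \<Gamma> (X x c) (Y x c)"
    using connection_in_chart[OF M D c] by blast
  have "s x \<in> cstructs M x" using s x by (simp add: almost_complex_structure_def)
  then have "acs_point M D c x \<Gamma> s" by unfold_locales (use M D c \<Gamma> s in auto)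
  then show thesis by (rule that)
qed

text \<open>Both almost complex structures on the bundle are \<open>split_structure\<close>s, which differ in the
  structure \<open>a\<close> on the horizontal part only; this handles all cases at once.\<close>

lemma holomorphic_section_iff:
  fixes M :: "('p, 'e::euclidean_space) chart set"
  assumes M: "smooth_manifold M" and D: "linear_connection M D" and s: "almost_complex_structure M s"
    and j': "almost_complex_structure M j'" and a: "almost_complex_structure M a"
    and \<J>: "\<And>x. x \<in> carrier M \<Longrightarrow> \<J> (x, s x) = split_structure M D (a x) (x, s x)"
  shows "holomorphic_section M j' \<J> s \<longleftrightarrow> (\<forall>x\<in>carrier M. j' x = a x) \<and> condition_A M D a s"
proof -
  have "(\<forall>v\<in>tangent_space M x. differential M (End_atlas M) (\<lambda>y. (y, s y)) x (j' x v) =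
        \<J> (x, s x) (differential M (End_atlas M) (\<lambda>y. (y, s y)) x v)) \<longleftrightarrow>
      j' x = a x \<and> condition_A_at M D a s x" if x: "x \<in> carrier M" for x
  proof -
    obtain c \<Gamma> where "acs_point M D c x \<Gamma> s" using acs_point_exists[OF M D s x] by blast
    then interpret acs_point M D c x \<Gamma> s .
    have e: "j' x \<in> endos M x" "a x \<in> endos M x"
      using j' a x by (simp_all add: almost_complex_structure_def cstructs_def)
    have "j' x = a x \<longleftrightarrow> (\<forall>v\<in>tangent_space M x. j' x v = a x v)"
      using endosD(4)[OF e(1)] endosD(4)[OF e(2)] by (metis ext)
    then show ?thesis
      unfolding condition_A_at_iff[OF a] \<J>[OF x] using holomorphic_at_iff[OF _ e] by blast
  qed
  then show ?thesis
    unfolding holomorphic_section_def condition_A_pointwise[OF M D] by blast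
qed

lemma type10_fields_cong:
  assumes "\<And>x. x \<in> carrier M \<Longrightarrow> j x = k x"
  shows "type10_fields M j = type10_fields M k"
  unfolding type10_fields_def using assms by auto

theorem proposition1:
  fixes M :: "('m, 'e::euclidean_space) chart set"
    and D :: "('m, 'e) conn"
    and j j\<^sub>1 j\<^sub>2 :: "'m \<Rightarrow> ('m, 'e) tendo"
    and n :: nat
  assumes "smooth_manifold M" and "DIM('e) = 2 * n"
    and "linear_connection M D"
    and "almost_complex_structure M j"
    and "almost_complex_structure M j\<^sub>1"
    and "almost_complex_structure M j\<^sub>2"
  shows "(holomorphic_section M j\<^sub>2 (J_section M D j) j\<^sub>1 \<longleftrightarrow>
            (\<forall>x\<in>carrier M. j\<^sub>2 x = j x) \<and> condition_A M D j j\<^sub>1) \<and>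
         (holomorphic_section M j (J_section M D j) j \<longleftrightarrow> condition_A M D j j) \<and>
         (holomorphic_section M j (J_nabla M D) j\<^sub>1 \<longleftrightarrow>
            (\<forall>x\<in>carrier M. j\<^sub>1 x = j x) \<and> condition_A M D j j)"
proof (intro conjI)
  note M = assms(1) and D = assms(3) and j = assms(4) and j1 = assms(5) and j2 = assms(6)
  show "holomorphic_section M j\<^sub>2 (J_section M D j) j\<^sub>1 \<longleftrightarrow>
      (\<forall>x\<in>carrier M. j\<^sub>2 x = j x) \<and> condition_A M D j j\<^sub>1"
    by (rule holomorphic_section_iff[OF M D j1 j2 j]) (simp add: J_section_def)
  have "holomorphic_section M j (J_section M D j) j \<longleftrightarrow> (\<forall>x\<in>carrier M. j x = j x) \<and> condition_A M D j j"
    by (rule holomorphic_section_iff[OF M D j j j]) (simp add: J_section_def)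
  then show "holomorphic_section M j (J_section M D j) j \<longleftrightarrow> condition_A M D j j" by simp
  have "holomorphic_section M j (J_nabla M D) j\<^sub>1 \<longleftrightarrow>
      (\<forall>x\<in>carrier M. j x = j\<^sub>1 x) \<and> condition_A M D j\<^sub>1 j\<^sub>1"
    by (rule holomorphic_section_iff[OF M D j1 j j1]) (simp add: J_nabla_def)
  moreover have "condition_A M D j\<^sub>1 j\<^sub>1 \<longleftrightarrow> condition_A M D j j" if "\<forall>x\<in>carrier M. j x = j\<^sub>1 x"
    unfolding condition_A_def using type10_fields_cong[of M j j\<^sub>1] that by simp
  ultimately show "holomorphic_section M j (J_nabla M D) j\<^sub>1 \<longleftrightarrow>
      (\<forall>x\<in>carrier M. j\<^sub>1 x = j x) \<and> condition_A M D j j" by metis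
qed

end
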